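(* Let $G$ be an $H$-type group, $f\in L^1(G)$, $\lambda\in\mathfrak z^*\setminus\{0\}$ and $\nu\in S(\mathfrak v^* )$. 1. For $\eta\in\mathfrak v^*$, let $\eta_{\nu,\lambda}$ be the orthogonal projection of $\eta$ onto $\mathrm{Span}\{\nu,J_{\hat\lambda}\nu\}$. Then $$\mathcal F_\lambda(I_{\nu,\lambda}f)(\pi_{(\eta,0)})=2\pi|\lambda|^{-1}\,J_0\big(|\eta_{\nu,\lambda}|\,|\lambda|^{-1}\big)\,\mathcal F(f)(\pi_{(\eta,0)}),$$ where $J_0$ is the Bessel function of the first kind of order zero. 2. For $\mu\in\mathfrak z^*\setminus\{0\}$ with $\lambda\cdot\mu=2k|\lambda|^3$ for some $k\in\mathbb Z$, $$\mathcal F_\lambda(I_{\nu,\lambda}f)(\pi_\mu)=2\pi|\lambda|^{-1}\,\mathcal J_{\nu,\lambda}(\mu)\circ\mathcal F(f)(\pi_\mu)$$ as bounded operators on Bargmann–Fock space $\mathcal F(\mathbb C^n)$.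
   Context: $H$-type group: $\mathfrak g$ is a finite-dimensional real Lie algebra with $[\mathfrak g,[\mathfrak g,\mathfrak g]]=0$ and an inner product; $\mathfrak z\ne0$ is its center, $\mathfrak v\neq 0$ the orthogonal complement of $\mathfrak z$, $2n=\dim\mathfrak v$, $m=\dim\mathfrak z$. For $\mu\in\mathfrak z^*$ let $J_\mu:\mathfrak v\to\mathfrak v$ be the skew-adjoint map with $\langle J_\mu V,W\rangle=\mu([V,W])$; one requires $J_\mu^2=-|\mu|^2\mathrm{Id}$ for all $\mu$. $G$ is $\mathfrak v\times\mathfrak z$ with product $(x,u)(x',u')=(x+x',u+u'+\tfrac12[x,x'])$ and Haar measure $dx\,du$. The inner product identifies $\mathfrak v^*\cong\mathfrak v$, $\mathfrak z^*\cong\mathfrak z$; $S(\mathfrak v^* )$ is the unit sphere; $\hat\lambda=\lambda/|\lambda|$. X-ray transform: $\gamma_{\nu,\lambda}(s)=\big(e^{sJ_\lambda}J_\lambda^{-1}\nu,\tfrac{s}{2|\lambda|}\hat\lambda\big)$, $\Gamma_\lambda=\{(0,j\pi|\lambda|^{-2}\hat\lambda):j\in\mathbb Z\}$, $G_\lambda=G/\Gamma_\lambda$ with the Haar measure for which $\int_Gf=\int_{G_\lambda}\sum_{\gamma\in\Gamma_\lambda}f(g\gamma)\,dg$, and $I_{\nu,\lambda}f(x,u)=\int_{\mathbb R}f((x,u)\gamma_{\nu,\lambda}(s))ds\in L^1(G_\lambda)$. Representations: $\mathcal F(\mathbb C^n)$ is the Hilbert space of holomorphic $F:\mathbb C^n\to\mathbb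 C$ with $\pi^{-n}\int|F(\zeta)|^2e^{-|\zeta|^2}d\zeta<\infty$. For $h>0$, $z\in\mathbb C^n$, $t\in\mathbb R$, $\pi_h(z,t)F(\zeta)=e^{iht-\sqrt{h/2}\,\zeta\cdot\bar z-\frac h4|z|^2}F(\zeta+\sqrt{h/2}\,z)$. For $\mu\in\mathfrak z^*\setminus\{0\}$ fix an orthogonal map $R_\mu:\mathbb R^{2n}\to\mathfrak v$, depending only on $\mu/|\mu|$, with $J_\mu=|\mu|R_\mu JR_\mu^t$, where $J$ is multiplication by $i$ on $\mathbb R^{2n}\cong\mathbb C^n$ ($z=x+iy$). Then $\pi_\mu(x,u)=\pi_{|\mu|}\big(R_\mu^tx,\tfrac{\mu\cdot u}{|\mu|}\big)$ is an irreducible unitary representation of $G$ on $\mathcal F(\mathbb C^n)$, which descends to $G_\lambda$ exactly when $\mu\cdot\lambda\in2|\lambda|^3\mathbb Z$. For $\eta\in\mathfrak v^*$, $\pi_{(\eta,0)}(x,u)=e^{i\eta(x)}$, a one-dimensional representation of $G$ and of $G_\lambda$. Fourier transforms: $\mathcal F(f)(\pi)=\int_Gf(g)\pi(g)^*dg$ for $f\in L^1(G)$, and $\mathcal F_\lambda(f)(\pi)=\int_{G_\lambda}f(g)\pi(g)^*dg$ for $f\in L^1(G_\lambda)$ and $\pi$ descending to $G_\lambda$. Multiplier: for $\mu\cdot\lambda\in 2|\lambda|^3\mathbb Z$, $\mathcal J_{\nu,\lambda}(\mu)=\frac{|\lambda|}{2\pi}\int_0^{2\pi|\lambda|^{-1}}\pi_\mu(\gamma_{\nu,\lambda}(s))\,ds$.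 *)

theory Defs
  imports "HOL-Analysis.Analysis"
begin

section \<open>H-type algebras\<close>

text \<open>
  The Lie algebra is a Euclidean space \<open>'g\<close> with a bracket \<open>br\<close>. Duals are identified with the
  spaces themselves by the inner product, so a covector on the centre (on its orthogonal complement)
  is an element of that subspace and the pairing is \<open>\<bullet>\<close>.
\<close>

definition lie_algebra :: "('g::euclidean_space \<Rightarrow> 'g \<Rightarrow> 'g) \<Rightarrow> bool" where
  "lie_algebra br \<longleftrightarrow> bilinear br \<and> (\<forall>X. br X X = 0) \<and>
     (\<forall>X Y Z. br X (br Y Z) + br Y (br Z X) + br Z (br X Y) = 0)"

definition lie_center :: "('g::euclidean_space \<Rightarrow> 'g \<Rightarrow> 'g) \<Rightarrow> 'g set" where
  "lie_center br = {Z. \<forall>X. br X Z = 0}"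

definition horizontal :: "('g::euclidean_space \<Rightarrow> 'g \<Rightarrow> 'g) \<Rightarrow> 'g set" where
  "horizontal br = orthogonal_comp (lie_center br)"

definition J_map :: "('g::euclidean_space \<Rightarrow> 'g \<Rightarrow> 'g) \<Rightarrow> 'g \<Rightarrow> 'g \<Rightarrow> 'g" where
  "J_map br \<mu> V = (THE U. U \<in> horizontal br \<and> (\<forall>W\<in>horizontal br. U \<bullet> W = \<mu> \<bullet> br V W))"

definition h_type :: "('g::euclidean_space \<Rightarrow> 'g \<Rightarrow> 'g) \<Rightarrow> bool" where
  "h_type br \<longleftrightarrow> lie_algebra br \<and> (\<forall>X Y Z. br X (br Y Z) = 0) \<and>
     lie_center br \<noteq> {0} \<and> horizontal br \<noteq> {0} \<and>
     (\<forall>\<mu>\<in>lie_center br. \<forall>V\<in>horizontal br.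
        J_map br \<mu> (J_map br \<mu> V) = - ((norm \<mu>)\<^sup>2 *\<^sub>R V))"

text \<open>
  The group: the pair \<open>(x, u)\<close> in \<open>\<vv> \<times> \<zz>\<close> is encoded as the element \<open>g = x + u\<close> of the orthogonal
  direct sum \<open>'g\<close>. The bracket ignores central components, so the product below is
  \<open>(x + x', u + u' + [x, x']/2)\<close>; the Haar measure \<open>dx du\<close> is \<open>lborel\<close> on \<open>'g\<close>; and for
  \<open>\<eta>\<close> in \<open>\<vv>\<close>, \<open>\<mu>\<close> in \<open>\<zz>\<close> one has \<open>\<eta> \<bullet> g = \<eta>(x)\<close>, \<open>\<mu> \<bullet> g = \<mu>(u)\<close>.
\<close>

definition hmult :: "('g::euclidean_space \<Rightarrow> 'g \<Rightarrow> 'g) \<Rightarrow> 'g \<Rightarrow> 'g \<Rightarrow> 'g" where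
  "hmult br g g' = g + g' + (1/2) *\<^sub>R br g g'"


section \<open>The quotient group and the X-ray transform\<close>

definition lin_exp :: "real \<Rightarrow> ('g::real_normed_vector \<Rightarrow> 'g) \<Rightarrow> 'g \<Rightarrow> 'g" where
  "lin_exp s A V = (\<Sum>k. (s ^ k / fact k) *\<^sub>R (A ^^ k) V)"

definition geod :: "('g::euclidean_space \<Rightarrow> 'g \<Rightarrow> 'g) \<Rightarrow> 'g \<Rightarrow> 'g \<Rightarrow> real \<Rightarrow> 'g" where
  "geod br \<nu> l s =
     lin_exp s (J_map br l) (inv_into (horizontal br) (J_map br l) \<nu>)
     + (s / (2 * norm l)) *\<^sub>R sgn l"

definition Gam :: "'g::euclidean_space \<Rightarrow> 'g set" where
  "Gam l = range (\<lambda>j::int. (of_int j * pi / (norm l)\<^sup>2) *\<^sub>R sgn l)"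

definition quot :: "('g::euclidean_space \<Rightarrow> 'g \<Rightarrow> 'g) \<Rightarrow> 'g \<Rightarrow> 'g set set" where
  "quot br l = range (\<lambda>g. hmult br g ` Gam l)"

text \<open>
  The function on cosets induced by a function \<open>F\<close> on the group that is constant on each coset:
  its value at \<open>C\<close> is the common value of \<open>F\<close> on \<open>C\<close>.
\<close>

definition descend :: "('g \<Rightarrow> 'b) \<Rightarrow> 'g set \<Rightarrow> 'b" where
  "descend F C = the_elem (F ` C)"

text \<open>
  The sets measurable in the quotient are those with Borel preimage (union of the cosets) in the
  group; \<open>\<Gamma>\<close> being discrete, these are the Borel sets of the quotient topology.
\<close>

definition is_quot_haar ::
  "('g::euclidean_space \<Rightarrow> 'g \<Rightarrow> 'g) \<Rightarrow> 'g \<Rightarrow> 'g set measure \<Rightarrow> bool" where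
  "is_quot_haar br l M \<longleftrightarrow>
     space M = quot br l \<and>
     sets M = {A. A \<subseteq> quot br l \<and> \<Union>A \<in> sets borel} \<and>
     (\<forall>g. \<forall>A\<in>sets M. emeasure M ((\<lambda>C. hmult br g ` C) ` A) = emeasure M A) \<and>
     (\<forall>\<phi> :: 'g \<Rightarrow> ennreal. \<phi> \<in> borel_measurable borel \<longrightarrow>
        (\<integral>\<^sup>+ g. \<phi> g \<partial>lborel)
        = (\<integral>\<^sup>+ C. descend (\<lambda>g. \<Sum>\<^sub>\<infinity>\<gamma>\<in>Gam l. \<phi> (hmult br g \<gamma>)) C \<partial>M))"

definition quot_haar :: "('g::euclidean_space \<Rightarrow> 'g \<Rightarrow> 'g) \<Rightarrow> 'g \<Rightarrow> 'g set measure" where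
  "quot_haar br l = (THE M. is_quot_haar br l M)"

definition xray ::
  "('g::euclidean_space \<Rightarrow> 'g \<Rightarrow> 'g) \<Rightarrow> 'g \<Rightarrow> 'g \<Rightarrow> ('g \<Rightarrow> complex) \<Rightarrow> 'g set \<Rightarrow> complex" where
  "xray br \<nu> l f = descend (\<lambda>g. \<integral>s. f (hmult br g (geod br \<nu> l s)) \<partial>lborel)"


section \<open>Bargmann-Fock space\<close>

definition cn_holomorphic :: "(complex ^ 'n \<Rightarrow> complex) \<Rightarrow> bool" where
  "cn_holomorphic F \<longleftrightarrow>
     (\<forall>\<zeta>. \<exists>D. (F has_derivative D) (at \<zeta>) \<and> (\<forall>c v. D (c *s v) = c * D v))"

definition fock :: "(complex ^ 'n \<Rightarrow> complex) set" where
  "fock = {F. cn_holomorphic F \<and>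
     integrable lborel (\<lambda>\<zeta>. (norm (F \<zeta>))\<^sup>2 * exp (- (norm \<zeta>)\<^sup>2))}"

definition fock_inner ::
  "(complex ^ 'n \<Rightarrow> complex) \<Rightarrow> (complex ^ 'n \<Rightarrow> complex) \<Rightarrow> complex" where
  "fock_inner F H = of_real (1 / pi ^ CARD('n)) *
     (\<integral>\<zeta>. F \<zeta> * cnj (H \<zeta>) * of_real (exp (- (norm \<zeta>)\<^sup>2)) \<partial>lborel)"

definition fock_norm :: "(complex ^ 'n \<Rightarrow> complex) \<Rightarrow> real" where
  "fock_norm F = sqrt (Re (fock_inner F F))"

text \<open>Operators on Fock space are functions whose values outside \<^const>\<open>fock\<close> are irrelevant.\<close>

type_synonym 'n fock_op = "(complex ^ 'n \<Rightarrow> complex) \<Rightarrow> (complex ^ 'n \<Rightarrow> complex)"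

definition fock_bounded :: "('n::finite) fock_op \<Rightarrow> bool" where
  "fock_bounded T \<longleftrightarrow>
     (\<forall>F\<in>fock. T F \<in> fock) \<and>
     (\<forall>F\<in>fock. \<forall>H\<in>fock. T (\<lambda>\<zeta>. F \<zeta> + H \<zeta>) = (\<lambda>\<zeta>. T F \<zeta> + T H \<zeta>)) \<and>
     (\<forall>F\<in>fock. \<forall>c. T (\<lambda>\<zeta>. c * F \<zeta>) = (\<lambda>\<zeta>. c * T F \<zeta>)) \<and>
     (\<exists>B. \<forall>F\<in>fock. fock_norm (T F) \<le> B * fock_norm F)"

definition fock_adjoint :: "('n::finite) fock_op \<Rightarrow> ('n::finite) fock_op" where
  "fock_adjoint T F = (THE H. H \<in> fock \<and> (\<forall>K\<in>fock. fock_inner H K = fock_inner F (T K)))"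

text \<open>The integral of an operator-valued function, in the weak sense.\<close>

definition op_integral :: "'x measure \<Rightarrow> ('x \<Rightarrow> ('n::finite) fock_op) \<Rightarrow> ('n::finite) fock_op" where
  "op_integral M \<Phi> F = (THE H. H \<in> fock \<and>
     (\<forall>K\<in>fock. has_bochner_integral M (\<lambda>x. fock_inner (\<Phi> x F) K) (fock_inner H K)))"


section \<open>Representations and Fourier transforms\<close>

definition pi_heis :: "real \<Rightarrow> complex ^ 'n \<Rightarrow> real \<Rightarrow> ('n::finite) fock_op" where
  "pi_heis h z t F \<zeta> =
     exp (\<i> * of_real (h * t) - of_real (sqrt (h / 2)) * (\<Sum>i\<in>UNIV. \<zeta> $ i * cnj (z $ i))
          - of_real (h / 4 * (norm z)\<^sup>2))
     * F (\<zeta> + sqrt (h / 2) *\<^sub>R z)"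

text \<open>
  An admissible choice of the maps \<open>R\<^sub>\<mu>\<close>, with \<open>complex ^ 'n\<close> as the underlying real Euclidean space
  of dimension \<open>2 n\<close>. As a map into \<open>'g\<close>, its transpose \<^term>\<open>adjoint (R \<mu>)\<close> vanishes on the centre.
\<close>

definition frame_family ::
  "('g::euclidean_space \<Rightarrow> 'g \<Rightarrow> 'g) \<Rightarrow> ('g \<Rightarrow> complex ^ 'n \<Rightarrow> 'g) \<Rightarrow> bool" where
  "frame_family br R \<longleftrightarrow> (\<forall>\<mu>\<in>lie_center br - {0}.
     linear (R \<mu>) \<and> (\<forall>w w'. R \<mu> w \<bullet> R \<mu> w' = w \<bullet> w') \<and> range (R \<mu>) = horizontal br \<and>
     R \<mu> = R (sgn \<mu>) \<and>
     (\<forall>V\<in>horizontal br. J_map br \<mu> V = norm \<mu> *\<^sub>R R \<mu> (\<i> *s adjoint (R \<mu>) V)))"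

definition pi_rep ::
  "('g::euclidean_space \<Rightarrow> complex ^ 'n \<Rightarrow> 'g) \<Rightarrow> 'g \<Rightarrow> 'g \<Rightarrow> ('n::finite) fock_op" where
  "pi_rep R \<mu> g = pi_heis (norm \<mu>) (adjoint (R \<mu>) g) ((\<mu> \<bullet> g) / norm \<mu>)"

definition pi_char :: "'g::euclidean_space \<Rightarrow> 'g \<Rightarrow> complex" where
  "pi_char \<eta> g = exp (\<i> * of_real (\<eta> \<bullet> g))"

text \<open>
  Both transforms are used with \<open>M = lborel\<close> on the group and with \<open>M = quot_haar br l\<close> on the
  quotient. For one-dimensional representations the adjoint is complex conjugation.
\<close>

definition fourier_char :: "'x measure \<Rightarrow> ('x \<Rightarrow> complex) \<Rightarrow> ('x \<Rightarrow> complex) \<Rightarrow> complex" where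
  "fourier_char M f \<omega> = (\<integral>x. f x * cnj (\<omega> x) \<partial>M)"

definition fourier_op :: "'x measure \<Rightarrow> ('x \<Rightarrow> complex) \<Rightarrow> ('x \<Rightarrow> ('n::finite) fock_op) \<Rightarrow> ('n::finite) fock_op" where
  "fourier_op M f \<rho> = op_integral M (\<lambda>x F \<zeta>. f x * fock_adjoint (\<rho> x) F \<zeta>)"

definition multiplier ::
  "('g::euclidean_space \<Rightarrow> 'g \<Rightarrow> 'g) \<Rightarrow> ('g \<Rightarrow> complex ^ 'n \<Rightarrow> 'g) \<Rightarrow> 'g \<Rightarrow> 'g \<Rightarrow> 'g \<Rightarrow> ('n::finite) fock_op" where
  "multiplier br R \<nu> l \<mu> F \<zeta> = of_real (norm l / (2 * pi)) *
     op_integral (restrict_space lborel {0..2 * pi / norm l})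
       (\<lambda>s. pi_rep R \<mu> (geod br \<nu> l s)) F \<zeta>"

definition bessel_J0 :: "real \<Rightarrow> real" where
  "bessel_J0 x = (\<Sum>k. (-1) ^ k / (fact k)\<^sup>2 * (x / 2) ^ (2 * k))"

definition orth_proj :: "'g::euclidean_space set \<Rightarrow> 'g \<Rightarrow> 'g" where
  "orth_proj S x = (THE p. p \<in> S \<and> x - p \<in> orthogonal_comp S)"

end

theory Submission
  imports Defs "HOL-Complex_Analysis.Complex_Analysis"
begin

text \<open>
  The period of \<open>\<Gamma>\<close> is central and the geodesic satisfies \<open>\<gamma>(s + 2\<pi>/|\<lambda>|) = \<gamma>(s) \<cdot> period\<close>. Hence, for a
  bounded function \<open>\<psi>\<close> on \<open>G\<close> invariant under \<open>\<Gamma>\<close>, integrating \<open>f(g \<gamma>(s)) \<psi>(g)\<close> over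
  \<open>G\<^sub>\<lambda> \<times> \<real>\<close> is the same as integrating it over \<open>G \<times> [0, 2\<pi>/|\<lambda>|)\<close>, and right translation by
  \<open>\<gamma>(s)\<inverse>\<close> moves the geodesic to the argument of \<open>\<psi>\<close>. Taking for \<open>\<psi>\<close> a conjugate character leaves the
  integral of \<open>exp(i \<eta>(\<gamma>(s)))\<close> over a period, a Bessel integral. Taking \<open>\<psi>(g) = (\<pi>(g)\<^sup>* F)(\<zeta>)\<close> for a fixed
  point \<open>\<zeta>\<close> gives the operator identity pointwise, because \<open>\<pi>(g \<gamma>(s)\<inverse>)\<^sup>* = \<pi>(\<gamma>(s)) \<pi>(g)\<^sup>*\<close>; point evaluations
  are continuous on Fock space, so the weak operator integrals are computed pointwise in \<open>\<zeta>\<close>.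
\<close>

section \<open>Linear maps preserving Lebesgue measure\<close>

text \<open>Most objects of the statement are fixed by definite descriptions: the quotient measure,
  \<open>J_map\<close>, the adjoint, the weak operator integral, the orthogonal projection. Each
  needs existence and uniqueness before it can be computed with. The quotient measure exists as the
  push-forward of Lebesgue measure from a slab across the direction of \<open>l\<close>; it is
  unique because its normalisation can be tested on functions supported in that slab. For operators,
  uniqueness is nondegeneracy of the Fock inner product. Bi-invariance of Lebesgue measure on the
  group is reduced to linear involutions, handled by a Fubini symmetry argument in place of
  determinants; the same argument covers the isometries behind the mean value inequality. Computing
  a weak integral pointwise means showing that the pointwise integral is itself an element of Fock
  space: holomorphic by a Taylor remainder uniform in the parameter, square integrable by
  Cauchy-Schwarz, and equal to the weak integral by Fubini.\<close>

lemma nn_integral_lborel_plus: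
  fixes c :: "'a::euclidean_space"
  assumes "f \<in> borel_measurable borel"
  shows "(\<integral>\<^sup>+ x. f (c + x) \<partial>lborel) = (\<integral>\<^sup>+ x. f x \<partial>lborel)"
  using assms by (subst (2) lborel_distr_plus[of c, symmetric]) (simp add: nn_integral_distr)

lemma linear_borel_measurable:
  fixes T :: "'a::euclidean_space \<Rightarrow> 'b::euclidean_space"
  assumes "linear T"
  shows "T \<in> borel_measurable borel"
  using assms by (simp add: linear_continuous_on linear_conv_bounded_linear borel_measurable_continuous_onI)

text \<open>Both sides are the integral of \<open>indicator B x * indicator A (T y + x)\<close> over
  pairs: translating \<open>y\<close> by a preimage of \<open>x\<close> separates the variables in
  one way, translating \<open>x\<close> by \<open>T y\<close> in the other, where the symmetry of
  \<open>B\<close> removes a sign. The factor by which preimages under \<open>T\<close> scale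
  measure is thus the same for all sets, and one convenient \<open>B\<close> determines it.\<close>

lemma emeasure_linear_vimage_cross:
  fixes T :: "'a::euclidean_space \<Rightarrow> 'a"
  assumes lin: "linear T" and surj: "surj T"
    and A[measurable]: "A \<in> sets borel" and B[measurable]: "B \<in> sets borel"
    and symm: "\<And>x. - x \<in> B \<longleftrightarrow> x \<in> B"
  shows "emeasure lborel (T -` A) * emeasure lborel B = emeasure lborel A * emeasure lborel (T -` B)"
proof -
  have [measurable]: "T \<in> borel_measurable borel"
    using lin by (rule linear_borel_measurable)
  have TA: "T -` A \<in> sets borel" "T -` B \<in> sets borel"
    using measurable_sets[of T borel borel] by auto
  have translate: "(\<integral>\<^sup>+ y. h (T y + x) \<partial>lborel) = (\<integral>\<^sup>+ y. h (T y) \<partial>lborel)"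
    if [measurable]: "h \<in> borel_measurable borel" for h :: "'a \<Rightarrow> ennreal" and x
  proof -
    obtain y0 where y0: "T y0 = x"
      using surj by (metis surjD)
    have "(\<integral>\<^sup>+ y. h (T y + x) \<partial>lborel) = (\<integral>\<^sup>+ y. h (T (y0 + y)) \<partial>lborel)"
      using y0 lin by (simp add: linear_add add.commute)
    also have "\<dots> = (\<integral>\<^sup>+ y. h (T y) \<partial>lborel)"
      by (rule nn_integral_lborel_plus[of "\<lambda>y. h (T y)"]) measurable
    finally show ?thesis .
  qed
  have "emeasure lborel (T -` A) * emeasure lborel B
      = (\<integral>\<^sup>+ x. indicator B x * (\<integral>\<^sup>+ y. indicator A (T y) \<partial>lborel) \<partial>lborel)"
    using TA by (simp add: nn_integral_multc mult.commute indicator_vimage[symmetric] comp_def)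
  also have "\<dots> = (\<integral>\<^sup>+ x. indicator B x * (\<integral>\<^sup>+ y. indicator A (T y + x) \<partial>lborel) \<partial>lborel)"
    by (subst translate) simp_all
  also have "\<dots> = (\<integral>\<^sup>+ x. \<integral>\<^sup>+ y. indicator B x * indicator A (T y + x) \<partial>lborel \<partial>lborel)"
    by (intro nn_integral_cong nn_integral_cmult[symmetric]) measurable
  also have "\<dots> = (\<integral>\<^sup>+ y. \<integral>\<^sup>+ x. indicator B x * indicator A (T y + x) \<partial>lborel \<partial>lborel)"
    by (rule lborel_pair.Fubini') measurable
  also have "\<dots> = (\<integral>\<^sup>+ y. \<integral>\<^sup>+ x. indicator B (- T y + x) * indicator A x \<partial>lborel \<partial>lborel)"
  proof (rule nn_integral_cong)
    fix y
    show "(\<integral>\<^sup>+ x. indicator B x * indicator A (T y + x) \<partial>lborel)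
      = (\<integral>\<^sup>+ x. indicator B (- T y + x) * indicator A x \<partial>lborel)"
      using nn_integral_lborel_plus[of "\<lambda>x. indicator B (- T y + x) * indicator A x :: ennreal" "T y"]
      by simp
  qed
  also have "\<dots> = (\<integral>\<^sup>+ x. \<integral>\<^sup>+ y. indicator B (- T y + x) * indicator A x \<partial>lborel \<partial>lborel)"
    by (rule lborel_pair.Fubini') measurable
  also have "\<dots> = (\<integral>\<^sup>+ x. indicator A x * (\<integral>\<^sup>+ y. indicator B (T y + - x) \<partial>lborel) \<partial>lborel)"
  proof (rule nn_integral_cong)
    fix x
    have "indicator B (- T y + x) * indicator A x = indicator A x * (indicator B (T y + - x) :: ennreal)" for y
      using symm[of "T y + - x"] by (simp add: indicator_def)
    then show "(\<integral>\<^sup>+ y. indicator B (- T y + x) * indicator A x \<partial>lborel)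
      = indicator A x * (\<integral>\<^sup>+ y. indicator B (T y + - x) \<partial>lborel)"
      by (simp add: nn_integral_cmult)
  qed
  also have "\<dots> = (\<integral>\<^sup>+ x. indicator A x * (\<integral>\<^sup>+ y. indicator B (T y) \<partial>lborel) \<partial>lborel)"
    by (subst translate) simp_all
  also have "\<dots> = emeasure lborel A * emeasure lborel (T -` B)"
    using TA by (simp add: nn_integral_multc indicator_vimage[symmetric] comp_def)
  finally show ?thesis .
qed

lemma emeasure_lborel_ball_pos_finite:
  "0 < emeasure lborel (ball (0::'a::euclidean_space) 1)" "emeasure lborel (ball (0::'a::euclidean_space) 1) < \<infinity>"
proof -
  show "emeasure lborel (ball (0::'a) 1) < \<infinity>"
    by (rule emeasure_bounded_finite) simp
  have "\<not> negligible (ball (0::'a) 1)"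
    by (intro open_not_negligible) auto
  then have "emeasure lborel (ball (0::'a) 1) \<noteq> 0"
    by (simp add: negligible_iff_emeasure0)
  then show "0 < emeasure lborel (ball (0::'a) 1)"
    by (simp add: zero_less_iff_neq_zero)
qed

text \<open>The unit ball is its own preimage and has finite positive measure, so it cancels from
  the cross identity.\<close>

lemma distr_lborel_linear_isometry:
  fixes T :: "'a::euclidean_space \<Rightarrow> 'a"
  assumes lin: "linear T" and norm: "\<And>x. norm (T x) = norm x"
  shows "distr lborel borel T = lborel"
proof (rule measure_eqI)
  have [measurable]: "T \<in> borel_measurable borel"
    using lin by (rule linear_borel_measurable)
  have "inj T"
    using norm lin by (metis linear_injective_0 norm_eq_zero)
  then have surj: "surj T"
    using lin linear_injective_imp_surjective by blast
  have TB: "T -` ball 0 1 = ball 0 1"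
    using norm by auto
  fix A assume "A \<in> sets (distr lborel borel T)"
  then have A: "A \<in> sets borel" by simp
  have "emeasure lborel (T -` A) * emeasure lborel (ball (0::'a) 1)
      = emeasure lborel A * emeasure lborel (ball (0::'a) 1)"
    using emeasure_linear_vimage_cross[OF lin surj A, of "ball 0 1"] TB by simp
  then have "emeasure lborel (T -` A) = emeasure lborel A"
    using emeasure_lborel_ball_pos_finite[where 'a='a]
    by (metis ennreal_mult_cancel_left infinity_ennreal_def less_irrefl mult.commute)
  then show "emeasure (distr lborel borel T) A = emeasure lborel A"
    using A by (simp add: emeasure_distr)
qed simp

text \<open>The scaling factor has square 1: the cross identity is applied to the preimage of the
  unit ball, whose own preimage is the ball again.\<close>

lemma distr_lborel_linear_involution:
  fixes T :: "'a::euclidean_space \<Rightarrow> 'a"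
  assumes lin: "linear T" and inv: "\<And>x. T (T x) = x"
  shows "distr lborel borel T = lborel"
proof (rule measure_eqI)
  have T[measurable]: "T \<in> borel_measurable borel"
    using lin by (rule linear_borel_measurable)
  have surj: "surj T"
    using inv by (metis surjI)
  let ?B = "ball (0::'a) 1"
  have TB: "T -` ?B \<in> sets borel"
    using measurable_sets[OF T, of ?B] by simp
  have "T -` (T -` ?B) = ?B"
    using inv by auto
  then have sq: "emeasure lborel ?B * emeasure lborel ?B = emeasure lborel (T -` ?B) * emeasure lborel (T -` ?B)"
    using emeasure_linear_vimage_cross[OF lin surj TB, of ?B] by simp
  \<comment> \<open>The preimage of the ball is not yet known to have finite measure, so the squares
    are compared by order, with the finite positive measure of the ball as the factor in the strict
    inequality.\<close>
  have eq: "emeasure lborel (T -` ?B) = emeasure lborel ?B"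
  proof (rule ccontr)
    assume "emeasure lborel (T -` ?B) \<noteq> emeasure lborel ?B"
    then consider "emeasure lborel (T -` ?B) < emeasure lborel ?B" | "emeasure lborel ?B < emeasure lborel (T -` ?B)"
      by (meson linorder_neqE)
    then show False
    proof cases
      case 1
      then have "emeasure lborel ?B * emeasure lborel (T -` ?B) < emeasure lborel ?B * emeasure lborel ?B"
        using emeasure_lborel_ball_pos_finite[where 'a='a] by (intro ennreal_mult_strict_left_mono) auto
      moreover have "emeasure lborel (T -` ?B) * emeasure lborel (T -` ?B) \<le> emeasure lborel ?B * emeasure lborel (T -` ?B)"
        using 1 by (intro mult_right_mono) auto
      ultimately show False
        using sq by simp
    next
      case 2
      then have "emeasure lborel ?B * emeasure lborel ?B < emeasure lborel ?B * emeasure lborel (T -` ?B)"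
        using emeasure_lborel_ball_pos_finite[where 'a='a] by (intro ennreal_mult_strict_left_mono) auto
      moreover have "emeasure lborel ?B * emeasure lborel (T -` ?B) \<le> emeasure lborel (T -` ?B) * emeasure lborel (T -` ?B)"
        using 2 by (intro mult_right_mono) auto
      ultimately show False
        using sq by simp
    qed
  qed
  fix A assume "A \<in> sets (distr lborel borel T)"
  then have A: "A \<in> sets borel" by simp
  have "emeasure lborel (T -` A) * emeasure lborel (ball (0::'a) 1)
      = emeasure lborel A * emeasure lborel (ball (0::'a) 1)"
    using emeasure_linear_vimage_cross[OF lin surj A, of "ball 0 1"] eq by simp
  then have "emeasure lborel (T -` A) = emeasure lborel A"
    using emeasure_lborel_ball_pos_finite[where 'a='a]
    by (metis ennreal_mult_cancel_left infinity_ennreal_def less_irrefl mult.commute)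
  then show "emeasure (distr lborel borel T) A = emeasure lborel A"
    using A by (simp add: emeasure_distr)
qed simp

section \<open>H-type algebras and their groups\<close>

text \<open>On the span of \<open>V\<close> and \<open>A V\<close> the map squares to a negative
  scalar, so its powers alternate between multiples of \<open>V\<close> and of \<open>A V\<close>;
  the even and odd parts of the exponential series are the cosine and sine series.\<close>

lemma lin_exp_square_neg:
  assumes A: "linear A" and sq: "A (A V) = - (a\<^sup>2 *\<^sub>R V)" and a: "a \<noteq> 0"
  shows "lin_exp s A V = cos (s * a) *\<^sub>R V + (sin (s * a) / a) *\<^sub>R A V"
proof -
  have pow: "(A ^^ n) V = (if even n then ((-1) ^ (n div 2) * a ^ n) *\<^sub>R V
      else ((-1) ^ ((n - 1) div 2) * a ^ (n - 1)) *\<^sub>R A V)" for n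
  proof (induction n)
    case (Suc n)
    show ?case
    proof (cases "even n")
      case False
      then obtain k where "n = 2 * k + 1" by (elim oddE)
      then show ?thesis
        using Suc sq by (simp add: linear_scale[OF A] power2_eq_square)
    qed (use Suc in \<open>simp add: linear_scale[OF A]\<close>)
  qed simp
  have coeff: "(s ^ n / fact n) *\<^sub>R (A ^^ n) V =
      (cos_coeff n *\<^sub>R (s * a) ^ n) *\<^sub>R V + ((sin_coeff n *\<^sub>R (s * a) ^ n) / a) *\<^sub>R A V" for n
  proof (cases "even n")
    case True
    then show ?thesis
      by (subst pow) (simp add: cos_coeff_def sin_coeff_def power_mult_distrib)
  next
    case False
    then obtain k where "n = Suc (2 * k)" by (elim oddE) simp
    with a show ?thesis
      by (subst pow) (simp add: cos_coeff_def sin_coeff_def power_mult_distrib)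
  qed
  have "(\<lambda>n. (cos_coeff n *\<^sub>R (s * a) ^ n) *\<^sub>R V + ((sin_coeff n *\<^sub>R (s * a) ^ n) / a) *\<^sub>R A V)
      sums (cos (s * a) *\<^sub>R V + (sin (s * a) / a) *\<^sub>R A V)"
    by (intro sums_add sums_scaleR_left sums_divide cos_converges sin_converges)
  then show ?thesis
    by (simp add: lin_exp_def coeff sums_iff)
qed

locale h_type_algebra =
  fixes br :: "'g::euclidean_space \<Rightarrow> 'g \<Rightarrow> 'g"
  assumes h_type: "h_type br"
begin

abbreviation (input) "center \<equiv> lie_center br"
abbreviation (input) "horiz \<equiv> horizontal br"
abbreviation (input) "J \<equiv> J_map br"

lemma bilinear_br: "bilinear br"
  using h_type unfolding h_type_def lie_algebra_def by blast

lemma linear_br_right: "linear (br X)"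
  using bilinear_br by (simp add: bilinear_def)

lemmas br_simps =
  bilinear_ladd[OF bilinear_br] bilinear_radd[OF bilinear_br]
  bilinear_lmul[OF bilinear_br] bilinear_rmul[OF bilinear_br]
  bilinear_lneg[OF bilinear_br] bilinear_rneg[OF bilinear_br]
  bilinear_lzero[OF bilinear_br] bilinear_rzero[OF bilinear_br]
  bilinear_lsub[OF bilinear_br] bilinear_rsub[OF bilinear_br]

lemma br_self [simp]: "br X X = 0"
  using h_type unfolding h_type_def lie_algebra_def by blast

lemma br_anticommute: "br X Y = - br Y X"
proof -
  have "0 = br (X + Y) (X + Y)"
    by (rule br_self[symmetric])
  also have "\<dots> = br X Y + br Y X"
    using br_self[of X] br_self[of Y] by (simp add: br_simps(1,2) del: br_self)
  finally have "br X Y + br Y X = 0"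
    by (rule sym)
  then show ?thesis
    by (simp add: eq_neg_iff_add_eq_0)
qed

lemma br_br [simp]: "br X (br Y Z) = 0" "br (br Y Z) X = 0"
proof -
  show "br X (br Y Z) = 0"
    using h_type unfolding h_type_def by blast
  then show "br (br Y Z) X = 0"
    using br_anticommute[of "br Y Z" X] by simp
qed

lemma br_in_center [simp]: "br X Y \<in> center"
  by (simp add: lie_center_def)

lemma br_center [simp]:
  assumes "Z \<in> center"
  shows "br X Z = 0" "br Z X = 0"
proof -
  show "br X Z = 0"
    using assms by (simp add: lie_center_def)
  then show "br Z X = 0"
    by (subst br_anticommute) simp
qed

lemma subspace_center: "subspace center"
  by (rule subspaceI) (auto simp: lie_center_def br_simps simp del: br_center)

lemma subspace_horiz: "subspace horiz"
  by (simp add: horizontal_def subspace_orthogonal_comp)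

lemma horiz_inner_center:
  assumes "V \<in> horiz" "Z \<in> center"
  shows "V \<bullet> Z = 0" "Z \<bullet> V = 0"
  using assms by (auto simp: horizontal_def orthogonal_comp_def orthogonal_def inner_commute)

lemma horizI: "(\<And>Z. Z \<in> center \<Longrightarrow> V \<bullet> Z = 0) \<Longrightarrow> V \<in> horiz"
  by (auto simp: horizontal_def orthogonal_comp_def orthogonal_def inner_commute)

text \<open>An element encodes the pair (x, u) as the sum x + u, and \<open>P\<close> recovers u. It
  provides the reflection used for the shear below and lets identities known for horizontal vectors
  be extended to all vectors.\<close>

lemma center_projection:
  obtains P where "linear P" "\<And>x. P x \<in> center" "\<And>x. x - P x \<in> horiz" "\<And>z. z \<in> center \<Longrightarrow> P z = z"
proof -
  obtain B where B: "B \<subseteq> center" "pairwise orthogonal B" "\<And>x. x \<in> B \<Longrightarrow> norm x = 1"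
      "independent B" "span B = center"
    using orthonormal_basis_subspace[OF subspace_center] by metis
  then have fin: "finite B"
    using independent_imp_finite by blast
  have ortho: "x \<bullet> y = (if x = y then 1 else 0)" if "x \<in> B" "y \<in> B" for x y
    using B that by (auto simp: orthogonal_def pairwise_def norm_eq_1)
  define P where "P x = (\<Sum>b\<in>B. (x \<bullet> b) *\<^sub>R b)" for x
  have 1: "linear P"
    by (rule linearI) (simp_all add: P_def algebra_simps inner_left_distrib sum.distrib scaleR_sum_right)
  have 2: "P x \<in> center" for x
    unfolding P_def using B subspace_center by (intro subspace_sum subspace_scale) auto
  have 3: "x - P x \<in> horiz" for x
  proof (rule horizI)
    fix Z assume "Z \<in> center"
    then obtain u where u: "Z = (\<Sum>b\<in>B. u b *\<^sub>R b)"
      using span_finite[OF fin] B by auto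
    have "(x - P x) \<bullet> b = 0" if "b \<in> B" for b
      using that fin by (simp add: P_def inner_diff_left inner_sum_left ortho if_distrib cong: if_cong)
    then show "(x - P x) \<bullet> Z = 0"
      by (simp add: u inner_sum_right)
  qed
  have 4: "P z = z" if z: "z \<in> center" for z
  proof -
    have "z - P z \<in> center"
      using z 2 subspace_center by (intro subspace_diff)
    then have "(z - P z) \<bullet> (z - P z) = 0"
      using 3 horiz_inner_center by blast
    then show ?thesis by simp
  qed
  show thesis by (rule that[OF 1 2 3 4])
qed

section \<open>The group law and the bi-invariance of Lebesgue measure\<close>

lemma hmult_assoc: "hmult br (hmult br a b) c = hmult br a (hmult br b c)"
  by (simp add: hmult_def br_simps scaleR_add_right)

lemma hmult_zero [simp]: "hmult br 0 a = a" "hmult br a 0 = a"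
  by (simp_all add: hmult_def br_simps)

lemma hmult_uminus [simp]: "hmult br (- a) a = 0" "hmult br a (- a) = 0"
  by (simp_all add: hmult_def br_simps)

lemma hmult_uminus_cancel [simp]: "hmult br (- a) (hmult br a b) = b" "hmult br a (hmult br (- a) b) = b"
  by (simp_all add: hmult_assoc[symmetric])

lemma hmult_inverse: "- hmult br a b = hmult br (- b) (- a)"
  using br_anticommute[of a b] by (simp add: hmult_def br_simps)

lemma hmult_center:
  assumes "z \<in> center"
  shows "hmult br g z = g + z" "hmult br z g = g + z"
  using assms by (simp_all add: hmult_def add.commute)

lemma continuous_on_hmult [continuous_intros]:
  assumes "continuous_on S a" "continuous_on S b"
  shows "continuous_on S (\<lambda>x. hmult br (a x) (b x))"
  unfolding hmult_def
  using assms bounded_bilinear.continuous_on[OF bilinear_br[unfolded bilinear_conv_bounded_bilinear] assms]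
  by (intro continuous_intros)

text \<open>
  \<open>x \<mapsto> x + [g,x]/2\<close> is the product of two linear involutions: the reflection \<open>2P - 1\<close> in the centre
  conjugates it to its inverse.
\<close>

lemma distr_lborel_shear: "distr lborel borel (\<lambda>x. x + (1/2) *\<^sub>R br g x) = lborel"
proof -
  obtain P where P: "linear P" "\<And>x. P x \<in> center" "\<And>x. x - P x \<in> horiz" "\<And>z. z \<in> center \<Longrightarrow> P z = z"
    using center_projection by blast
  define \<sigma> where "\<sigma> x = 2 *\<^sub>R P x - x" for x
  have br_center_scale: "(1/2) *\<^sub>R br g x \<in> center" for x
    using subspace_center by (simp add: subspace_scale)
  define T where "T x = \<sigma> x + (1/2) *\<^sub>R br g x" for x
  have lin\<sigma>: "linear \<sigma>"
    unfolding \<sigma>_def using P(1) by (intro linear_compose_sub linear_compose_scale_right linear_ident)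
  have linT: "linear T"
    unfolding T_def using linear_br_right by (intro linear_compose_add linear_compose_scale_right lin\<sigma>)
  have \<sigma>\<sigma>: "\<sigma> (\<sigma> x) = x" for x
  proof -
    have "P (\<sigma> x) = P x"
      by (simp add: \<sigma>_def linear_diff[OF P(1)] linear_scale[OF P(1)] P(2,4) scaleR_2 linear_add[OF P(1)])
    then show ?thesis
      by (simp add: \<sigma>_def)
  qed
  have \<sigma>z: "\<sigma> z = z" if "z \<in> center" for z
    using that by (simp add: \<sigma>_def P(4) scaleR_2)
  have br\<sigma>: "br g (\<sigma> x) = - br g x" for x
    using P(2) by (simp add: \<sigma>_def br_simps)
  have TT: "T (T x) = x" for x
    using \<sigma>z[OF br_center_scale] by (simp add: T_def linear_add[OF lin\<sigma>] \<sigma>\<sigma> br_simps br\<sigma>)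
  have \<sigma>T: "(\<lambda>x. x + (1/2) *\<^sub>R br g x) = \<sigma> \<circ> T"
    using \<sigma>z[OF br_center_scale] by (auto simp: T_def linear_add[OF lin\<sigma>] \<sigma>\<sigma>)
  have "distr lborel borel (\<sigma> \<circ> T) = distr (distr lborel borel T) borel \<sigma>"
    using linear_borel_measurable[OF lin\<sigma>] linear_borel_measurable[OF linT]
    by (simp add: distr_distr)
  also have "\<dots> = lborel"
    by (simp add: distr_lborel_linear_involution lin\<sigma> linT \<sigma>\<sigma> TT)
  finally show ?thesis
    by (simp add: \<sigma>T)
qed

lemma hmult_borel_measurable [measurable]: "(\<lambda>x. hmult br (fst x) (snd x)) \<in> borel_measurable borel"
  by (intro borel_measurable_continuous_onI continuous_intros)

lemma borel_measurable_hmult [measurable (raw)]: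
  assumes "a \<in> borel_measurable M" "b \<in> borel_measurable M"
  shows "(\<lambda>x. hmult br (a x) (b x)) \<in> borel_measurable M"
  using measurable_compose[OF borel_measurable_Pair[OF assms] hmult_borel_measurable] by simp

lemma distr_lborel_hmult_left: "distr lborel borel (hmult br g) = lborel"
proof -
  have "hmult br g = (+) g \<circ> (\<lambda>x. x + (1/2) *\<^sub>R br g x)"
    by (auto simp: hmult_def)
  moreover have [measurable]: "br g \<in> borel_measurable borel"
    by (rule linear_borel_measurable[OF linear_br_right])
  ultimately have "distr lborel borel (hmult br g)
      = distr (distr lborel borel (\<lambda>x. x + (1/2) *\<^sub>R br g x)) borel ((+) g)"
    by (simp add: distr_distr)
  then show ?thesis
    by (simp add: distr_lborel_shear lborel_distr_plus)
qed

text \<open>Unimodularity: the product x g equals 2 g + (-g) x, the outer sum being that of the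
  vector space, so a right translation is a left translation followed by an ordinary one.\<close>

lemma distr_lborel_hmult_right: "distr lborel borel (\<lambda>x. hmult br x g) = lborel"
proof -
  have "(\<lambda>x. hmult br x g) = (+) (2 *\<^sub>R g) \<circ> hmult br (- g)"
  proof
    fix x
    show "hmult br x g = ((+) (2 *\<^sub>R g) \<circ> hmult br (- g)) x"
      using br_anticommute[of x g] by (simp add: hmult_def br_simps scaleR_2)
  qed
  then have "distr lborel borel (\<lambda>x. hmult br x g) = distr (distr lborel borel (hmult br (- g))) borel ((+) (2 *\<^sub>R g))"
    by (simp add: distr_distr)
  then show ?thesis
    by (simp add: distr_lborel_hmult_left lborel_distr_plus)
qed

section \<open>The maps \<open>J_map\<close> and the geodesic in closed form\<close>

lemma J_map_exists: "\<exists>!U. U \<in> horiz \<and> (\<forall>W\<in>horiz. U \<bullet> W = \<mu> \<bullet> br V W)"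
proof (rule ex1I)
  \<comment> \<open>Riesz representation of the functional \<open>\<mu> \<bullet> br V W\<close> of
    \<open>W\<close>. The functional vanishes on the centre, which makes \<open>U\<close>
    horizontal.\<close>
  define U where "U = (\<Sum>b\<in>Basis. (\<mu> \<bullet> br V b) *\<^sub>R b)"
  have U: "U \<bullet> W = \<mu> \<bullet> br V W" for W
  proof -
    have "\<mu> \<bullet> br V W = \<mu> \<bullet> br V (\<Sum>b\<in>Basis. (W \<bullet> b) *\<^sub>R b)"
      by (simp add: euclidean_representation)
    also have "\<dots> = (\<Sum>b\<in>Basis. (W \<bullet> b) * (\<mu> \<bullet> br V b))"
      by (simp add: linear_sum[OF linear_br_right] br_simps inner_sum_right)
    finally show ?thesis
      by (simp add: U_def inner_sum_left mult.commute inner_commute[of W])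
  qed
  show "U \<in> horiz \<and> (\<forall>W\<in>horiz. U \<bullet> W = \<mu> \<bullet> br V W)"
    using U by (auto intro!: horizI)
  fix U' assume U': "U' \<in> horiz \<and> (\<forall>W\<in>horiz. U' \<bullet> W = \<mu> \<bullet> br V W)"
  have "U' - U \<in> horiz"
    using U' \<open>U \<in> horiz \<and> _\<close> subspace_horiz subspace_diff by blast
  then have "(U' - U) \<bullet> (U' - U) = 0"
    using U' U by (simp add: inner_diff_left)
  then show "U' = U" by simp
qed

lemma J_map_horiz [simp]: "J \<mu> V \<in> horiz"
  using theI'[OF J_map_exists[of \<mu> V]] by (simp add: J_map_def)

text \<open>The defining relation extends from horizontal \<open>W\<close> to all \<open>W\<close>:
  the bracket kills the central part of \<open>W\<close>, and this part is orthogonal to the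
  horizontal vector \<open>J \<mu> V\<close>. Linearity and skewness are then read off by pairing
  with arbitrary vectors.\<close>

lemma J_map_inner: "J \<mu> V \<bullet> W = \<mu> \<bullet> br V W"
proof -
  obtain P where P: "P W \<in> center" "W - P W \<in> horiz"
    using center_projection by metis
  have "J \<mu> V \<bullet> (W - P W) = \<mu> \<bullet> br V (W - P W)"
    using theI'[OF J_map_exists[of \<mu> V]] P by (simp add: J_map_def)
  then show ?thesis
    using P by (simp add: inner_diff_right br_simps horiz_inner_center)
qed

lemma linear_J_map: "linear (J \<mu>)"
  by (rule linearI; rule vector_eq_rdot[THEN iffD1])
    (simp_all add: J_map_inner inner_add_left br_simps inner_add_right)

lemma J_map_scale_left: "J (c *\<^sub>R \<mu>) V = c *\<^sub>R J \<mu> V"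
  by (rule vector_eq_rdot[THEN iffD1]) (simp add: J_map_inner)

lemma J_map_J_map:
  "\<mu> \<in> center \<Longrightarrow> V \<in> horiz \<Longrightarrow> J \<mu> (J \<mu> V) = - ((norm \<mu>)\<^sup>2 *\<^sub>R V)"
  using h_type unfolding h_type_def by blast

lemma J_map_inner_self: "V \<bullet> J \<mu> V = 0"
  by (simp add: inner_commute[of V] J_map_inner)

lemma norm_J_map:
  assumes "\<mu> \<in> center" "V \<in> horiz"
  shows "norm (J \<mu> V) = norm \<mu> * norm V"
proof -
  have "J \<mu> V \<bullet> J \<mu> V = - (J \<mu> (J \<mu> V) \<bullet> V)"
    using br_anticommute[of V "J \<mu> V"] by (simp add: J_map_inner)
  then have "(norm (J \<mu> V))\<^sup>2 = (norm \<mu> * norm V)\<^sup>2"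
    using assms by (simp add: J_map_J_map power2_norm_eq_inner power_mult_distrib)
  then show ?thesis by simp
qed

lemma geod_eq:
  assumes l: "l \<in> center" "l \<noteq> 0" and \<nu>: "\<nu> \<in> horiz"
  shows "geod br \<nu> l s = - (cos (s * norm l) / (norm l)\<^sup>2) *\<^sub>R J l \<nu>
    + (sin (s * norm l) / norm l) *\<^sub>R \<nu> + (s / (2 * norm l)) *\<^sub>R sgn l"
proof -
  \<comment> \<open>Since \<open>J l\<close> squares to minus \<open>(norm l)\<^sup>2\<close> on
    horizontal vectors, this is the preimage of \<open>\<nu>\<close>; injectivity of
    \<open>J l\<close> there forces \<open>inv_into\<close> to return it.\<close>
  define V where "V = - (1 / (norm l)\<^sup>2) *\<^sub>R J l \<nu>"
  have V: "V \<in> horiz"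
    using subspace_horiz by (simp add: V_def subspace_scale subspace_neg)
  have JV: "J l V = \<nu>"
    using l \<nu> by (simp add: V_def linear_scale[OF linear_J_map] linear_neg[OF linear_J_map] J_map_J_map)
  have "inj_on (J l) horiz"
  proof (rule inj_onI)
    fix x y assume "x \<in> horiz" "y \<in> horiz" and "J l x = J l y"
    then have "- ((norm l)\<^sup>2 *\<^sub>R x) = - ((norm l)\<^sup>2 *\<^sub>R y)"
      using l(1) J_map_J_map by metis
    then show "x = y" using l by simp
  qed
  then have "inv_into horiz (J l) \<nu> = V"
    using V JV inv_into_f_f by metis
  moreover have "lin_exp s (J l) V = cos (s * norm l) *\<^sub>R V + (sin (s * norm l) / norm l) *\<^sub>R J l V"
    using l V by (intro lin_exp_square_neg linear_J_map) (simp_all add: J_map_J_map)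
  ultimately show ?thesis
    by (simp add: geod_def JV) (simp add: V_def)
qed

end

section \<open>Fundamental domains of cyclic translation groups\<close>

text \<open>A Borel transversal for the integers acting by multiples of \<open>v\<close>. Uniqueness
  is asked of the integer and not of the point, so that a sum over \<open>j\<close> meets the domain
  exactly once. The notion is used on the group and, with a time coordinate added, on its product
  with the line.\<close>

definition cyclic_domain :: "'a::euclidean_space \<Rightarrow> 'a set \<Rightarrow> bool" where
  "cyclic_domain v D \<longleftrightarrow> D \<in> sets borel \<and> (\<forall>x. \<exists>!j::int. x + of_int j *\<^sub>R v \<in> D)"

lemma cyclic_domain_borel: "cyclic_domain v D \<Longrightarrow> D \<in> sets borel"
  by (simp add: cyclic_domain_def)

lemma nn_integral_cyclic_domain_one:
  assumes "cyclic_domain v D"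
  shows "(\<integral>\<^sup>+ j. indicator D (x + of_int j *\<^sub>R v) * c \<partial>count_space (UNIV::int set)) = c"
proof -
  obtain j0 where j0: "\<And>j. x + of_int j *\<^sub>R v \<in> D \<longleftrightarrow> j = j0"
    using assms unfolding cyclic_domain_def by metis
  have "(\<integral>\<^sup>+ j. indicator D (x + of_int j *\<^sub>R v) * c \<partial>count_space (UNIV::int set))
      = (\<integral>\<^sup>+ j. c * indicator {j0} j \<partial>count_space UNIV)"
    by (intro nn_integral_cong) (simp add: j0 indicator_def)
  then show ?thesis
    by simp
qed

text \<open>Weil's unfolding formula: after Tonelli and a translation in each summand, the bijection
  \<open>uminus\<close> absorbs the sign of \<open>j\<close>, and the translates of \<open>D\<close>
  cover every point exactly once.\<close>

lemma nn_integral_unfold: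
  assumes D: "cyclic_domain v D" and \<phi>[measurable]: "\<phi> \<in> borel_measurable borel"
  shows "(\<integral>\<^sup>+ x. \<phi> x \<partial>lborel)
    = (\<integral>\<^sup>+ x. indicator D x * (\<integral>\<^sup>+ j. \<phi> (x + of_int j *\<^sub>R v) \<partial>count_space (UNIV::int set)) \<partial>lborel)"
proof -
  note [measurable] = cyclic_domain_borel[OF D]
  have "(\<integral>\<^sup>+ x. indicator D x * (\<integral>\<^sup>+ j. \<phi> (x + of_int j *\<^sub>R v) \<partial>count_space (UNIV::int set)) \<partial>lborel)
      = (\<integral>\<^sup>+ x. (\<integral>\<^sup>+ j. indicator D x * \<phi> (x + of_int j *\<^sub>R v) \<partial>count_space (UNIV::int set)) \<partial>lborel)"
    by (simp add: nn_integral_cmult)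
  also have "\<dots> = (\<integral>\<^sup>+ j. (\<integral>\<^sup>+ x. indicator D x * \<phi> (x + of_int j *\<^sub>R v) \<partial>lborel) \<partial>count_space (UNIV::int set))"
    by (rule nn_integral_count_space_nn_integral) auto
  also have "\<dots> = (\<integral>\<^sup>+ j. (\<integral>\<^sup>+ x. indicator D (x + of_int (- j) *\<^sub>R v) * \<phi> x \<partial>lborel) \<partial>count_space (UNIV::int set))"
  proof (rule nn_integral_cong)
    fix j :: int
    show "(\<integral>\<^sup>+ x. indicator D x * \<phi> (x + of_int j *\<^sub>R v) \<partial>lborel)
      = (\<integral>\<^sup>+ x. indicator D (x + of_int (- j) *\<^sub>R v) * \<phi> x \<partial>lborel)"
      using nn_integral_lborel_plus[of "\<lambda>x. indicator D x * \<phi> (x + of_int j *\<^sub>R v)" "of_int (- j) *\<^sub>R v"]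
      by (simp add: add.commute[of _ "- _"] add.commute[of v])
  qed
  also have "\<dots> = (\<integral>\<^sup>+ j. (\<integral>\<^sup>+ x. indicator D (x + of_int j *\<^sub>R v) * \<phi> x \<partial>lborel) \<partial>count_space (UNIV::int set))"
    by (rule nn_integral_bij_count_space) (rule bij_uminus)
  also have "\<dots> = (\<integral>\<^sup>+ x. (\<integral>\<^sup>+ j. indicator D (x + of_int j *\<^sub>R v) * \<phi> x \<partial>count_space (UNIV::int set)) \<partial>lborel)"
    by (rule nn_integral_count_space_nn_integral[symmetric]) auto
  also have "\<dots> = (\<integral>\<^sup>+ x. \<phi> x \<partial>lborel)"
    by (simp add: nn_integral_cyclic_domain_one[OF D])
  finally show ?thesis ..
qed

lemma invariant_int_translation:
  fixes F :: "'a::real_vector \<Rightarrow> 'b"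
  assumes "\<And>x. F (x + v) = F x"
  shows "F (x + of_int j *\<^sub>R v) = F x"
proof (induction j rule: int_induct[where k = 0])
  case (step1 i)
  then show ?case
    using assms[of "x + of_int i *\<^sub>R v"] by (simp add: algebra_simps)
next
  case (step2 i)
  then show ?case
    using assms[of "x + of_int (i - 1) *\<^sub>R v"] by (simp add: algebra_simps)
qed simp

text \<open>The function \<open>indicator E x * F x\<close> is unfolded over \<open>D\<close>;
  invariance takes \<open>F\<close> out of the sum over translates, and what remains counts the
  single translate that lies in \<open>E\<close>.\<close>

lemma nn_integral_cyclic_domain_eq:
  assumes D: "cyclic_domain v D" and E: "cyclic_domain v E"
    and F[measurable]: "F \<in> borel_measurable borel" and inv: "\<And>x. F (x + v) = F x"
  shows "(\<integral>\<^sup>+ x. indicator D x * F x \<partial>lborel) = (\<integral>\<^sup>+ x. indicator E x * F x \<partial>lborel)"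
proof -
  note [measurable] = cyclic_domain_borel[OF D] cyclic_domain_borel[OF E]
  have "(\<integral>\<^sup>+ x. indicator E x * F x \<partial>lborel) = (\<integral>\<^sup>+ x. indicator D x *
      (\<integral>\<^sup>+ j. indicator E (x + of_int j *\<^sub>R v) * F (x + of_int j *\<^sub>R v) \<partial>count_space (UNIV::int set)) \<partial>lborel)"
    by (rule nn_integral_unfold[OF D]) measurable
  then show ?thesis
    by (simp add: invariant_int_translation[of F, OF inv] nn_integral_cyclic_domain_one[OF E])
qed

lemma integral_cyclic_domain_eq_real:
  fixes F :: "'a::euclidean_space \<Rightarrow> real"
  assumes D: "cyclic_domain v D" and E: "cyclic_domain v E"
    and F[measurable]: "F \<in> borel_measurable borel" and inv: "\<And>x. F (x + v) = F x"
    and int: "integrable lborel (\<lambda>x. indicator D x *\<^sub>R F x)"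
  shows "integrable lborel (\<lambda>x. indicator E x *\<^sub>R F x)"
    and "(\<integral>x. indicator E x *\<^sub>R F x \<partial>lborel) = (\<integral>x. indicator D x *\<^sub>R F x \<partial>lborel)"
proof -
  note [measurable] = cyclic_domain_borel[OF D] cyclic_domain_borel[OF E]
  \<comment> \<open>Used for three choices of \<open>h\<close>: \<open>norm\<close> gives
    integrability, the identity and \<open>uminus\<close> give the positive and negative parts,
    because \<open>ennreal\<close> sends negative numbers to 0. The condition \<open>h 0 = 0\<close>
    lets the indicator move outside.\<close>
  have eq: "(\<integral>\<^sup>+ x. ennreal (h (indicator D x *\<^sub>R F x)) \<partial>lborel) = (\<integral>\<^sup>+ x. ennreal (h (indicator E x *\<^sub>R F x)) \<partial>lborel)"
    if [measurable]: "h \<in> borel_measurable borel" and h0: "h 0 = 0" for h :: "real \<Rightarrow> real"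
  proof -
    have "ennreal (h (indicator A x *\<^sub>R F x)) = indicator A x * ennreal (h (F x))" for A x
      by (simp add: indicator_def h0)
    then show ?thesis
      using nn_integral_cyclic_domain_eq[OF D E, of "\<lambda>x. ennreal (h (F x))"] inv by simp
  qed
  show "integrable lborel (\<lambda>x. indicator E x *\<^sub>R F x)"
    using int eq[of norm] by (simp add: integrable_iff_bounded)
  then show "(\<integral>x. indicator E x *\<^sub>R F x \<partial>lborel) = (\<integral>x. indicator D x *\<^sub>R F x \<partial>lborel)"
    using int eq[of "\<lambda>x. x"] eq[of uminus] by (simp add: real_lebesgue_integral_def)
qed

lemma integral_cyclic_domain_eq:
  fixes F :: "'a::euclidean_space \<Rightarrow> complex"
  assumes D: "cyclic_domain v D" and E: "cyclic_domain v E"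
    and F[measurable]: "F \<in> borel_measurable borel" and inv: "\<And>x. F (x + v) = F x"
    and int: "integrable lborel (\<lambda>x. indicator D x *\<^sub>R F x)"
  shows "integrable lborel (\<lambda>x. indicator E x *\<^sub>R F x)"
    and "(\<integral>x. indicator E x *\<^sub>R F x \<partial>lborel) = (\<integral>x. indicator D x *\<^sub>R F x \<partial>lborel)"
proof -
  note Re = integral_cyclic_domain_eq_real[OF D E, of "\<lambda>x. Re (F x)"]
  note Im = integral_cyclic_domain_eq_real[OF D E, of "\<lambda>x. Im (F x)"]
  have "integrable lborel (\<lambda>x. indicator D x *\<^sub>R Re (F x))" "integrable lborel (\<lambda>x. indicator D x *\<^sub>R Im (F x))"
    using integrable_Re[OF int] integrable_Im[OF int] by simp_all
  note Re = Re[OF _ _ this(1)] and Im = Im[OF _ _ this(2)]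
  show E_int: "integrable lborel (\<lambda>x. indicator E x *\<^sub>R F x)"
  proof -
    have "ennreal (norm (indicator A x *\<^sub>R F x)) = indicator A x * ennreal (norm (F x))" for A x
      by (simp add: indicator_def)
    then have "(\<integral>\<^sup>+ x. ennreal (norm (indicator D x *\<^sub>R F x)) \<partial>lborel) = (\<integral>\<^sup>+ x. ennreal (norm (indicator E x *\<^sub>R F x)) \<partial>lborel)"
      using nn_integral_cyclic_domain_eq[OF D E, of "\<lambda>x. ennreal (norm (F x))"] inv by simp
    then show ?thesis
      using int cyclic_domain_borel[OF E] by (simp add: integrable_iff_bounded)
  qed
  show "(\<integral>x. indicator E x *\<^sub>R F x \<partial>lborel) = (\<integral>x. indicator D x *\<^sub>R F x \<partial>lborel)"
    using Re(2) Im(2) inv integral_Re[OF int] integral_Im[OF int] integral_Re[OF E_int] integral_Im[OF E_int]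
    by (simp add: complex_eq_iff)
qed

lemma nn_integral_count_space_int:
  "(\<integral>\<^sup>+ j. f j \<partial>count_space UNIV) = (\<Sum>n. f (int_decode n))"
  using nn_integral_bij_count_space[OF bij_int_decode, of f] by (simp add: nn_integral_count_space_nat)

text \<open>Turns the unordered sum in \<open>is_quot_haar\<close> into an integral for counting
  measure, to which Tonelli applies.\<close>

lemma infsum_int_ennreal:
  fixes f :: "int \<Rightarrow> ennreal"
  shows "(\<Sum>\<^sub>\<infinity>j. f j) = (\<integral>\<^sup>+ j. f j \<partial>count_space UNIV)"
proof -
  have "(\<Sum>\<^sub>\<infinity>j. f j) = (\<Sum>\<^sub>\<infinity>n. f (int_decode n))"
    by (rule infsum_reindex_bij_betw[symmetric]) (rule bij_int_decode)
  also have "\<dots> = (\<Sum>n. f (int_decode n))"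
    by (intro sums_unique has_sum_imp_sums has_sum_infsum nonneg_summable_on_complete) simp
  finally show ?thesis
    by (simp add: nn_integral_count_space_int)
qed

section \<open>The Haar measure of the quotient\<close>

locale h_type_quotient = h_type_algebra +
  fixes l :: 'a
  assumes l_center: "l \<in> lie_center br" and l_nonzero: "l \<noteq> 0"
begin

definition period :: 'a where
  "period = (pi / (norm l)\<^sup>2) *\<^sub>R sgn l"

text \<open>Half-open, and as wide as \<open>period\<close> is long, so that each coset has exactly
  one point in it.\<close>

definition slab :: "'a set" where
  "slab = {g. 0 \<le> sgn l \<bullet> g \<and> sgn l \<bullet> g < pi / (norm l)\<^sup>2}"

definition coset :: "'a \<Rightarrow> 'a set" where
  "coset g = hmult br g ` Gam l"

lemma period_center [simp]: "period \<in> lie_center br"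
  using l_center by (simp add: period_def sgn_div_norm subspace_scale[OF subspace_center])

lemma int_period_center [simp]: "c *\<^sub>R period \<in> lie_center br"
  by (simp add: subspace_scale[OF subspace_center])

lemma Gam_eq: "Gam l = range (\<lambda>j::int. of_int j *\<^sub>R period)"
  by (simp add: Gam_def period_def)

lemma coset_eq: "coset g = range (\<lambda>j::int. g + of_int j *\<^sub>R period)"
  by (simp add: coset_def Gam_eq image_image hmult_center)

lemma period_nonzero: "period \<noteq> 0"
  using l_nonzero by (simp add: period_def sgn_zero_iff)

lemma in_coset: "g \<in> coset g"
  unfolding coset_eq by (rule range_eqI[of _ _ 0]) simp

lemma coset_period [simp]: "coset (g + period) = coset g"
proof -
  have "range (\<lambda>j::int. g + period + of_int j *\<^sub>R period) = (\<lambda>j. g + of_int j *\<^sub>R period) ` range ((+) (1::int))"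
    unfolding image_image by (simp add: algebra_simps)
  then show ?thesis
    unfolding coset_eq by (simp only: surj_plus)
qed

lemma coset_translate [simp]: "coset (g + of_int j *\<^sub>R period) = coset g"
  by (rule invariant_int_translation) simp

lemma coset_memD: "h \<in> coset g \<Longrightarrow> coset h = coset g"
  by (subst (asm) coset_eq) auto

lemma quot_eq: "quot br l = range coset"
  by (simp add: quot_def coset_def[abs_def])

lemma coset_in_quot [simp]: "coset g \<in> quot br l"
  by (simp add: quot_eq)

lemma descend_coset:
  assumes "\<And>g. F (g + period) = F g"
  shows "descend F (coset g) = F g"
proof -
  have "F ` coset g = {F g}"
    using invariant_int_translation[of F, OF assms] by (auto simp: coset_eq image_image)
  then show ?thesis
    by (simp add: descend_def)
qed

lemma Union_quot: "A \<subseteq> quot br l \<Longrightarrow> \<Union>A = {g. coset g \<in> A}"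
  using in_coset coset_memD by (auto simp: quot_eq)

lemma hmult_coset: "hmult br g ` coset h = coset (hmult br g h)"
  by (simp add: coset_def image_image hmult_assoc)

lemma sgn_l_period: "sgn l \<bullet> period = pi / (norm l)\<^sup>2"
  using l_nonzero by (simp add: period_def dot_square_norm norm_sgn)

lemma cyclic_domain_slab: "cyclic_domain period slab"
  unfolding cyclic_domain_def
proof safe
  show "slab \<in> sets borel"
    unfolding slab_def by measurable
  define a where "a = pi / (norm l)\<^sup>2"
  have a: "a > 0"
    using l_nonzero by (simp add: a_def)
  \<comment> \<open>The right translate is found by rounding the coordinate along \<open>l\<close>,
    measured in multiples of the period length \<open>a\<close>.\<close>
  have iff: "x + of_int j *\<^sub>R period \<in> slab \<longleftrightarrow> j = - \<lfloor>(sgn l \<bullet> x) / a\<rfloor>" for x :: 'a and j :: int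
  proof -
    have "x + of_int j *\<^sub>R period \<in> slab \<longleftrightarrow> 0 \<le> sgn l \<bullet> x + of_int j * a \<and> sgn l \<bullet> x + of_int j * a < a"
      by (simp add: slab_def inner_add_right sgn_l_period a_def)
    also have "\<dots> \<longleftrightarrow> of_int (- j) \<le> (sgn l \<bullet> x) / a \<and> (sgn l \<bullet> x) / a < of_int (- j) + 1"
      using a by (simp add: field_simps) linarith
    also have "\<dots> \<longleftrightarrow> \<lfloor>(sgn l \<bullet> x) / a\<rfloor> = - j"
      by (simp add: floor_eq_iff)
    finally show ?thesis by auto
  qed
  fix x
  show "\<exists>j::int. x + of_int j *\<^sub>R period \<in> slab"
    by (simp add: iff)
  fix j j' :: int
  assume "x + of_int j *\<^sub>R period \<in> slab" "x + of_int j' *\<^sub>R period \<in> slab"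
  then show "j = j'"
    by (simp add: iff)
qed

section \<open>The quotient sigma-algebra and the push-forward of Lebesgue measure from the
  slab\<close>

definition quot_algebra :: "'a set measure" where
  "quot_algebra = measure_of (quot br l) {A. A \<subseteq> quot br l \<and> \<Union>A \<in> sets borel} (\<lambda>_. 0)"

lemma sigma_algebra_quot: "sigma_algebra (quot br l) {A. A \<subseteq> quot br l \<and> \<Union>A \<in> sets borel}"
proof (rule sigma_algebra_iff2[THEN iffD2], safe)
  fix A assume A: "A \<subseteq> quot br l" "\<Union>A \<in> sets borel"
  then have "\<Union>(quot br l - A) = UNIV - \<Union>A"
    by (subst (1 2) Union_quot) auto
  then show "\<Union>(quot br l - A) \<in> sets borel"
    using A by auto
next
  fix A :: "nat \<Rightarrow> 'a set set"
  assume A: "range A \<subseteq> {A. A \<subseteq> quot br l \<and> \<Union>A \<in> sets borel}"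
  have "\<Union>(\<Union>(range A)) = (\<Union>n. \<Union>(A n))"
    by auto
  moreover have "(\<Union>n. \<Union>(A n)) \<in> sets borel"
    using A by (intro sets.countable_nat_UN) auto
  ultimately show "\<Union>(\<Union>(range A)) \<in> sets borel"
    by simp
qed auto

lemma space_quot_algebra [simp]: "space quot_algebra = quot br l"
  by (simp add: quot_algebra_def space_measure_of_conv)

lemma sets_quot_algebra: "sets quot_algebra = {A. A \<subseteq> quot br l \<and> \<Union>A \<in> sets borel}"
  using sigma_algebra.sets_measure_of_eq[OF sigma_algebra_quot] by (simp add: quot_algebra_def)

text \<open>Universal property of the quotient sigma-algebra: the union of the cosets in a preimage
  is the preimage under the pulled-back function. It reduces measurability on the quotient to
  measurability on the group.\<close>

lemma measurable_quot_algebra_iff: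
  "\<Phi> \<in> measurable quot_algebra N \<longleftrightarrow> (\<lambda>g. \<Phi> (coset g)) \<in> measurable borel N"
proof -
  have "\<Union>(\<Phi> -` B \<inter> quot br l) = (\<lambda>g. \<Phi> (coset g)) -` B" for B
    by (subst Union_quot) auto
  then show ?thesis
    by (auto simp: measurable_def sets_quot_algebra quot_eq)
qed

lemma coset_measurable [measurable]: "coset \<in> measurable borel quot_algebra"
  using measurable_quot_algebra_iff[of "\<lambda>x. x" quot_algebra] by simp

definition slab_measure :: "'a set measure" where
  "slab_measure = distr (restrict_space lborel slab) quot_algebra coset"

lemma slab_borel [measurable]: "slab \<in> sets borel"
  by (rule cyclic_domain_borel[OF cyclic_domain_slab])

lemma coset_measurable_slab: "coset \<in> measurable (restrict_space lborel slab) quot_algebra"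
  by (intro measurable_restrict_space1) simp

lemma nn_integral_slab_measure:
  assumes [measurable]: "\<Phi> \<in> borel_measurable quot_algebra"
  shows "(\<integral>\<^sup>+ C. \<Phi> C \<partial>slab_measure) = (\<integral>\<^sup>+ g. indicator slab g * \<Phi> (coset g) \<partial>lborel)"
  unfolding slab_measure_def using coset_measurable_slab
  by (simp add: nn_integral_distr nn_integral_restrict_space mult.commute)

lemma emeasure_slab_measure:
  assumes "A \<in> sets quot_algebra"
  shows "emeasure slab_measure A = (\<integral>\<^sup>+ g. indicator slab g * indicator {g. coset g \<in> A} g \<partial>lborel)"
proof -
  have "emeasure slab_measure A = (\<integral>\<^sup>+ C. indicator A C \<partial>slab_measure)"
    using assms by (simp add: slab_measure_def)
  also have "\<dots> = (\<integral>\<^sup>+ g. indicator slab g * indicator {g. coset g \<in> A} g \<partial>lborel)"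
    using assms by (simp add: nn_integral_slab_measure indicator_def[abs_def])
  finally show ?thesis .
qed

text \<open>The sum over \<open>Gam l\<close> is indexed by the integers because
  \<open>period\<close> is nonzero, and it is constant on cosets because moving \<open>g\<close> by
  one period only shifts the index.\<close>

lemma descend_Gam_sum:
  "descend (\<lambda>g. \<Sum>\<^sub>\<infinity>\<gamma>\<in>Gam l. \<phi> (hmult br g \<gamma>)) (coset g)
    = (\<integral>\<^sup>+ j. \<phi> (g + of_int j *\<^sub>R period) \<partial>count_space (UNIV::int set))"
proof -
  have inj: "inj (\<lambda>j::int. of_int j *\<^sub>R period)"
    using period_nonzero by (auto simp: inj_def)
  have sum: "(\<Sum>\<^sub>\<infinity>\<gamma>\<in>Gam l. \<phi> (hmult br g \<gamma>))
      = (\<integral>\<^sup>+ j. \<phi> (g + of_int j *\<^sub>R period) \<partial>count_space (UNIV::int set))" for g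
    unfolding Gam_eq infsum_reindex[OF inj] by (simp add: infsum_int_ennreal hmult_center comp_def)
  have inv: "(\<integral>\<^sup>+ j. \<phi> (g + period + of_int j *\<^sub>R period) \<partial>count_space (UNIV::int set))
      = (\<integral>\<^sup>+ j. \<phi> (g + of_int j *\<^sub>R period) \<partial>count_space (UNIV::int set))" for g
  proof -
    have "(\<integral>\<^sup>+ j. \<phi> (g + of_int (1 + j) *\<^sub>R period) \<partial>count_space (UNIV::int set))
        = (\<integral>\<^sup>+ j. \<phi> (g + of_int j *\<^sub>R period) \<partial>count_space (UNIV::int set))"
      by (rule nn_integral_bij_count_space[of "(+) 1"]) simp
    then show ?thesis
      by (simp add: scaleR_add_left add.assoc)
  qed
  show ?thesis
    unfolding sum by (rule descend_coset) (rule inv)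
qed

text \<open>Left translation replaces the slab by another set of coset representatives, and
  integrals of periodic functions do not depend on the representatives. The normalisation is the
  unfolding formula.\<close>

lemma is_quot_haar_slab_measure: "is_quot_haar br l slab_measure"
  unfolding is_quot_haar_def
proof (intro conjI allI ballI impI)
  show "space slab_measure = quot br l"
    by (simp add: slab_measure_def)
  show sets: "sets slab_measure = {A. A \<subseteq> quot br l \<and> \<Union> A \<in> sets borel}"
    by (simp add: slab_measure_def sets_quot_algebra)
  fix g A assume A: "A \<in> sets slab_measure"
  then have A': "A \<in> sets quot_algebra" "A \<subseteq> quot br l"
    by (auto simp: slab_measure_def sets_quot_algebra)
  define E where "E = {x. coset x \<in> A}"
  have E[measurable]: "E \<in> sets borel"
    using A sets Union_quot[of A] by (simp add: E_def)
  define gA where "gA = (\<lambda>C. hmult br g ` C) ` A"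
  have gA_iff: "coset x \<in> gA \<longleftrightarrow> hmult br (- g) x \<in> E" for x
  proof
    assume "coset x \<in> gA"
    then obtain y where y: "coset x = coset (hmult br g y)" "coset y \<in> A"
      using A'(2) by (auto simp: gA_def quot_eq hmult_coset)
    then have "coset (hmult br (- g) x) = coset (hmult br (- g) (hmult br g y))"
      by (metis hmult_coset)
    then show "hmult br (- g) x \<in> E"
      using y by (simp add: E_def)
  next
    assume "hmult br (- g) x \<in> E"
    then show "coset x \<in> gA"
      unfolding gA_def E_def by (intro image_eqI[of _ _ "coset (hmult br (- g) x)"]) (simp_all add: hmult_coset)
  qed
  have gA_quot: "gA \<subseteq> quot br l"
    using A'(2) by (auto simp: gA_def quot_eq hmult_coset)
  have "\<Union>gA = (\<lambda>x. hmult br (- g) x) -` E"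
    using gA_iff by (simp add: Union_quot[OF gA_quot] vimage_def)
  moreover have "(\<lambda>x. hmult br (- g) x) -` E \<in> sets borel"
    using measurable_sets[of "\<lambda>x. hmult br (- g) x" borel borel E] by simp
  ultimately have gA: "gA \<in> sets quot_algebra"
    using gA_quot by (simp add: sets_quot_algebra)
  \<comment> \<open>Left translation by \<open>g\<close> commutes with adding the central period, so
    the preimage of the slab is again a cyclic domain.\<close>
  define D where "D = hmult br g -` slab"
  have hg: "hmult br g (x + c *\<^sub>R period) = hmult br g x + c *\<^sub>R period" for x c
    by (metis hmult_assoc hmult_center(1) int_period_center)
  have D: "cyclic_domain period D"
    unfolding cyclic_domain_def
  proof (intro conjI allI)
    show "D \<in> sets borel"
      using measurable_sets[of "\<lambda>x. hmult br g x" borel borel slab] by (simp add: D_def)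
    show "\<exists>!j::int. x + of_int j *\<^sub>R period \<in> D" for x
      using cyclic_domain_slab by (simp add: D_def hg cyclic_domain_def)
  qed
  note [measurable] = cyclic_domain_borel[OF D]
  have "emeasure slab_measure gA = (\<integral>\<^sup>+ x. indicator slab x * indicator E (hmult br (- g) x) \<partial>lborel)"
    using emeasure_slab_measure[OF gA] by (simp add: gA_iff indicator_def[abs_def])
  also have "\<dots> = (\<integral>\<^sup>+ x. indicator slab (hmult br g x) * indicator E x \<partial>lborel)"
    by (subst distr_lborel_hmult_left[of g, symmetric]) (simp add: nn_integral_distr)
  also have "\<dots> = (\<integral>\<^sup>+ x. indicator D x * indicator E x \<partial>lborel)"
    by (simp add: D_def indicator_def)
  also have "\<dots> = (\<integral>\<^sup>+ x. indicator slab x * indicator E x \<partial>lborel)"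
    by (rule nn_integral_cyclic_domain_eq[OF D cyclic_domain_slab]) (measurable, simp add: E_def indicator_def)
  also have "\<dots> = emeasure slab_measure A"
    using emeasure_slab_measure[OF A'(1)] by (simp add: E_def)
  finally show "emeasure slab_measure ((\<lambda>C. hmult br g ` C) ` A) = emeasure slab_measure A"
    by (simp add: gA_def)
next
  fix \<phi> :: "'a \<Rightarrow> ennreal" assume [measurable]: "\<phi> \<in> borel_measurable borel"
  have meas: "(\<lambda>C. descend (\<lambda>g. \<Sum>\<^sub>\<infinity>\<gamma>\<in>Gam l. \<phi> (hmult br g \<gamma>)) C) \<in> borel_measurable quot_algebra"
    unfolding measurable_quot_algebra_iff descend_Gam_sum nn_integral_count_space_int by measurable
  show "(\<integral>\<^sup>+ g. \<phi> g \<partial>lborel)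
    = (\<integral>\<^sup>+ C. descend (\<lambda>g. \<Sum>\<^sub>\<infinity>\<gamma>\<in>Gam l. \<phi> (hmult br g \<gamma>)) C \<partial>slab_measure)"
    unfolding nn_integral_slab_measure[OF meas] descend_Gam_sum
    by (rule nn_integral_unfold[OF cyclic_domain_slab]) simp
qed

text \<open>For uniqueness the normalisation is tested on the indicator of the part of the slab
  lying over \<open>A\<close>. Its sum over \<open>Gam l\<close> descends to the indicator of
  \<open>A\<close>, so every admissible measure gives \<open>A\<close> the same value.\<close>

lemma quot_haar_eq: "quot_haar br l = slab_measure"
  unfolding quot_haar_def
proof (rule the_equality)
  show "is_quot_haar br l slab_measure"
    by (rule is_quot_haar_slab_measure)
  have unique: "emeasure M A = (\<integral>\<^sup>+ g. indicator {g. coset g \<in> A} g * indicator slab g \<partial>lborel)"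
    if M: "is_quot_haar br l M" and A: "A \<in> sets M" for M A
  proof -
    have A': "A \<subseteq> quot br l" "\<Union>A \<in> sets borel"
      using M A by (auto simp: is_quot_haar_def)
    define E where "E = {g. coset g \<in> A}"
    have [measurable]: "E \<in> sets borel"
      using A' by (simp add: E_def Union_quot)
    have "(\<integral>\<^sup>+ g. indicator E g * indicator slab g \<partial>lborel)
        = (\<integral>\<^sup>+ C. descend (\<lambda>g. \<Sum>\<^sub>\<infinity>\<gamma>\<in>Gam l. indicator E (hmult br g \<gamma>) * indicator slab (hmult br g \<gamma>)) C \<partial>M)"
      using M unfolding is_quot_haar_def
      by (elim conjE allE[of _ "\<lambda>g. indicator E g * indicator slab g"]) measurable
    also have "\<dots> = (\<integral>\<^sup>+ C. indicator A C \<partial>M)"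
    proof (rule nn_integral_cong)
      fix C assume "C \<in> space M"
      then obtain g where C: "C = coset g"
        using M by (auto simp: is_quot_haar_def quot_eq)
      have "(\<integral>\<^sup>+ j. indicator E (g + of_int j *\<^sub>R period) * indicator slab (g + of_int j *\<^sub>R period) \<partial>count_space (UNIV::int set))
          = (\<integral>\<^sup>+ j. indicator slab (g + of_int j *\<^sub>R period) * indicator E g \<partial>count_space (UNIV::int set))"
        by (intro nn_integral_cong) (simp add: E_def indicator_def)
      also have "\<dots> = indicator A C"
        unfolding nn_integral_cyclic_domain_one[OF cyclic_domain_slab] by (simp add: C E_def indicator_def)
      finally show "descend (\<lambda>g. \<Sum>\<^sub>\<infinity>\<gamma>\<in>Gam l. indicator E (hmult br g \<gamma>) * indicator slab (hmult br g \<gamma>)) C = (indicator A C :: ennreal)"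
        unfolding C by (subst descend_Gam_sum)
    qed
    also have "\<dots> = emeasure M A"
      using A by simp
    finally show ?thesis
      by (simp add: E_def)
  qed
  fix M assume M: "is_quot_haar br l M"
  show "M = slab_measure"
  proof (rule measure_eqI)
    show sets: "sets M = sets slab_measure"
      using M is_quot_haar_slab_measure unfolding is_quot_haar_def by metis
    show "emeasure M A = emeasure slab_measure A" if "A \<in> sets M" for A
      using that sets unique[OF M] unique[OF is_quot_haar_slab_measure] by simp
  qed
qed

text \<open>Formulated with \<open>has_bochner_integral\<close> so that existence and value of a
  quotient integral pass to the slab together.\<close>

lemma has_bochner_integral_quot_haar:
  fixes \<Phi> :: "'a set \<Rightarrow> 'b::{banach, second_countable_topology}"
  assumes "(\<lambda>g. \<Phi> (coset g)) \<in> borel_measurable borel"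
  shows "has_bochner_integral (quot_haar br l) \<Phi> I
    \<longleftrightarrow> has_bochner_integral lborel (\<lambda>g. indicator slab g *\<^sub>R \<Phi> (coset g)) I"
proof -
  have [measurable]: "\<Phi> \<in> borel_measurable quot_algebra"
    using assms by (simp add: measurable_quot_algebra_iff)
  show ?thesis
    unfolding quot_haar_eq slab_measure_def has_bochner_integral_iff
    using coset_measurable_slab
    by (simp add: integrable_distr_eq integral_distr integrable_restrict_space integral_restrict_space)
qed

end

section \<open>Integration of the X-ray transform against functions on the quotient\<close>

locale h_type_xray = h_type_quotient +
  fixes \<nu> :: 'a
  assumes \<nu>_horizontal: "\<nu> \<in> horizontal br" and \<nu>_norm: "norm \<nu> = 1"
begin

abbreviation "geo \<equiv> geod br \<nu> l"

definition time :: real where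
  "time = 2 * pi / norm l"

lemma time_pos: "time > 0"
  using l_nonzero by (simp add: time_def)

lemmas geo_eq = geod_eq[OF l_center l_nonzero \<nu>_horizontal]

text \<open>The horizontal part rotates with angular speed \<open>norm l\<close>, so it closes up
  after \<open>2 * pi / norm l\<close>; the central drift accumulated in that time is
  \<open>pi / (norm l)\<^sup>2\<close>, the length of \<open>period\<close>.\<close>

lemma geo_time: "geo (s + time) = geo s + period"
proof -
  have "(s + time) * norm l = s * norm l + 2 * pi" "time / (2 * norm l) = pi / (norm l)\<^sup>2"
    using l_nonzero by (simp_all add: time_def field_simps power2_eq_square)
  then show ?thesis
    by (simp add: geo_eq period_def add_divide_distrib scaleR_add_left)
qed

lemma geo_continuous [continuous_intros]:
  fixes g :: "'b::t2_space \<Rightarrow> real"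
  shows "continuous_on S g \<Longrightarrow> continuous_on S (\<lambda>x. geo (g x))"
  unfolding geo_eq using l_nonzero by (auto intro!: continuous_intros)

lemma geo_measurable [measurable]: "geo \<in> borel_measurable borel"
  by (intro borel_measurable_continuous_onI continuous_intros)

lemma hmult_period: "hmult br (g + period) h = hmult br g h + period" "hmult br g (h + period) = hmult br g h + period"
  by (metis hmult_assoc hmult_center period_center)+

definition line_integral :: "('a \<Rightarrow> complex) \<Rightarrow> 'a \<Rightarrow> complex" where
  "line_integral f g = (\<integral>s. f (hmult br g (geo s)) \<partial>lborel)"

lemma line_integral_period:
  assumes [measurable]: "f \<in> borel_measurable borel"
  shows "line_integral f (g + period) = line_integral f g"
proof -
  have "line_integral f (g + period) = (\<integral>s. f (hmult br g (geo (time + s))) \<partial>lborel)"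
    by (simp add: line_integral_def hmult_period add.commute[of time] geo_time)
  also have "\<dots> = (\<integral>s. f (hmult br g (geo s)) \<partial>distr lborel borel ((+) time))"
    by (simp add: integral_distr)
  finally show ?thesis
    by (simp add: lborel_distr_plus line_integral_def)
qed

lemma xray_coset:
  assumes "f \<in> borel_measurable borel"
  shows "xray br \<nu> l f (coset g) = line_integral f g"
  unfolding xray_def by (subst descend_coset) (use line_integral_period[OF assms] in \<open>simp_all add: line_integral_def\<close>)

lemma line_integral_measurable [measurable]:
  assumes [measurable]: "f \<in> borel_measurable borel"
  shows "line_integral f \<in> borel_measurable borel"
  unfolding line_integral_def by measurable

text \<open>
  On \<open>G \<times> \<real>\<close> the integrand is invariant under translation by \<open>(period, -time)\<close>; both
  \<open>slab \<times> \<real>\<close> and \<open>G \<times> [0, time)\<close> are fundamental domains of this action.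
\<close>

lemma cyclic_domain_slab_times: "cyclic_domain (period, - time) (slab \<times> (UNIV::real set))"
  using cyclic_domain_slab unfolding cyclic_domain_def by (auto intro: borel_Times)

lemma cyclic_domain_times_interval: "cyclic_domain (period, - time) ((UNIV::'a set) \<times> {0..<time})"
  unfolding cyclic_domain_def
proof (intro conjI allI)
  show "(UNIV::'a set) \<times> {0..<time} \<in> sets borel"
    by (intro borel_Times) auto
  fix p :: "'a \<times> real"
  \<comment> \<open>Adding \<open>j\<close> times the vector removes \<open>j * time\<close> from
    the second coordinate, so \<open>j\<close> has to be the floor of the elapsed number of
    periods.\<close>
  have iff: "p + of_int j *\<^sub>R (period, - time) \<in> UNIV \<times> {0..<time} \<longleftrightarrow> \<lfloor>snd p / time\<rfloor> = j" for j :: int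
    using time_pos
    by (auto simp: mem_Times_iff floor_eq_iff pos_le_divide_eq pos_divide_less_eq distrib_right)
  show "\<exists>!j::int. p + of_int j *\<^sub>R (period, - time) \<in> UNIV \<times> {0..<time}"
    unfolding iff by auto
qed

lemma nn_integral_hmult_right:
  assumes [measurable]: "h \<in> borel_measurable borel"
  shows "(\<integral>\<^sup>+ g. h (hmult br g a) \<partial>lborel) = (\<integral>\<^sup>+ g. h g \<partial>lborel)"
  by (subst (2) distr_lborel_hmult_right[of a, symmetric]) (simp add: nn_integral_distr)

lemma integral_hmult_right:
  fixes h :: "'a \<Rightarrow> complex"
  assumes [measurable]: "h \<in> borel_measurable borel"
  shows "(\<integral>g. h (hmult br g a) \<partial>lborel) = (\<integral>g. h g \<partial>lborel)"
  by (subst (2) distr_lborel_hmult_right[of a, symmetric]) (simp add: integral_distr)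

text \<open>A transversal needs the half-open interval, whereas \<open>multiplier\<close> is defined
  with the closed one; the endpoint is a null set.\<close>

lemma integral_interval_half_open:
  fixes h :: "real \<Rightarrow> complex"
  assumes [measurable]: "h \<in> borel_measurable borel"
  shows "(\<integral>s. indicator {0..<time} s *\<^sub>R h s \<partial>lborel) = (\<integral>s. h s \<partial>restrict_space lborel {0..time})"
  unfolding integral_restrict_space[of "{0..time}" lborel h, simplified]
  by (intro integral_cong_AE eventually_mono[OF AE_lborel_singleton[of time]]) (auto simp: indicator_def)

text \<open>Convergence is part of the claim. It is checked on the group times
  \<open>{0..<time}\<close>, where right invariance bounds the integral by \<open>time * B\<close>
  times the L1 norm of \<open>f\<close>. Passing to the other fundamental domain then supplies the
  integrability on \<open>slab\<close> times the line that Fubini requires there. The function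
  \<open>X\<close> on cosets is any function whose pullback is \<open>\<psi>\<close>.\<close>

lemma has_bochner_integral_xray:
  assumes f: "integrable lborel f" and \<psi>[measurable]: "\<psi> \<in> borel_measurable borel"
    and bound: "\<And>g. norm (\<psi> g) \<le> B" and inv: "\<And>g. \<psi> (g + period) = \<psi> g"
    and X: "\<And>g. X (coset g) = \<psi> g"
  shows "has_bochner_integral (quot_haar br l) (\<lambda>C. xray br \<nu> l f C * X C)
    (\<integral>s. (\<integral>g. f g * \<psi> (hmult br g (- geo s)) \<partial>lborel) \<partial>restrict_space lborel {0..time})"
proof -
  have fm[measurable]: "f \<in> borel_measurable borel"
    using f by (simp add: borel_measurable_integrable)
  define \<Phi> where "\<Phi> p = f (hmult br (fst p) (geo (snd p))) * \<psi> (fst p)" for p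
  have \<Phi>[measurable]: "\<Phi> \<in> borel_measurable borel"
  proof -
    have "\<Phi> \<in> borel_measurable (lborel \<Otimes>\<^sub>M lborel)"
      unfolding \<Phi>_def by measurable
    then show ?thesis
      by (simp add: lborel_prod)
  qed
  let ?D = "slab \<times> (UNIV::real set)" and ?E = "(UNIV::'a set) \<times> {0..<time}"
  \<comment> \<open>Moving \<open>g\<close> by a period while stepping back by \<open>time\<close>
    along the geodesic leaves the argument of \<open>f\<close> unchanged.\<close>
  have \<Phi>_inv: "\<Phi> (p + (period, - time)) = \<Phi> p" for p
  proof -
    have "hmult br (fst p + period) (geo (snd p - time)) = hmult br (fst p) (geo (snd p))"
      using geo_time[of "snd p - time"] by (simp add: hmult_period(1) hmult_period(2)[symmetric])
    then show ?thesis
      by (simp add: \<Phi>_def inv)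
  qed
  have [measurable]: "?D \<in> sets borel" "?E \<in> sets borel"
    using cyclic_domain_borel cyclic_domain_slab_times cyclic_domain_times_interval by blast+
  have intE: "integrable lborel (\<lambda>p. indicator ?E p *\<^sub>R \<Phi> p)"
  proof (rule integrableI_bounded)
    have "(\<integral>\<^sup>+ p. ennreal (norm (indicator ?E p *\<^sub>R \<Phi> p)) \<partial>lborel)
        = (\<integral>\<^sup>+ p. ennreal (norm (indicator ?E p *\<^sub>R \<Phi> p)) \<partial>(lborel \<Otimes>\<^sub>M lborel))"
      by (simp add: lborel_prod)
    also have "\<dots> = (\<integral>\<^sup>+ s. \<integral>\<^sup>+ g. ennreal (norm (indicator ?E (g, s) *\<^sub>R \<Phi> (g, s))) \<partial>lborel \<partial>lborel)"
      by (rule lborel_pair.nn_integral_snd[symmetric]) (simp add: lborel_prod)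
    also have "\<dots> \<le> (\<integral>\<^sup>+ s. indicator {0..<time} s * (ennreal B * (\<integral>\<^sup>+ g. ennreal (norm (f g)) \<partial>lborel)) \<partial>lborel)"
    proof (rule nn_integral_mono)
      fix s
      have "(\<integral>\<^sup>+ g. ennreal (norm (indicator ?E (g, s) *\<^sub>R \<Phi> (g, s))) \<partial>lborel)
          \<le> (\<integral>\<^sup>+ g. indicator {0..<time} s * (ennreal B * ennreal (norm (f (hmult br g (geo s))))) \<partial>lborel)"
      proof (rule nn_integral_mono)
        fix g
        have "norm (\<Phi> (g, s)) \<le> B * norm (f (hmult br g (geo s)))"
          unfolding \<Phi>_def by (simp add: norm_mult mult.commute mult_right_mono bound)
        then show "ennreal (norm (indicator ?E (g, s) *\<^sub>R \<Phi> (g, s)))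
            \<le> indicator {0..<time} s * (ennreal B * ennreal (norm (f (hmult br g (geo s)))))"
          by (auto simp: indicator_def ennreal_mult''[symmetric] ennreal_leI)
      qed
      also have "\<dots> = indicator {0..<time} s * (ennreal B * (\<integral>\<^sup>+ g. ennreal (norm (f (hmult br g (geo s)))) \<partial>lborel))"
        by (simp add: nn_integral_cmult)
      also have "(\<integral>\<^sup>+ g. ennreal (norm (f (hmult br g (geo s)))) \<partial>lborel) = (\<integral>\<^sup>+ g. ennreal (norm (f g)) \<partial>lborel)"
        by (rule nn_integral_hmult_right) measurable
      finally show "(\<integral>\<^sup>+ g. ennreal (norm (indicator ?E (g, s) *\<^sub>R \<Phi> (g, s))) \<partial>lborel)
          \<le> indicator {0..<time} s * (ennreal B * (\<integral>\<^sup>+ g. ennreal (norm (f g)) \<partial>lborel))" .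
    qed
    also have "\<dots> = ennreal time * (ennreal B * (\<integral>\<^sup>+ g. ennreal (norm (f g)) \<partial>lborel))"
      using time_pos by (simp add: nn_integral_multc)
    also have "\<dots> < \<infinity>"
      using f by (simp add: integrable_iff_bounded ennreal_mult_less_top)
    finally show "(\<integral>\<^sup>+ p. ennreal (norm (indicator ?E p *\<^sub>R \<Phi> p)) \<partial>lborel) < \<infinity>" .
  qed measurable
  note swap = integral_cyclic_domain_eq[OF cyclic_domain_times_interval cyclic_domain_slab_times \<Phi> \<Phi>_inv intE]
  have intD': "integrable (lborel \<Otimes>\<^sub>M lborel) (\<lambda>p. indicator ?D p *\<^sub>R \<Phi> p)"
    and intE': "integrable (lborel \<Otimes>\<^sub>M lborel) (\<lambda>p. indicator ?E p *\<^sub>R \<Phi> p)"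
    using swap(1) intE by (simp_all add: lborel_prod)
  have inner: "(\<integral>s. indicator ?D (g, s) *\<^sub>R \<Phi> (g, s) \<partial>lborel) = indicator slab g *\<^sub>R (line_integral f g * \<psi> g)" for g
    by (simp add: indicator_def \<Phi>_def line_integral_def)
  have "has_bochner_integral lborel (\<lambda>g. indicator slab g *\<^sub>R (line_integral f g * \<psi> g)) (\<integral>p. indicator ?D p *\<^sub>R \<Phi> p \<partial>(lborel \<Otimes>\<^sub>M lborel))"
    unfolding has_bochner_integral_iff
    using lborel_pair.integrable_fst'[OF intD'] lborel_pair.integral_fst'[OF intD'] by (simp add: inner)
  moreover have "(\<integral>p. indicator ?D p *\<^sub>R \<Phi> p \<partial>(lborel \<Otimes>\<^sub>M lborel)) = (\<integral>p. indicator ?E p *\<^sub>R \<Phi> p \<partial>(lborel \<Otimes>\<^sub>M lborel))"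
    using swap(2) by (simp add: lborel_prod)
  moreover have "\<dots> = (\<integral>s. (\<integral>g. indicator ?E (g, s) *\<^sub>R \<Phi> (g, s) \<partial>lborel) \<partial>lborel)"
    using lborel_pair.integral_snd[of "\<lambda>g s. indicator ?E (g, s) *\<^sub>R \<Phi> (g, s)"] intE' by (simp add: case_prod_unfold)
  moreover have "\<dots> = (\<integral>s. indicator {0..<time} s *\<^sub>R (\<integral>g. f g * \<psi> (hmult br g (- geo s)) \<partial>lborel) \<partial>lborel)"
  proof (rule Bochner_Integration.integral_cong)
    fix s
    \<comment> \<open>The factor \<open>geo s\<close> is inserted together with its inverse, so that
      the integrand depends on \<open>hmult br g (geo s)\<close> alone and right invariance
      applies.\<close>
    have "(\<integral>g. \<Phi> (g, s) \<partial>lborel) = (\<integral>g. f (hmult br g (geo s)) * \<psi> (hmult br (hmult br g (geo s)) (- geo s)) \<partial>lborel)"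
      by (simp add: \<Phi>_def hmult_assoc)
    also have "\<dots> = (\<integral>g. f g * \<psi> (hmult br g (- geo s)) \<partial>lborel)"
      by (rule integral_hmult_right) measurable
    finally show "(\<integral>g. indicator ?E (g, s) *\<^sub>R \<Phi> (g, s) \<partial>lborel)
        = indicator {0..<time} s *\<^sub>R (\<integral>g. f g * \<psi> (hmult br g (- geo s)) \<partial>lborel)"
      by (simp add: indicator_def)
  qed simp
  moreover have "\<dots> = (\<integral>s. (\<integral>g. f g * \<psi> (hmult br g (- geo s)) \<partial>lborel) \<partial>restrict_space lborel {0..time})"
    by (rule integral_interval_half_open) measurable
  ultimately show ?thesis
    by (subst has_bochner_integral_quot_haar) (simp_all add: xray_coset X)
qed

text \<open>The instance with constant weight 1.\<close>

lemma integrable_xray: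
  assumes "integrable lborel f"
  shows "integrable (quot_haar br l) (xray br \<nu> l f)"
  using has_bochner_integral_xray[OF assms, of "\<lambda>_. 1" 1 "\<lambda>_. 1"] by (simp add: has_bochner_integral_iff)

end

section \<open>The one-dimensional representations\<close>

lemma integral_exp_int_multiple:
  fixes k :: int
  assumes \<omega>: "\<omega> > 0"
  shows "(\<integral>s. exp (\<i> * of_real (of_int k * \<omega> * s)) \<partial>restrict_space lborel {0..2 * pi / \<omega>})
    = (if k = 0 then of_real (2 * pi / \<omega>) else 0)"
proof (cases "k = 0")
  case True
  then show ?thesis
    using \<omega> by (simp add: measure_def emeasure_restrict_space space_restrict_space scaleR_conv_of_real)
next
  case False
  define c where "c = \<i> * of_real (of_int k * \<omega>)"
  have c: "c \<noteq> 0"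
    using False \<omega> by (simp add: c_def)
  have "(\<integral>s. indicator {0..2 * pi / \<omega>} s *\<^sub>R exp (c * of_real s) \<partial>lborel)
      = exp (c * of_real (2 * pi / \<omega>)) / c - exp (c * of_real 0) / c"
  proof (rule integral_FTC_Icc)
    show "((\<lambda>s. exp (c * of_real s) / c) has_vector_derivative exp (c * of_real s)) (at s within {0..2 * pi / \<omega>})" for s
      using c by (auto intro!: derivative_eq_intros has_vector_derivative_real_field)
    show "continuous_on {0..2 * pi / \<omega>} (\<lambda>s. exp (c * complex_of_real s))"
      by (intro continuous_intros)
  qed (use \<omega> in simp)
  moreover have "exp (c * of_real (2 * pi / \<omega>)) = 1"
    using \<omega> exp_integer_2pi[of "of_int k"] by (simp add: c_def mult_ac)
  ultimately show ?thesis
    using False by (simp add: integral_restrict_space c_def mult_ac)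
qed

text \<open>With w the rotating point, i Im w = u + v for u = w / 2 and v = - cnj w / 2. After
  expanding the exponential and the binomials only terms with equal powers of u and v have nonzero
  mean; the one of degree 2k carries the coefficient (2k choose k) / (2k)! = 1 / (k!)^2, which gives
  the series of \<open>bessel_J0\<close>.\<close>

lemma integral_exp_Im_circle:
  assumes \<omega>: "\<omega> > 0"
  shows "(\<integral>s. exp (\<i> * of_real (Im (P * exp (\<i> * of_real (\<omega> * s))))) \<partial>restrict_space lborel {0..2 * pi / \<omega>})
    = of_real (2 * pi / \<omega> * bessel_J0 (norm P))"
proof -
  define M where "M = restrict_space lborel {0..2 * pi / \<omega>}"
  define T where "T = 2 * pi / \<omega>"
  interpret M: finite_measure M
    unfolding M_def using \<omega> by (intro finite_measureI) (simp add: emeasure_restrict_space space_restrict_space)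
  have measM: "measure M (space M) = T"
    using \<omega> by (simp add: M_def T_def space_restrict_space emeasure_restrict_space measure_def)
  define w where "w s = P * exp (\<i> * of_real (\<omega> * s))" for s
  define X where "X s = \<i> * of_real (Im (w s))" for s
  have meas[measurable]: "w \<in> borel_measurable M" "X \<in> borel_measurable M" "(\<lambda>s. cnj (w s)) \<in> borel_measurable M"
    unfolding w_def X_def M_def by (auto intro!: measurable_restrict_space1 borel_measurable_continuous_onI continuous_intros)
  have norm_w: "norm (w s) = norm P" for s
    by (simp add: w_def norm_mult)
  define u where "u s = w s / 2" for s
  define v where "v s = - cnj (w s) / 2" for s
  have [measurable]: "u \<in> borel_measurable M" "v \<in> borel_measurable M"
    unfolding u_def v_def by measurable
  have X_eq: "X s = u s + v s" for s
    by (simp add: X_def u_def v_def complex_eq_iff)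
  have norm_X: "norm (X s) \<le> norm P" for s
    using abs_Im_le_cmod[of "w s"] by (simp add: X_def norm_mult norm_w)
  \<comment> \<open>\<open>u\<close> and \<open>v\<close> rotate in opposite directions, so the
    product has frequency \<open>(j - i) * \<omega>\<close> and integrates to 0 unless the exponents
    agree; the sign comes from the minus in \<open>v\<close>.\<close>
  have mono: "(\<integral>s. u s ^ j * v s ^ i \<partial>M) = (if j = i then of_real (T * (- 1) ^ j * (norm P / 2) ^ (2 * j)) else 0)" for i j
  proof -
    have "u s ^ j * v s ^ i
        = ((P / 2) ^ j * (- cnj P / 2) ^ i) * exp (\<i> * of_real (of_int (int j - int i) * \<omega> * s))" for s
    proof -
      have "u s = (P / 2) * cis (\<omega> * s)" "v s = (- cnj P / 2) * cnj (cis (\<omega> * s))"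
        by (simp_all add: u_def v_def w_def cis_conv_exp)
      then have "u s ^ j * v s ^ i
          = ((P / 2) ^ j * (- cnj P / 2) ^ i) * (cis (\<omega> * s) ^ j * cnj (cis (\<omega> * s)) ^ i)"
        by (simp only: power_mult_distrib mult.assoc mult.left_commute)
      also have "cis (\<omega> * s) ^ j * cnj (cis (\<omega> * s)) ^ i = cis (of_int (int j - int i) * \<omega> * s)"
        unfolding cis_cnj Complex.DeMoivre cis_mult by (simp add: algebra_simps)
      finally show ?thesis
        by (simp only: cis_conv_exp)
    qed
    then have "(\<integral>s. u s ^ j * v s ^ i \<partial>M)
        = ((P / 2) ^ j * (- cnj P / 2) ^ i) * (if int j - int i = 0 then of_real T else 0)"
      unfolding M_def T_def by (simp only: integral_mult_right_zero integral_exp_int_multiple[OF \<omega>])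
    moreover have "(P / 2) ^ j * (- cnj P / 2) ^ j = of_real ((- 1) ^ j * (norm P / 2) ^ (2 * j))" for j
    proof -
      have "(P / 2) * (- cnj P / 2) = - (P * cnj P) / 4"
        by simp
      also have "\<dots> = of_real (- ((norm P / 2)\<^sup>2))"
        unfolding complex_norm_square[symmetric] by (simp add: power_divide)
      finally have "(P / 2) ^ j * (- cnj P / 2) ^ j = of_real ((- ((norm P / 2)\<^sup>2)) ^ j)"
        by (simp only: power_mult_distrib[symmetric] of_real_power)
      then show ?thesis
        by (simp only: power_minus[of "(norm P / 2)\<^sup>2"] power_mult)
    qed
    ultimately show ?thesis
      by (auto simp: mult_ac)
  qed
  have int: "integrable M (\<lambda>s. u s ^ j * v s ^ i)" for i j
    by (rule M.integrable_const_bound[of _ "(norm P / 2) ^ j * (norm P / 2) ^ i"])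
      (auto simp: u_def v_def norm_mult norm_power norm_divide norm_w)
  define c where "c m = (\<integral>s. X s ^ m /\<^sub>R fact m \<partial>M)" for m
  have c: "c m = (\<Sum>j\<le>m. of_nat (m choose j) * (if j = m - j then of_real (T * (- 1) ^ j * (norm P / 2) ^ (2 * j)) else 0)) /\<^sub>R fact m" for m
    unfolding c_def X_eq binomial_ring using int by (simp add: mono mult.assoc)
  have int_pow: "integrable M (\<lambda>s. X s ^ m /\<^sub>R fact m)" for m
    unfolding X_eq binomial_ring using int by (simp add: mult.assoc)
  \<comment> \<open>Domination by the exponential series of \<open>norm P\<close> on a finite
    measure space permits termwise integration.\<close>
  have "summable (\<lambda>m. \<integral>s. norm (X s ^ m /\<^sub>R fact m) \<partial>M)"
  proof (rule summable_comparison_test')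
    show "summable (\<lambda>m. T * (norm P ^ m /\<^sub>R fact m))"
      by (intro summable_mult sums_summable[OF exp_converges])
    fix m
    have "(\<integral>s. norm (X s ^ m /\<^sub>R fact m) \<partial>M) \<le> (\<integral>s. norm P ^ m /\<^sub>R fact m \<partial>M)"
      using norm_X int_pow[of m] by (intro integral_mono integrable_norm) (auto simp: norm_power divide_right_mono power_mono field_simps)
    then show "norm (\<integral>s. norm (X s ^ m /\<^sub>R fact m) \<partial>M) \<le> T * (norm P ^ m /\<^sub>R fact m)"
      by (simp add: measM mult.commute)
  qed
  moreover have "AE s in M. summable (\<lambda>m. norm (X s ^ m /\<^sub>R fact m))"
    using summable_norm_exp[of "X _"] by auto
  ultimately have "c sums (\<integral>s. (\<Sum>m. X s ^ m /\<^sub>R fact m) \<partial>M)"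
    unfolding c_def using int_pow by (intro sums_integral) auto
  then have "c sums (\<integral>s. exp (X s) \<partial>M)"
    by (simp add: exp_def)
  moreover have odd: "c m = 0" if "m \<notin> range (\<lambda>k. 2 * k)" for m
  proof -
    have "j \<noteq> m - j" if "j \<le> m" for j
    proof
      assume "j = m - j"
      then have "m = 2 * j"
        using that by linarith
      then show False
        using \<open>m \<notin> range (\<lambda>k. 2 * k)\<close> by blast
    qed
    then have "(\<Sum>j\<le>m. of_nat (m choose j) * (if j = m - j then complex_of_real (T * (- 1) ^ j * (norm P / 2) ^ (2 * j)) else 0)) = 0"
      by (intro sum.neutral) auto
    then show ?thesis
      unfolding c by simp
  qed
  ultimately have "(\<lambda>k. c (2 * k)) sums (\<integral>s. exp (X s) \<partial>M)"
    using sums_mono_reindex[of "\<lambda>k. 2 * k" c] by (auto simp: strict_mono_def)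
  moreover have "c (2 * k) = of_real (T * ((- 1) ^ k / (fact k)\<^sup>2 * (norm P / 2) ^ (2 * k)))" for k
  proof -
    have "(\<Sum>j\<le>2 * k. of_nat ((2 * k) choose j) * (if j = 2 * k - j then of_real (T * (- 1) ^ j * (norm P / 2) ^ (2 * j)) else 0))
        = (\<Sum>j\<le>2 * k. if j = k then of_nat ((2 * k) choose k) * complex_of_real (T * (- 1) ^ k * (norm P / 2) ^ (2 * k)) else 0)"
      by (intro sum.cong) auto
    also have "\<dots> = of_nat ((2 * k) choose k) * of_real (T * (- 1) ^ k * (norm P / 2) ^ (2 * k))"
      by simp
    finally show ?thesis
      unfolding c using binomial_fact[of k "2 * k", where 'a=complex]
      by (simp add: scaleR_conv_of_real field_simps power2_eq_square)
  qed
  ultimately have sums: "(\<lambda>k. complex_of_real (T * ((- 1) ^ k / (fact k)\<^sup>2 * (norm P / 2) ^ (2 * k)))) sums (\<integral>s. exp (X s) \<partial>M)"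
    by simp
  \<comment> \<open>\<open>bessel_J0\<close> is a real series, so the real part is identified first;
    the imaginary part vanishes termwise.\<close>
  have "(\<lambda>k. T * ((- 1) ^ k / (fact k)\<^sup>2 * (norm P / 2) ^ (2 * k))) sums Re (\<integral>s. exp (X s) \<partial>M)"
    using sums_Re[OF sums] by (simp only: Re_complex_of_real)
  then have "(\<lambda>k. (T * ((- 1) ^ k / (fact k)\<^sup>2 * (norm P / 2) ^ (2 * k))) / T) sums (Re (\<integral>s. exp (X s) \<partial>M) / T)"
    by (rule sums_divide)
  then have "bessel_J0 (norm P) = Re (\<integral>s. exp (X s) \<partial>M) / T"
    using \<omega> by (simp add: bessel_J0_def sums_iff T_def)
  then have "Re (\<integral>s. exp (X s) \<partial>M) = T * bessel_J0 (norm P)"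
    using \<omega> by (simp add: T_def)
  moreover have "Im (\<integral>s. exp (X s) \<partial>M) = 0"
  proof -
    have "(\<lambda>k. 0) sums Im (\<integral>s. exp (X s) \<partial>M)"
      using sums_Im[OF sums] by (simp only: Im_complex_of_real)
    then show ?thesis
      using sums_unique2 sums_zero by blast
  qed
  ultimately show ?thesis
    by (simp add: X_def w_def M_def T_def complex_eq_iff)
qed

lemma orth_proj_span_pair:
  fixes a b :: "'a::euclidean_space"
  assumes "norm a = 1" "norm b = 1" "a \<bullet> b = 0"
  shows "orth_proj (span {a, b}) x = (x \<bullet> a) *\<^sub>R a + (x \<bullet> b) *\<^sub>R b"
  unfolding orth_proj_def
proof (rule the_equality)
  have ab: "a \<bullet> a = 1" "b \<bullet> b = 1" "b \<bullet> a = 0"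
    using assms by (simp_all add: norm_eq_1 inner_commute)
  let ?p = "(x \<bullet> a) *\<^sub>R a + (x \<bullet> b) *\<^sub>R b"
  have orth: "y \<in> orthogonal_comp (span {a, b}) \<longleftrightarrow> (\<forall>z\<in>span {a, b}. z \<bullet> y = 0)" for y
    by (auto simp: orthogonal_comp_def orthogonal_def)
  have in_span: "?p \<in> span {a, b}"
    by (intro span_add span_scale span_base) auto
  have "z \<bullet> (x - ?p) = 0" if z: "z \<in> span {a, b}" for z
  proof -
    have "orthogonal (x - ?p) z"
      using z by (rule orthogonal_to_span) (use assms ab in \<open>auto simp: orthogonal_def inner_diff_left inner_diff_right inner_add_left inner_add_right inner_commute\<close>)
    then show ?thesis by (simp add: orthogonal_def inner_commute)
  qed
  then show *: "?p \<in> span {a, b} \<and> x - ?p \<in> orthogonal_comp (span {a, b})"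
    using in_span orth by blast
  fix p assume p: "p \<in> span {a, b} \<and> x - p \<in> orthogonal_comp (span {a, b})"
  have "p - ?p \<in> span {a, b}"
    using p in_span by (simp add: span_diff)
  moreover have "p - ?p \<in> orthogonal_comp (span {a, b})"
    using subspace_diff[OF subspace_orthogonal_comp, of "x - ?p" "span {a, b}" "x - p"] p * by (simp add: algebra_simps)
  ultimately have "(p - ?p) \<bullet> (p - ?p) = 0"
    unfolding orth by blast
  then show "p = ?p" by simp
qed

context h_type_xray
begin

lemma fourier_char_xray:
  assumes f: "integrable lborel f" and \<eta>: "\<eta> \<in> horizontal br"
  shows "fourier_char (quot_haar br l) (xray br \<nu> l f) (descend (pi_char \<eta>)) =
    of_real (2 * pi / norm l * bessel_J0 (norm (orth_proj (span {\<nu>, J_map br (sgn l) \<nu>}) \<eta>) / norm l)) *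
    fourier_char lborel f (pi_char \<eta>)"
proof -
  have [measurable]: "f \<in> borel_measurable borel"
    using f by (simp add: borel_measurable_integrable)
  define J\<nu> where "J\<nu> = J_map br (sgn l) \<nu>"
  have sgn_center: "sgn l \<in> lie_center br"
    using l_center by (simp add: sgn_div_norm subspace_scale[OF subspace_center])
  have Jl: "J_map br l \<nu> = norm l *\<^sub>R J\<nu>"
    using J_map_scale_left[of "norm l" "sgn l" \<nu>] l_nonzero by (simp add: J\<nu>_def sgn_div_norm)
  have J\<nu>: "norm J\<nu> = 1" "\<nu> \<bullet> J\<nu> = 0"
    using norm_J_map[OF sgn_center \<nu>_horizontal] \<nu>_norm l_nonzero
    by (simp_all add: J\<nu>_def norm_sgn J_map_inner_self)
  \<comment> \<open>The phase is a sin - b cos, where a and b are the coordinates of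
    \<open>\<eta>\<close> along \<open>\<nu>\<close> and \<open>J\<nu>\<close> divided by
    \<open>norm l\<close>; this is the imaginary part of a - i b times the rotating unit. The
    central drift pairs to zero with the horizontal \<open>\<eta>\<close>.\<close>
  define P where "P = Complex ((\<eta> \<bullet> \<nu>) / norm l) (- (\<eta> \<bullet> J\<nu>) / norm l)"
  have "norm (orth_proj (span {\<nu>, J\<nu>}) \<eta>) = sqrt ((\<eta> \<bullet> \<nu>)\<^sup>2 + (\<eta> \<bullet> J\<nu>)\<^sup>2)"
    using J\<nu> \<nu>_norm by (simp add: orth_proj_span_pair norm_eq_sqrt_inner inner_add_left inner_add_right inner_commute power2_eq_square)

  then have normP: "norm (orth_proj (span {\<nu>, J\<nu>}) \<eta>) / norm l = norm P"
    by (simp add: P_def complex_norm power_divide real_sqrt_divide flip: add_divide_distrib)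
  have phase: "\<eta> \<bullet> geo s = Im (P * exp (\<i> * of_real (norm l * s)))" for s
  proof -
    have "exp (\<i> * of_real (norm l * s)) = cis (norm l * s)"
      by (simp add: cis_conv_exp)
    then show ?thesis
      using horiz_inner_center[OF \<eta> sgn_center] l_nonzero
      by (simp add: geo_eq Jl P_def inner_add_right inner_diff_right field_simps power2_eq_square)
  qed
  have \<eta>_inner: "\<eta> \<bullet> hmult br g h = \<eta> \<bullet> g + \<eta> \<bullet> h" for g h
    using \<eta> by (simp add: hmult_def inner_add_right horiz_inner_center)
  define \<psi> where "\<psi> g = cnj (pi_char \<eta> g)" for g
  have \<psi>: "\<psi> g = exp (- (\<i> * of_real (\<eta> \<bullet> g)))" for g
    by (simp add: \<psi>_def pi_char_def exp_cnj)
  have inv: "pi_char \<eta> (g + period) = pi_char \<eta> g" for g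
    using \<eta> by (simp add: pi_char_def inner_add_right horiz_inner_center)
  have "has_bochner_integral (quot_haar br l) (\<lambda>C. xray br \<nu> l f C * cnj (descend (pi_char \<eta>) C))
    (\<integral>s. (\<integral>g. f g * \<psi> (hmult br g (- geo s)) \<partial>lborel) \<partial>restrict_space lborel {0..time})"
  proof (rule has_bochner_integral_xray[OF f])
    show "\<psi> \<in> borel_measurable borel"
      unfolding \<psi> by measurable
    show "norm (\<psi> g) \<le> 1" for g
      by (simp add: \<psi> norm_exp_eq_Re)
    show "\<psi> (g + period) = \<psi> g" for g
      by (simp add: \<psi>_def inv)
    show "cnj (descend (pi_char \<eta>) (coset g)) = \<psi> g" for g
      by (simp add: \<psi>_def descend_coset inv)
  qed
  then have "fourier_char (quot_haar br l) (xray br \<nu> l f) (descend (pi_char \<eta>))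
    = (\<integral>s. (\<integral>g. f g * \<psi> (hmult br g (- geo s)) \<partial>lborel) \<partial>restrict_space lborel {0..time})"
    by (simp add: fourier_char_def has_bochner_integral_integral_eq)
  also have "\<dots> = (\<integral>s. fourier_char lborel f (pi_char \<eta>) * exp (\<i> * of_real (\<eta> \<bullet> geo s)) \<partial>restrict_space lborel {0..time})"
  proof (rule Bochner_Integration.integral_cong)
    fix s
    \<comment> \<open>The character is multiplicative, and conjugation and inversion cancel on the
      geodesic factor.\<close>
    have "\<psi> (hmult br g (- geo s)) = cnj (pi_char \<eta> g) * exp (\<i> * of_real (\<eta> \<bullet> geo s))" for g
      unfolding \<psi>_def[symmetric] by (simp add: \<psi> \<eta>_inner exp_add[symmetric] algebra_simps)
    then show "(\<integral>g. f g * \<psi> (hmult br g (- geo s)) \<partial>lborel)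
      = fourier_char lborel f (pi_char \<eta>) * exp (\<i> * of_real (\<eta> \<bullet> geo s))"
      unfolding fourier_char_def by (simp add: mult.assoc[symmetric])
  qed simp
  also have "\<dots> = fourier_char lborel f (pi_char \<eta>) * of_real (2 * pi / norm l * bessel_J0 (norm P))"
    using integral_exp_Im_circle[of "norm l" P] l_nonzero by (simp add: phase time_def)
  finally show ?thesis
    by (simp add: normP[unfolded J\<nu>_def] mult.commute)
qed

end

section \<open>Holomorphic functions on complex Euclidean space\<close>

lemma norm_vector_smult:
  fixes v :: "complex ^ 'n"
  shows "norm (c *s v) = norm c * norm v"
  by (simp add: norm_vec_def norm_mult L2_set_right_distrib)

lemma linear_vector_smult_right: "linear (\<lambda>v :: complex ^ 'n. c *s v)"
  by (rule linearI) (simp_all add: vec_eq_iff)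

lemma linear_vector_smult_left: "linear (\<lambda>t :: complex. t *s (v :: complex ^ 'n))"
  by (rule linearI) (simp_all add: vec_eq_iff algebra_simps)

lemma continuous_on_vector_smult [continuous_intros]:
  fixes v :: "'a::topological_space \<Rightarrow> complex ^ 'n"
  assumes "continuous_on S c" "continuous_on S v"
  shows "continuous_on S (\<lambda>x. c x *s v x)"
proof -
  have eq: "(\<lambda>x. c x *s v x) = (\<lambda>x. \<chi> i. c x * v x $ i)"
    by (simp add: vector_scalar_mult_def)
  show ?thesis
    unfolding eq using assms by (intro continuous_intros)
qed

lemma cn_holomorphic_continuous: "cn_holomorphic F \<Longrightarrow> continuous_on S F"
  unfolding cn_holomorphic_def
  by (meson continuous_at_imp_continuous_on has_derivative_continuous)

lemma cn_holomorphic_measurable: "cn_holomorphic F \<Longrightarrow> F \<in> borel_measurable borel"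
  by (rule borel_measurable_continuous_onI[OF cn_holomorphic_continuous])

lemma cn_holomorphic_line_derivative:
  fixes F :: "complex ^ 'n \<Rightarrow> complex"
  assumes "(F has_derivative D) (at (\<zeta> + t *s v))" and homog: "\<And>c v. D (c *s v) = c * D v"
  shows "((\<lambda>t. F (\<zeta> + t *s v)) has_field_derivative D v) (at t)"
proof -
  have line: "((\<lambda>t. \<zeta> + t *s v) has_derivative (\<lambda>t. t *s v)) (at t)"
    using linear_vector_smult_left[of v]
    by (auto intro!: derivative_eq_intros bounded_linear_imp_has_derivative simp: linear_conv_bounded_linear)
  have eq: "(\<lambda>t. t * D v) = (*) (D v)"
    by (simp add: fun_eq_iff mult.commute)
  show ?thesis
    using has_derivative_compose[OF line assms(1)] unfolding has_field_derivative_def homog eq .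
qed

lemma cn_holomorphic_line:
  assumes "cn_holomorphic F"
  shows "(\<lambda>t. F (\<zeta> + t *s v)) holomorphic_on S"
  unfolding holomorphic_on_def field_differentiable_def
proof
  fix t
  obtain D where "(F has_derivative D) (at (\<zeta> + t *s v))" "\<And>c v. D (c *s v) = c * D v"
    using assms unfolding cn_holomorphic_def by blast
  then show "\<exists>f'. ((\<lambda>t. F (\<zeta> + t *s v)) has_field_derivative f') (at t within S)"
    using cn_holomorphic_line_derivative has_field_derivative_at_within by blast
qed

lemma cn_holomorphic_add:
  assumes "cn_holomorphic F" "cn_holomorphic G"
  shows "cn_holomorphic (\<lambda>\<zeta>. F \<zeta> + G \<zeta>)"
  unfolding cn_holomorphic_def
proof
  fix \<zeta>
  obtain D E where "(F has_derivative D) (at \<zeta>)" "\<And>c v. D (c *s v) = c * D v"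
    "(G has_derivative E) (at \<zeta>)" "\<And>c v. E (c *s v) = c * E v"
    using assms unfolding cn_holomorphic_def by metis
  then show "\<exists>D. ((\<lambda>\<zeta>. F \<zeta> + G \<zeta>) has_derivative D) (at \<zeta>) \<and> (\<forall>c v. D (c *s v) = c * D v)"
    by (intro exI[of _ "\<lambda>v. D v + E v"]) (auto intro: has_derivative_add simp: algebra_simps)
qed

lemma cn_holomorphic_mult:
  assumes "cn_holomorphic F" "cn_holomorphic G"
  shows "cn_holomorphic (\<lambda>\<zeta>. F \<zeta> * G \<zeta>)"
  unfolding cn_holomorphic_def
proof
  fix \<zeta>
  obtain D E where "(F has_derivative D) (at \<zeta>)" "\<And>c v. D (c *s v) = c * D v"
    "(G has_derivative E) (at \<zeta>)" "\<And>c v. E (c *s v) = c * E v"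
    using assms unfolding cn_holomorphic_def by metis
  then show "\<exists>D. ((\<lambda>\<zeta>. F \<zeta> * G \<zeta>) has_derivative D) (at \<zeta>) \<and> (\<forall>c v. D (c *s v) = c * D v)"
    using has_derivative_mult[of F D \<zeta> UNIV G E]
    by (intro exI[of _ "\<lambda>v. F \<zeta> * E v + D v * G \<zeta>"]) (simp add: distrib_left mult.assoc mult.left_commute)
qed

lemma cn_holomorphic_const [simp]: "cn_holomorphic (\<lambda>_. c)"
  unfolding cn_holomorphic_def by (auto intro!: exI[of _ "\<lambda>_. 0"])

lemma cn_holomorphic_shift:
  assumes "cn_holomorphic F"
  shows "cn_holomorphic (\<lambda>\<zeta>. F (\<zeta> + w))"
  unfolding cn_holomorphic_def
proof
  fix \<zeta>
  obtain D where D: "(F has_derivative D) (at (\<zeta> + w))" "\<And>c v. D (c *s v) = c * D v"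
    using assms unfolding cn_holomorphic_def by blast
  have "((\<lambda>\<zeta>. \<zeta> + w) has_derivative (\<lambda>v. v)) (at \<zeta>)"
    by (auto intro!: derivative_eq_intros)
  from has_derivative_compose[OF this D(1)] D(2)
  show "\<exists>D. ((\<lambda>\<zeta>. F (\<zeta> + w)) has_derivative D) (at \<zeta>) \<and> (\<forall>c v. D (c *s v) = c * D v)"
    by blast
qed

lemma cn_holomorphic_exp_linear:
  fixes b :: "complex ^ 'n"
  shows "cn_holomorphic (\<lambda>\<zeta>. exp (a - (\<Sum>i\<in>UNIV. \<zeta> $ i * b $ i)))"
  unfolding cn_holomorphic_def
proof
  fix \<zeta> :: "complex ^ 'n"
  let ?L = "\<lambda>v :: complex ^ 'n. - (\<Sum>i\<in>UNIV. v $ i * b $ i)"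
  have "linear (\<lambda>v :: complex ^ 'n. \<Sum>i\<in>UNIV. v $ i * b $ i)"
    by (rule linearI) (simp_all add: distrib_right sum.distrib scaleR_sum_right)
  then have "((\<lambda>\<zeta>. a - (\<Sum>i\<in>UNIV. \<zeta> $ i * b $ i)) has_derivative ?L) (at \<zeta>)"
    by (auto intro!: derivative_eq_intros bounded_linear_imp_has_derivative simp: linear_conv_bounded_linear)
  from has_derivative_compose[OF this DERIV_exp[unfolded has_field_derivative_def]]
  have "((\<lambda>\<zeta>. exp (a - (\<Sum>i\<in>UNIV. \<zeta> $ i * b $ i))) has_derivative
      (\<lambda>v. ?L v * exp (a - (\<Sum>i\<in>UNIV. \<zeta> $ i * b $ i)))) (at \<zeta>)"
    by (simp add: mult.commute)
  moreover have "?L (c *s v) = c * ?L v" for c v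
    by (simp add: sum_distrib_left mult.assoc)
  ultimately show "\<exists>D. ((\<lambda>\<zeta>. exp (a - (\<Sum>i\<in>UNIV. \<zeta> $ i * b $ i))) has_derivative D) (at \<zeta>) \<and> (\<forall>c v. D (c *s v) = c * D v)"
    by (intro exI[of _ "\<lambda>v. ?L v * exp (a - (\<Sum>i\<in>UNIV. \<zeta> $ i * b $ i))"]) (auto simp: mult.assoc)
qed

text \<open>Restriction to the complex line through \<open>\<zeta>\<close> in direction
  \<open>v\<close> reduces this to one variable. Radius 2 leaves room for circles of radius 1 about
  every point of the unit disc, so Cauchy's inequality bounds the first derivative by
  \<open>M\<close> and the second by \<open>2 * M\<close>. The constants depend only on the bound
  for \<open>F\<close>, the uniformity needed for differentiating under an integral.\<close>

lemma cn_holomorphic_taylor: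
  fixes F :: "complex ^ 'n \<Rightarrow> complex"
  assumes F: "cn_holomorphic F" and bound: "\<And>w. w \<in> cball \<zeta> 2 \<Longrightarrow> norm (F w) \<le> M"
    and D: "(F has_derivative D) (at \<zeta>)" and homog: "\<And>c v. D (c *s v) = c * D v"
  shows "norm (D v) \<le> M * norm v"
    and "norm v \<le> 1 \<Longrightarrow> norm (F (\<zeta> + v) - F \<zeta> - D v) \<le> 2 * M * (norm v)\<^sup>2"
proof -
  \<comment> \<open>For \<open>v = 0\<close> division by zero yields \<open>u = 0\<close>, and both
    \<open>v = of_real (norm v) *s u\<close> and \<open>norm u \<le> 1\<close> remain true.\<close>
  define u where "u = of_real (1 / norm v) *s v"
  have v: "v = of_real (norm v) *s u"
    by (cases "v = 0") (simp_all add: u_def vec_eq_iff)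
  have u: "norm u \<le> 1"
    by (simp add: u_def norm_vector_smult norm_divide)
  have D0: "D 0 = 0"
    using homog[of 0 0] by simp
  define \<phi> where "\<phi> t = F (\<zeta> + t *s u)" for t
  have hol: "\<phi> holomorphic_on S" for S
    unfolding \<phi>_def by (rule cn_holomorphic_line[OF F])
  have \<phi>_bound: "norm (\<phi> t) \<le> M" if "norm t \<le> 2" for t
  proof -
    have "norm (t *s u) \<le> 2 * 1"
      unfolding norm_vector_smult using that u by (intro mult_mono) auto
    then show ?thesis
      unfolding \<phi>_def by (intro bound) (simp add: dist_norm)
  qed
  have cauchy: "norm ((deriv ^^ n) \<phi> t) \<le> fact n * M / 1 ^ n" if "norm t \<le> 1" for n t
  proof (rule Cauchy_inequality)
    show "norm (\<phi> x) \<le> M" if x: "norm (t - x) = 1" for x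
    proof (rule \<phi>_bound)
      show "norm x \<le> 2"
        using norm_triangle_ineq4[of t "t - x"] x \<open>norm t \<le> 1\<close> by simp
    qed
  qed (use hol in \<open>auto intro: holomorphic_on_imp_continuous_on\<close>)
  have deriv0: "deriv \<phi> 0 = D u"
    unfolding \<phi>_def using cn_holomorphic_line_derivative[of F D \<zeta> 0 u] D homog by (intro DERIV_imp_deriv) simp
  have Dv: "D v = of_real (norm v) * D u"
    by (subst v) (rule homog)
  have "norm (D u) \<le> M"
    using cauchy[of 0 1] by (simp add: deriv0)
  then show "norm (D v) \<le> M * norm v"
    unfolding Dv by (simp add: norm_mult mult.commute[of M] mult_left_mono)
  assume v1: "norm v \<le> 1"
  have "norm ((deriv ^^ 0) \<phi> (of_real (norm v)) - (\<Sum>i\<le>1. (deriv ^^ i) \<phi> 0 * (of_real (norm v) - 0) ^ i / fact i))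
      \<le> (2 * M) * norm (of_real (norm v) - 0 :: complex) ^ Suc 1 / fact 1"
  proof (rule complex_Taylor[where S = "cball 0 1"])
    show "((deriv ^^ i) \<phi> has_field_derivative (deriv ^^ Suc i) \<phi> x) (at x within cball 0 1)" for i x
      using holomorphic_derivI[OF holomorphic_higher_deriv[OF hol[of UNIV] open_UNIV] open_UNIV UNIV_I]
      by (simp add: has_field_derivative_at_within)
    show "norm ((deriv ^^ Suc 1) \<phi> x) \<le> 2 * M" if "x \<in> cball 0 1" for x
      using cauchy[of x "Suc 1"] that by (simp add: numeral_2_eq_2)
  qed (use v1 in auto)
  moreover have "\<phi> (of_real (norm v)) = F (\<zeta> + v)" "\<phi> 0 = F \<zeta>"
    using v by (simp_all add: \<phi>_def)
  ultimately show "norm (F (\<zeta> + v) - F \<zeta> - D v) \<le> 2 * M * (norm v)\<^sup>2"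
    by (simp add: deriv0 Dv power2_eq_square algebra_simps)
qed

text \<open>The mean value property from Cauchy's formula on the unit circle, kept in
  \<open>ennreal\<close> so that it can be integrated over a further variable by Tonelli.\<close>

lemma holomorphic_circle_average:
  assumes "\<phi> holomorphic_on UNIV"
  shows "ennreal (2 * pi * norm (\<phi> 0)) \<le> (\<integral>\<^sup>+ t. indicator {0..2 * pi} t * ennreal (norm (\<phi> (cis t))) \<partial>lborel)"
proof -
  have "((\<lambda>u. \<phi> u / (u - 0)) has_contour_integral (2 * of_real pi * \<i> * \<phi> 0)) (circlepath 0 1)"
    using assms by (intro Cauchy_integral_circlepath_simple) (auto intro: holomorphic_on_subset)
  then have hi: "((\<lambda>t. \<phi> (cis t) * \<i>) has_integral (2 * of_real pi * \<i> * \<phi> 0)) {0..2 * pi}"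
    unfolding circlepath_def by (subst (asm) has_contour_integral_part_circlepath_iff) (simp_all add: mult_ac)
  have int: "integral {0..2 * pi} (\<lambda>t. \<phi> (cis t)) = 2 * of_real pi * \<phi> 0"
  proof -
    have "\<phi> (cis t) * \<i> * - \<i> = \<phi> (cis t)" for t
      by (simp add: mult.assoc)
    moreover have "2 * of_real pi * \<i> * \<phi> 0 * - \<i> = 2 * of_real pi * \<phi> 0"
      by (simp add: complex_eq_iff)
    ultimately show ?thesis
      using has_integral_mult_left[OF hi, of "- \<i>"] by (simp only: integral_unique)
  qed
  have "continuous_on {0..2 * pi} (\<lambda>t. \<phi> (cis t))"
    by (rule continuous_on_compose2[OF holomorphic_on_imp_continuous_on[OF assms]]) (auto intro!: continuous_intros)
  then have set_int: "set_integrable lborel {0..2 * pi} (\<lambda>t. \<phi> (cis t))"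
    by (rule borel_integrable_atLeastAtMost')
  have "2 * of_real pi * \<phi> 0 = (\<integral>t. indicator {0..2 * pi} t *\<^sub>R \<phi> (cis t) \<partial>lborel)"
    using set_borel_integral_eq_integral(2)[OF set_int] int by (simp add: set_lebesgue_integral_def)
  then have "norm (2 * of_real pi * \<phi> 0) = norm (\<integral>t. indicator {0..2 * pi} t *\<^sub>R \<phi> (cis t) \<partial>lborel)"
    by (rule arg_cong)
  then have "ennreal (2 * pi * norm (\<phi> 0)) = ennreal (norm (\<integral>t. indicator {0..2 * pi} t *\<^sub>R \<phi> (cis t) \<partial>lborel))"
    by (simp add: norm_mult)
  also have "\<dots> \<le> (\<integral>\<^sup>+ t. ennreal (norm (indicator {0..2 * pi} t *\<^sub>R \<phi> (cis t))) \<partial>lborel)"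
    using set_int by (intro integral_norm_bound_ennreal) (simp add: set_integrable_def)
  also have "\<dots> = (\<integral>\<^sup>+ t. indicator {0..2 * pi} t * ennreal (norm (\<phi> (cis t))) \<partial>lborel)"
    by (intro nn_integral_cong) (simp add: indicator_def)
  finally show ?thesis .
qed

lemma nn_integral_rotate:
  fixes h :: "complex ^ 'n \<Rightarrow> ennreal"
  assumes [measurable]: "h \<in> borel_measurable borel"
  shows "(\<integral>\<^sup>+ w. h (cis t *s w) \<partial>lborel) = (\<integral>\<^sup>+ w. h w \<partial>lborel)"
proof -
  have "distr lborel borel (\<lambda>w :: complex ^ 'n. cis t *s w) = lborel"
    by (rule distr_lborel_linear_isometry[OF linear_vector_smult_right]) (simp add: norm_vector_smult)
  moreover have [measurable]: "(\<lambda>w :: complex ^ 'n. cis t *s w) \<in> borel_measurable borel"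
    by (rule linear_borel_measurable[OF linear_vector_smult_right])
  ultimately have "(\<integral>\<^sup>+ w. h w \<partial>lborel) = (\<integral>\<^sup>+ w. h w \<partial>distr lborel borel (\<lambda>w. cis t *s w))"
    by simp
  then show ?thesis
    by (simp add: nn_integral_distr)
qed

text \<open>For each \<open>w\<close> the circle average is taken on the complex line through
  \<open>\<zeta>\<close> in direction \<open>w\<close>. After integration over the ball, invariance
  of Lebesgue measure undoes the rotation by \<open>cis t\<close>, and the angular integral
  contributes the same factor \<open>2 * pi\<close> to both sides. This does the work of polar
  coordinates.\<close>

lemma cn_holomorphic_ball_average:
  fixes F :: "complex ^ 'n \<Rightarrow> complex"
  assumes F: "cn_holomorphic F"
  shows "emeasure lborel (ball (0 :: complex ^ 'n) 1) * ennreal (norm (F \<zeta>))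
    \<le> (\<integral>\<^sup>+ w. indicator (ball 0 1) w * ennreal (norm (F (\<zeta> + w))) \<partial>lborel)"
proof -
  let ?B = "ball (0 :: complex ^ 'n) 1"
  have [measurable]: "F \<in> borel_measurable borel" "?B \<in> sets borel"
    by (simp_all add: cn_holomorphic_measurable[OF F])
  have [measurable]: "(\<lambda>p. cis (fst p) *s snd p) \<in> borel_measurable (lborel \<Otimes>\<^sub>M lborel :: (real \<times> (complex ^ 'n)) measure)"
  proof -
    have "(\<lambda>p :: real \<times> (complex ^ 'n). cis (fst p) *s snd p) \<in> borel_measurable borel"
      by (intro borel_measurable_continuous_onI) (auto intro!: continuous_intros)
    then show ?thesis by (simp add: lborel_prod)
  qed
  have "ennreal (2 * pi) * (emeasure lborel ?B * ennreal (norm (F \<zeta>)))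
      = (\<integral>\<^sup>+ w. indicator ?B w * ennreal (2 * pi * norm (F \<zeta>)) \<partial>lborel)"
  proof -
    have "ennreal (2 * pi * norm (F \<zeta>)) = ennreal (2 * pi) * ennreal (norm (F \<zeta>))"
      by (rule ennreal_mult) auto
    moreover have "(\<integral>\<^sup>+ w. indicator ?B w * ennreal (2 * pi * norm (F \<zeta>)) \<partial>lborel)
        = emeasure lborel ?B * ennreal (2 * pi * norm (F \<zeta>))"
      by (subst nn_integral_multc) (simp_all add: borel_measurable_indicator)
    ultimately show ?thesis
      by (simp only: mult.left_commute)
  qed
  also have "\<dots> \<le> (\<integral>\<^sup>+ w. \<integral>\<^sup>+ t. indicator ?B w * (indicator {0..2 * pi} t * ennreal (norm (F (\<zeta> + cis t *s w)))) \<partial>lborel \<partial>lborel)"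
  proof (rule nn_integral_mono)
    fix w :: "complex ^ 'n"
    have [measurable]: "(\<lambda>t. cis t *s w) \<in> borel_measurable borel"
      by (intro borel_measurable_continuous_onI) (auto intro!: continuous_intros)
    have "(\<lambda>t. indicator {0..2 * pi} t * ennreal (norm (F (\<zeta> + cis t *s w)))) \<in> borel_measurable lborel"
      by measurable
    then show "indicator ?B w * ennreal (2 * pi * norm (F \<zeta>))
      \<le> (\<integral>\<^sup>+ t. indicator ?B w * (indicator {0..2 * pi} t * ennreal (norm (F (\<zeta> + cis t *s w)))) \<partial>lborel)"
      using holomorphic_circle_average[OF cn_holomorphic_line[OF F, of \<zeta> w]]
      by (simp add: nn_integral_cmult mult_left_mono)
  qed
  also have "\<dots> = (\<integral>\<^sup>+ t. \<integral>\<^sup>+ w. indicator ?B w * (indicator {0..2 * pi} t * ennreal (norm (F (\<zeta> + cis t *s w)))) \<partial>lborel \<partial>lborel)"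
    by (rule lborel_pair.Fubini') (simp add: case_prod_unfold)
  also have "\<dots> = (\<integral>\<^sup>+ t. \<integral>\<^sup>+ w. indicator ?B w * (indicator {0..2 * pi} t * ennreal (norm (F (\<zeta> + w)))) \<partial>lborel \<partial>lborel)"
  proof (rule nn_integral_cong)
    fix t
    have "indicator ?B w = (indicator ?B (cis t *s w) :: ennreal)" for w
      by (simp add: indicator_def norm_vector_smult)
    then show "(\<integral>\<^sup>+ w. indicator ?B w * (indicator {0..2 * pi} t * ennreal (norm (F (\<zeta> + cis t *s w)))) \<partial>lborel)
      = (\<integral>\<^sup>+ w. indicator ?B w * (indicator {0..2 * pi} t * ennreal (norm (F (\<zeta> + w)))) \<partial>lborel)"
      using nn_integral_rotate[of "\<lambda>w. indicator ?B w * (indicator {0..2 * pi} t * ennreal (norm (F (\<zeta> + w))))" t]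
      by simp
  qed
  also have "\<dots> = (\<integral>\<^sup>+ t. indicator {0..2 * pi} t * (\<integral>\<^sup>+ w. indicator ?B w * ennreal (norm (F (\<zeta> + w))) \<partial>lborel) \<partial>lborel)"
    by (subst nn_integral_cmult[symmetric]) (simp_all add: mult_ac)
  also have "\<dots> = ennreal (2 * pi) * (\<integral>\<^sup>+ w. indicator ?B w * ennreal (norm (F (\<zeta> + w))) \<partial>lborel)"
    by (simp add: nn_integral_multc)
  finally show ?thesis
    by (subst (asm) ennreal_mult_le_mult_iff) auto
qed

section \<open>Bargmann-Fock space\<close>

definition fock_weight :: "complex ^ 'n \<Rightarrow> real" where
  "fock_weight \<zeta> = exp (- (norm \<zeta>)\<^sup>2)"

lemma fock_weight_pos [simp]: "0 < fock_weight \<zeta>" "0 \<le> fock_weight \<zeta>"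
  by (simp_all add: fock_weight_def)

lemma fock_weight_measurable [measurable]: "fock_weight \<in> borel_measurable borel"
  unfolding fock_weight_def by measurable

lemma fock_holomorphic: "F \<in> fock \<Longrightarrow> cn_holomorphic F"
  by (simp add: fock_def)

lemma fock_integrable: "F \<in> fock \<Longrightarrow> integrable lborel (\<lambda>\<zeta>. (norm (F \<zeta>))\<^sup>2 * fock_weight \<zeta>)"
  by (simp add: fock_def fock_weight_def)

lemma fock_measurable: "F \<in> fock \<Longrightarrow> F \<in> borel_measurable borel"
  by (simp add: fock_holomorphic cn_holomorphic_measurable)

lemma fockI: "cn_holomorphic F \<Longrightarrow> integrable lborel (\<lambda>\<zeta>. (norm (F \<zeta>))\<^sup>2 * fock_weight \<zeta>) \<Longrightarrow> F \<in> fock"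
  by (simp add: fock_def fock_weight_def)

lemma fock_inner_eq:
  fixes F :: "complex ^ 'n \<Rightarrow> complex"
  shows "fock_inner F H = of_real (1 / pi ^ CARD('n)) * (\<integral>\<zeta>. F \<zeta> * cnj (H \<zeta>) * of_real (fock_weight \<zeta>) \<partial>lborel)"
  by (simp add: fock_inner_def fock_weight_def)

lemma fock_norm_square:
  fixes F :: "complex ^ 'n \<Rightarrow> complex"
  shows "(fock_norm F)\<^sup>2 = (1 / pi ^ CARD('n)) * (\<integral>\<zeta>. (norm (F \<zeta>))\<^sup>2 * fock_weight \<zeta> \<partial>lborel)"
    and "fock_inner F F = of_real ((fock_norm F)\<^sup>2)"
proof -
  have square: "F \<zeta> * cnj (F \<zeta>) * of_real (fock_weight \<zeta>) = of_real ((norm (F \<zeta>))\<^sup>2 * fock_weight \<zeta>)" for \<zeta>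
    by (simp only: of_real_mult complex_norm_square)
  have eq: "fock_inner F F = of_real ((1 / pi ^ CARD('n)) * (\<integral>\<zeta>. (norm (F \<zeta>))\<^sup>2 * fock_weight \<zeta> \<partial>lborel))"
    by (simp only: fock_inner_eq square integral_complex_of_real of_real_mult[of "1 / _"])
  moreover have "0 \<le> (1 / pi ^ CARD('n)) * (\<integral>\<zeta>. (norm (F \<zeta>))\<^sup>2 * fock_weight \<zeta> \<partial>lborel)"
    by (intro mult_nonneg_nonneg integral_nonneg) auto
  ultimately show "(fock_norm F)\<^sup>2 = (1 / pi ^ CARD('n)) * (\<integral>\<zeta>. (norm (F \<zeta>))\<^sup>2 * fock_weight \<zeta> \<partial>lborel)"
    by (simp only: fock_norm_def Re_complex_of_real real_sqrt_pow2)
  with eq show "fock_inner F F = of_real ((fock_norm F)\<^sup>2)"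
    by simp
qed

lemma fock_norm_nonneg [simp]: "0 \<le> fock_norm F"
proof -
  have "0 \<le> Re (fock_inner F F)"
    unfolding fock_norm_square(2) by simp
  then show ?thesis
    by (simp add: fock_norm_def)
qed

lemma nn_integral_fock_norm:
  fixes F :: "complex ^ 'n \<Rightarrow> complex"
  assumes "F \<in> fock"
  shows "(\<integral>\<^sup>+ \<zeta>. ennreal ((norm (F \<zeta>))\<^sup>2 * fock_weight \<zeta>) \<partial>lborel) = ennreal (pi ^ CARD('n) * (fock_norm F)\<^sup>2)"
  by (subst nn_integral_eq_integral[OF fock_integrable[OF assms]]) (simp_all add: fock_norm_square(1))

text \<open>On the unit ball about \<open>\<zeta>\<close> the Gaussian weight is at least
  \<open>exp (- (norm \<zeta> + 1)\<^sup>2)\<close>; the power of \<open>pi\<close> undoes the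
  normalisation of the inner product, and the volume is that of the ball in the mean value
  inequality.\<close>

definition fock_eval_bound :: "complex ^ 'n \<Rightarrow> real" where
  "fock_eval_bound \<zeta> =
     sqrt (exp ((norm \<zeta> + 1)\<^sup>2) * pi ^ CARD('n) / measure lborel (ball (0 :: complex ^ 'n) 1))"

lemma fock_eval_bound_nonneg [simp]: "0 \<le> fock_eval_bound \<zeta>"
  by (simp add: fock_eval_bound_def)

lemma fock_eval_bound_mono:
  fixes \<zeta> \<xi> :: "complex ^ 'n"
  shows "norm \<zeta> \<le> norm \<xi> \<Longrightarrow> fock_eval_bound \<zeta> \<le> fock_eval_bound \<xi>"
  unfolding fock_eval_bound_def by (intro real_sqrt_le_mono divide_right_mono mult_right_mono) (auto intro: power_mono)

text \<open>The mean value inequality is applied to the holomorphic function \<open>F\<^sup>2\<close>.\<close>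

lemma fock_eval_le:
  fixes F :: "complex ^ 'n \<Rightarrow> complex"
  assumes F: "F \<in> fock"
  shows "norm (F \<zeta>) \<le> fock_eval_bound \<zeta> * fock_norm F"
proof -
  let ?B = "ball (0 :: complex ^ 'n) 1"
  note [measurable] = fock_measurable[OF F]
  have [measurable]: "?B \<in> sets borel"
    by simp
  have vol: "emeasure lborel ?B = ennreal (measure lborel ?B)" "0 < measure lborel ?B"
  proof -
    show "emeasure lborel ?B = ennreal (measure lborel ?B)"
      using emeasure_lborel_ball_pos_finite(2)[where 'a = "complex ^ 'n"]
      by (intro emeasure_eq_ennreal_measure) auto
    show "0 < measure lborel ?B"
      unfolding measure_def enn2real_positive_iff
      using emeasure_lborel_ball_pos_finite[where 'a = "complex ^ 'n"] by auto
  qed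
  have "ennreal (measure lborel ?B * (norm (F \<zeta>))\<^sup>2) = emeasure lborel ?B * ennreal (norm (F \<zeta> * F \<zeta>))"
    by (simp add: vol ennreal_mult norm_mult power2_eq_square)
  also have "\<dots> \<le> (\<integral>\<^sup>+ w. indicator ?B w * ennreal (norm (F (\<zeta> + w) * F (\<zeta> + w))) \<partial>lborel)"
    by (intro cn_holomorphic_ball_average cn_holomorphic_mult fock_holomorphic F)
  also have "\<dots> \<le> (\<integral>\<^sup>+ w. ennreal (exp ((norm \<zeta> + 1)\<^sup>2)) * ennreal ((norm (F (\<zeta> + w)))\<^sup>2 * fock_weight (\<zeta> + w)) \<partial>lborel)"
  proof (rule nn_integral_mono)
    fix w
    show "indicator ?B w * ennreal (norm (F (\<zeta> + w) * F (\<zeta> + w)))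
      \<le> ennreal (exp ((norm \<zeta> + 1)\<^sup>2)) * ennreal ((norm (F (\<zeta> + w)))\<^sup>2 * fock_weight (\<zeta> + w))"
    proof (cases "w \<in> ?B")
      case True
      then have "norm (\<zeta> + w) \<le> norm \<zeta> + 1"
        using norm_triangle_ineq[of \<zeta> w] by simp
      then have "(norm (\<zeta> + w))\<^sup>2 \<le> (norm \<zeta> + 1)\<^sup>2"
        by (intro power_mono) auto
      then have "1 \<le> exp ((norm \<zeta> + 1)\<^sup>2) * fock_weight (\<zeta> + w)"
        by (simp add: fock_weight_def flip: exp_add)
      then have "(norm (F (\<zeta> + w)))\<^sup>2 * 1 \<le> (norm (F (\<zeta> + w)))\<^sup>2 * (exp ((norm \<zeta> + 1)\<^sup>2) * fock_weight (\<zeta> + w))"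
        by (intro mult_left_mono) auto
      then have "norm (F (\<zeta> + w) * F (\<zeta> + w)) \<le> exp ((norm \<zeta> + 1)\<^sup>2) * ((norm (F (\<zeta> + w)))\<^sup>2 * fock_weight (\<zeta> + w))"
        unfolding norm_mult power2_eq_square[of "norm (F (\<zeta> + w))", symmetric]
        by (simp only: mult_1_right mult.left_commute)
      then have "ennreal (norm (F (\<zeta> + w) * F (\<zeta> + w)))
          \<le> ennreal (exp ((norm \<zeta> + 1)\<^sup>2)) * ennreal ((norm (F (\<zeta> + w)))\<^sup>2 * fock_weight (\<zeta> + w))"
        by (subst ennreal_mult[symmetric]) (auto intro: ennreal_leI)
      then show ?thesis
        using True by simp
    qed simp
  qed
  also have "\<dots> = ennreal (exp ((norm \<zeta> + 1)\<^sup>2)) * (\<integral>\<^sup>+ w. ennreal ((norm (F w))\<^sup>2 * fock_weight w) \<partial>lborel)"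
    using nn_integral_lborel_plus[of "\<lambda>w. ennreal ((norm (F w))\<^sup>2 * fock_weight w)" \<zeta>]
    by (simp add: nn_integral_cmult)
  also have "\<dots> = ennreal (exp ((norm \<zeta> + 1)\<^sup>2) * (pi ^ CARD('n) * (fock_norm F)\<^sup>2))"
    unfolding nn_integral_fock_norm[OF F] by (rule ennreal_mult[symmetric]) auto
  finally have "measure lborel ?B * (norm (F \<zeta>))\<^sup>2 \<le> exp ((norm \<zeta> + 1)\<^sup>2) * (pi ^ CARD('n) * (fock_norm F)\<^sup>2)"
    by (subst (asm) ennreal_le_iff) auto
  then have "(norm (F \<zeta>))\<^sup>2 \<le> (fock_eval_bound \<zeta> * fock_norm F)\<^sup>2"
    using vol(2) by (simp add: fock_eval_bound_def power_mult_distrib field_simps)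
  then show ?thesis
    by (rule power2_le_imp_le) simp
qed

lemma fock_norm_eq_0: "F \<in> fock \<Longrightarrow> fock_norm F = 0 \<Longrightarrow> F = (\<lambda>_. 0)"
  using fock_eval_le[of F] by auto

lemma fock_add:
  assumes F: "F \<in> fock" and H: "H \<in> fock"
  shows "(\<lambda>\<zeta>. F \<zeta> + H \<zeta>) \<in> fock"
proof (rule fockI)
  note [measurable] = fock_measurable[OF F] fock_measurable[OF H]
  show "cn_holomorphic (\<lambda>\<zeta>. F \<zeta> + H \<zeta>)"
    by (intro cn_holomorphic_add fock_holomorphic F H)
  show "integrable lborel (\<lambda>\<zeta>. (norm (F \<zeta> + H \<zeta>))\<^sup>2 * fock_weight \<zeta>)"
  proof (rule Bochner_Integration.integrable_bound)
    show "integrable lborel (\<lambda>\<zeta>. 2 * ((norm (F \<zeta>))\<^sup>2 * fock_weight \<zeta>) + 2 * ((norm (H \<zeta>))\<^sup>2 * fock_weight \<zeta>))"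
      by (intro Bochner_Integration.integrable_add integrable_mult_right fock_integrable F H)
    have "(norm (F \<zeta> + H \<zeta>))\<^sup>2 \<le> 2 * (norm (F \<zeta>))\<^sup>2 + 2 * (norm (H \<zeta>))\<^sup>2" for \<zeta>
    proof -
      have "(norm (F \<zeta> + H \<zeta>))\<^sup>2 \<le> (norm (F \<zeta>) + norm (H \<zeta>))\<^sup>2"
        by (intro power_mono norm_triangle_ineq) simp
      also have "\<dots> \<le> 2 * (norm (F \<zeta>))\<^sup>2 + 2 * (norm (H \<zeta>))\<^sup>2"
        using sum_squares_bound[of "norm (F \<zeta>)" "norm (H \<zeta>)"] by (simp add: power2_sum)
      finally show ?thesis .
    qed
    then have "(norm (F \<zeta> + H \<zeta>))\<^sup>2 * fock_weight \<zeta> \<le> (2 * (norm (F \<zeta>))\<^sup>2 + 2 * (norm (H \<zeta>))\<^sup>2) * fock_weight \<zeta>" for \<zeta>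
      by (intro mult_right_mono) auto
    then show "AE \<zeta> in lborel. norm ((norm (F \<zeta> + H \<zeta>))\<^sup>2 * fock_weight \<zeta>)
        \<le> norm (2 * ((norm (F \<zeta>))\<^sup>2 * fock_weight \<zeta>) + 2 * ((norm (H \<zeta>))\<^sup>2 * fock_weight \<zeta>))"
      by (auto simp: algebra_simps abs_mult)
  qed measurable
qed

lemma fock_scale: "F \<in> fock \<Longrightarrow> (\<lambda>\<zeta>. c * F \<zeta>) \<in> fock"
  using fock_integrable[of F, THEN integrable_mult_right[of "(norm c)\<^sup>2"]]
  by (intro fockI) (auto intro: cn_holomorphic_mult fock_holomorphic simp: norm_mult power_mult_distrib mult.assoc)

lemma fock_inner_integrable:
  assumes F: "F \<in> fock" and H: "H \<in> fock"
  shows "integrable lborel (\<lambda>\<zeta>. F \<zeta> * cnj (H \<zeta>) * of_real (fock_weight \<zeta>))"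
proof (rule Bochner_Integration.integrable_bound)
  note [measurable] = fock_measurable[OF F] fock_measurable[OF H]
  have [measurable]: "(\<lambda>\<zeta>. cnj (H \<zeta>)) \<in> borel_measurable borel"
    using fock_holomorphic[OF H] by (intro borel_measurable_continuous_onI continuous_intros cn_holomorphic_continuous)
  show "integrable lborel (\<lambda>\<zeta>. (norm (F \<zeta>))\<^sup>2 * fock_weight \<zeta> + (norm (H \<zeta>))\<^sup>2 * fock_weight \<zeta>)"
    by (intro Bochner_Integration.integrable_add fock_integrable F H)
  show "(\<lambda>\<zeta>. F \<zeta> * cnj (H \<zeta>) * of_real (fock_weight \<zeta>)) \<in> borel_measurable lborel"
    by measurable
  have "norm (F \<zeta>) * norm (H \<zeta>) \<le> (norm (F \<zeta>))\<^sup>2 + (norm (H \<zeta>))\<^sup>2" for \<zeta>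
    using sum_squares_bound[of "norm (F \<zeta>)" "norm (H \<zeta>)"]
      mult_nonneg_nonneg[OF norm_ge_zero[of "F \<zeta>"] norm_ge_zero[of "H \<zeta>"]] by linarith
  then have "norm (F \<zeta>) * norm (H \<zeta>) * fock_weight \<zeta> \<le> ((norm (F \<zeta>))\<^sup>2 + (norm (H \<zeta>))\<^sup>2) * fock_weight \<zeta>" for \<zeta>
    by (intro mult_right_mono) auto
  then show "AE \<zeta> in lborel. norm (F \<zeta> * cnj (H \<zeta>) * of_real (fock_weight \<zeta>))
      \<le> norm ((norm (F \<zeta>))\<^sup>2 * fock_weight \<zeta> + (norm (H \<zeta>))\<^sup>2 * fock_weight \<zeta>)"
    by (auto simp: norm_mult algebra_simps)
qed

lemma fock_inner_add_left:
  assumes "F \<in> fock" "G \<in> fock" "H \<in> fock"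
  shows "fock_inner (\<lambda>\<zeta>. F \<zeta> + G \<zeta>) H = fock_inner F H + fock_inner G H"
  using fock_inner_integrable[OF assms(1,3)] fock_inner_integrable[OF assms(2,3)]
  by (simp add: fock_inner_eq ring_distribs)

lemma fock_inner_scale_left: "fock_inner (\<lambda>\<zeta>. c * F \<zeta>) H = c * fock_inner F H"
proof -
  have "(\<integral>\<zeta>. c * F \<zeta> * cnj (H \<zeta>) * of_real (fock_weight \<zeta>) \<partial>lborel)
      = c * (\<integral>\<zeta>. F \<zeta> * cnj (H \<zeta>) * of_real (fock_weight \<zeta>) \<partial>lborel)"
    by (simp only: mult.assoc integral_mult_right_zero)
  then show ?thesis
    by (simp add: fock_inner_eq)
qed

text \<open>The difference is tested against itself; norm zero forces it to vanish at every point
  because point evaluations are bounded. This is the uniqueness behind the definite descriptions of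
  adjoints and weak integrals.\<close>

lemma fock_eqI:
  assumes F: "F \<in> fock" and H: "H \<in> fock" and eq: "\<And>K. K \<in> fock \<Longrightarrow> fock_inner F K = fock_inner H K"
  shows "F = H"
proof -
  define D where "D \<zeta> = F \<zeta> + (- 1) * H \<zeta>" for \<zeta>
  have D: "D \<in> fock"
    unfolding D_def by (intro fock_add F fock_scale H)
  have "fock_inner D D = fock_inner F D + (- 1) * fock_inner H D"
    unfolding D_def by (simp only: fock_inner_add_left[OF F fock_scale[OF H] D[unfolded D_def]] fock_inner_scale_left)
  then have "fock_norm D = 0"
    using eq[OF D] fock_norm_square(2)[of D] by simp
  then have "D = (\<lambda>_. 0)"
    by (rule fock_norm_eq_0[OF D])
  then show ?thesis
    by (auto simp: D_def fun_eq_iff)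
qed

section \<open>Integrals of operator-valued functions on Fock space\<close>

text \<open>A countable sequence of difference quotients is used so that the derivative inherits
  measurability in a parameter.\<close>

lemma cn_holomorphic_directional_limit:
  fixes F :: "complex ^ 'n \<Rightarrow> complex"
  assumes D: "(F has_derivative D) (at \<zeta>)" and homog: "\<And>c v. D (c *s v) = c * D v"
  shows "(\<lambda>n. (F (\<zeta> + of_real (inverse (real (Suc n))) *s v) - F \<zeta>) / of_real (inverse (real (Suc n)))) \<longlonglongrightarrow> D v"
proof -
  have "((\<lambda>t. F (\<zeta> + t *s v)) has_field_derivative D v) (at 0)"
    using cn_holomorphic_line_derivative[of F D \<zeta> 0 v] D homog by simp
  then have lim: "((\<lambda>h. (F (\<zeta> + h *s v) - F \<zeta>) / h) \<longlongrightarrow> D v) (at 0)"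
    by (simp add: has_field_derivative_iff)
  have "(\<lambda>n. complex_of_real (inverse (real (Suc n)))) \<longlonglongrightarrow> of_real 0"
    by (intro tendsto_of_real LIMSEQ_inverse_real_of_nat)
  then have "filterlim (\<lambda>n. complex_of_real (inverse (real (Suc n)))) (at 0) sequentially"
    by (intro filterlim_atI) (auto simp del: of_nat_Suc)
  from filterlim_compose[OF lim this] show ?thesis .
qed

lemma integrable_mult_bounded:
  fixes a :: "'x \<Rightarrow> complex"
  assumes a: "integrable M a" and g: "g \<in> borel_measurable M" "\<And>x. norm (g x) \<le> c"
  shows "integrable M (\<lambda>x. a x * g x)"
proof (rule Bochner_Integration.integrable_bound)
  show "integrable M (\<lambda>x. norm (a x) * c)"
    using a by simp
  show "(\<lambda>x. a x * g x) \<in> borel_measurable M"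
    using a g by (simp add: borel_measurable_integrable)
  have "0 \<le> c"
    using order_trans[OF norm_ge_zero g(2)] .
  then show "AE x in M. norm (a x * g x) \<le> norm (norm (a x) * c)"
    using g(2) by (auto simp: norm_mult intro!: mult_left_mono)
qed

lemma norm_integral_mult_le:
  fixes a :: "'x \<Rightarrow> complex"
  assumes a: "integrable M a" and g: "g \<in> borel_measurable M" "\<And>x. norm (g x) \<le> c"
  shows "norm (\<integral>x. a x * g x \<partial>M) \<le> (\<integral>x. norm (a x) \<partial>M) * c"
proof -
  have "norm (\<integral>x. a x * g x \<partial>M) \<le> (\<integral>x. norm (a x * g x) \<partial>M)"
    by (rule integral_norm_bound)
  also have "\<dots> \<le> (\<integral>x. norm (a x) * c \<partial>M)"
    using a integrable_mult_bounded[OF a g] g(2)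
    by (intro integral_mono integrable_norm) (auto simp: norm_mult intro!: mult_left_mono)
  finally show ?thesis by simp
qed

text \<open>The derivative is the integral of the derivatives: by the Taylor estimate the remainder
  is quadratic in the increment with a constant independent of \<open>x\<close>, and this survives
  integration against \<open>a\<close>.\<close>

lemma cn_holomorphic_integral:
  fixes G :: "'x \<Rightarrow> complex ^ 'n \<Rightarrow> complex"
  assumes a: "integrable M a" and meas: "\<And>\<zeta>. (\<lambda>x. G x \<zeta>) \<in> borel_measurable M"
    and hol: "\<And>x. cn_holomorphic (G x)" and bound: "\<And>x \<zeta> r. norm \<zeta> \<le> r \<Longrightarrow> norm (G x \<zeta>) \<le> b r"
  shows "cn_holomorphic (\<lambda>\<zeta>. \<integral>x. a x * G x \<zeta> \<partial>M)"
  unfolding cn_holomorphic_def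
proof
  fix \<zeta>
  have "\<forall>x. \<exists>D. (G x has_derivative D) (at \<zeta>) \<and> (\<forall>c v. D (c *s v) = c * D v)"
    using hol unfolding cn_holomorphic_def by blast
  from choice[OF this] obtain D where D: "\<And>x. (G x has_derivative D x) (at \<zeta>)"
    and homog: "\<And>x c v. D x (c *s v) = c * D x v"
    by blast
  define m where "m = b (norm \<zeta> + 2)"
  have bound2: "norm (G x w) \<le> m" if "w \<in> cball \<zeta> 2" for x w
    unfolding m_def
  proof (rule bound)
    show "norm w \<le> norm \<zeta> + 2"
      using that norm_triangle_ineq2[of w \<zeta>] by (simp add: dist_norm norm_minus_commute)
  qed
  \<comment> \<open>Any member of the family shows this; \<open>undefined\<close> merely names an
    element of the index type.\<close>
  have m: "0 \<le> m"
    using order_trans[OF norm_ge_zero bound2[of \<zeta> undefined]] by simp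
  have taylor1: "norm (D x v) \<le> m * norm v" for x v
    by (rule cn_holomorphic_taylor(1)[OF hol bound2 D homog])
  have taylor2: "norm (G x (\<zeta> + v) - G x \<zeta> - D x v) \<le> 2 * m * (norm v)\<^sup>2" if "norm v \<le> 1" for x v
    by (rule cn_holomorphic_taylor(2)[OF hol bound2 D homog that])
  have meas_D: "(\<lambda>x. D x v) \<in> borel_measurable M" for v
  proof (rule borel_measurable_LIMSEQ_metric)
    show "(\<lambda>x. (G x (\<zeta> + of_real (inverse (real (Suc n))) *s v) - G x \<zeta>) / of_real (inverse (real (Suc n)))) \<in> borel_measurable M" for n
      using meas by simp
    show "(\<lambda>n. (G x (\<zeta> + of_real (inverse (real (Suc n))) *s v) - G x \<zeta>) / of_real (inverse (real (Suc n)))) \<longlonglongrightarrow> D x v" for x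
      by (rule cn_holomorphic_directional_limit[OF D homog])
  qed
  have int_D: "integrable M (\<lambda>x. a x * D x v)" for v
    using integrable_mult_bounded[OF a meas_D taylor1] .
  have int_G: "integrable M (\<lambda>x. a x * G x w)" for w
    using integrable_mult_bounded[OF a meas bound[OF order_refl]] .
  define E where "E v = (\<integral>x. a x * D x v \<partial>M)" for v
  define A where "A = (\<integral>x. norm (a x) \<partial>M)"
  have A: "0 \<le> A"
    by (simp add: A_def)
  have lin_D: "linear (D x)" for x
    using D by (rule has_derivative_linear)
  have "linear E"
    using int_D by (intro linearI)
      (simp_all add: E_def linear_add[OF lin_D] linear_scale[OF lin_D] distrib_left)
  then have E: "bounded_linear E"
    by (simp add: linear_conv_bounded_linear)
  have rem: "norm ((\<integral>x. a x * G x (\<zeta> + v) \<partial>M) - (\<integral>x. a x * G x \<zeta> \<partial>M) - E v) \<le> A * (2 * m * (norm v)\<^sup>2)"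
    if v: "norm v \<le> 1" for v
  proof -
    have eq: "(\<integral>x. a x * G x (\<zeta> + v) \<partial>M) - (\<integral>x. a x * G x \<zeta> \<partial>M) - E v
        = (\<integral>x. a x * (G x (\<zeta> + v) - G x \<zeta> - D x v) \<partial>M)"
      using int_D int_G by (simp add: E_def right_diff_distrib)
    have meas': "(\<lambda>x. G x (\<zeta> + v) - G x \<zeta> - D x v) \<in> borel_measurable M"
      by (intro borel_measurable_diff meas meas_D)
    show ?thesis
      unfolding eq A_def by (rule norm_integral_mult_le[OF a meas' taylor2[OF v]])
  qed
  have "((\<lambda>\<zeta>. \<integral>x. a x * G x \<zeta> \<partial>M) has_derivative E) (at \<zeta>)"
    unfolding has_derivative_at
  proof (rule conjI[OF E], rule Lim_null_comparison)
    show "\<forall>\<^sub>F v in at 0. norm (norm ((\<integral>x. a x * G x (\<zeta> + v) \<partial>M) - (\<integral>x. a x * G x \<zeta> \<partial>M) - E v) / norm v) \<le> A * (2 * m) * norm v"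
      unfolding eventually_at
    proof (intro exI[of _ 1] conjI ballI impI)
      fix v :: "complex ^ 'n" assume v: "v \<noteq> 0 \<and> dist v 0 < 1"
      then have "norm ((\<integral>x. a x * G x (\<zeta> + v) \<partial>M) - (\<integral>x. a x * G x \<zeta> \<partial>M) - E v) \<le> A * (2 * m) * norm v * norm v"
        using rem[of v] by (simp add: power2_eq_square mult.assoc)
      then show "norm (norm ((\<integral>x. a x * G x (\<zeta> + v) \<partial>M) - (\<integral>x. a x * G x \<zeta> \<partial>M) - E v) / norm v) \<le> A * (2 * m) * norm v"
        using v by (simp add: pos_divide_le_eq)
    qed simp
    show "((\<lambda>v. A * (2 * m) * norm v) \<longlongrightarrow> 0) (at 0)"
      by (auto intro!: tendsto_eq_intros)
  qed
  moreover have "E (c *s v) = c * E v" for c v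
  proof -
    have "a x * D x (c *s v) = c * (a x * D x v)" for x
      by (simp add: homog mult.left_commute)
    then show ?thesis
      by (simp only: E_def integral_mult_right_zero)
  qed
  ultimately show "\<exists>D. ((\<lambda>\<zeta>. \<integral>x. a x * G x \<zeta> \<partial>M) has_derivative D) (at \<zeta>) \<and> (\<forall>c v. D (c *s v) = c * D v)"
    by blast
qed

text \<open>The setting for integrating \<open>a x\<close> times \<open>G x\<close>. In the
  applications \<open>G x\<close> is a representation operator applied to a fixed vector,
  \<open>B\<close> is the norm of that vector, and \<open>a\<close> is \<open>f\<close>, a line
  integral cut off to the slab, or a constant. Joint measurability is there for Fubini.\<close>

locale fock_family = sigma_finite_measure M
  for M :: "'x measure" +
  fixes a :: "'x \<Rightarrow> complex" and G :: "'x \<Rightarrow> complex ^ 'n \<Rightarrow> complex" and B :: real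
  assumes a: "integrable M a"
    and G_measurable [measurable]: "(\<lambda>p. G (fst p) (snd p)) \<in> borel_measurable (M \<Otimes>\<^sub>M lborel)"
    and G_fock: "\<And>x. G x \<in> fock" and G_norm: "\<And>x. fock_norm (G x) \<le> B"
begin

sublocale pair_sigma_finite M "lborel :: (complex ^ 'n) measure" ..

lemma a_measurable [measurable]: "a \<in> borel_measurable M"
  using a by (rule borel_measurable_integrable)

lemma B_nonneg: "0 \<le> B"
  using order_trans[OF fock_norm_nonneg G_norm] .

lemma G_bound:
  fixes \<zeta> \<xi> :: "complex ^ 'n"
  shows "norm \<zeta> \<le> norm \<xi> \<Longrightarrow> norm (G x \<zeta>) \<le> fock_eval_bound \<xi> * B"
  using fock_eval_le[OF G_fock, of x \<zeta>] mult_mono[OF fock_eval_bound_mono G_norm, of \<zeta> \<xi> x] by simp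

lemma G_measurable_swap [measurable]:
  "(\<lambda>p. G (snd p) (fst p)) \<in> borel_measurable (lborel \<Otimes>\<^sub>M M)"
  "(\<lambda>p. G (snd p) (fst p)) \<in> borel_measurable (borel \<Otimes>\<^sub>M M)"
proof -
  show *: "(\<lambda>p. G (snd p) (fst p)) \<in> borel_measurable (lborel \<Otimes>\<^sub>M M)"
    using measurable_pair_swap[OF G_measurable] by (simp add: case_prod_unfold)
  then show "(\<lambda>p. G (snd p) (fst p)) \<in> borel_measurable (borel \<Otimes>\<^sub>M M)"
    by (subst measurable_cong_sets[OF sets_pair_measure_cong[OF sets_lborel[symmetric] refl] refl])
qed

lemma G_section [measurable]: "(\<lambda>x. G x \<zeta>) \<in> borel_measurable M"
  using measurable_compose[OF measurable_Pair2'[of \<zeta> lborel M] G_measurable] by simp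

lemma integrable_section: "integrable M (\<lambda>x. a x * G x \<zeta>)"
  using integrable_mult_bounded[OF a G_section G_bound[OF order_refl]] .

definition integral_op :: "complex ^ 'n \<Rightarrow> complex" where
  "integral_op \<zeta> = (\<integral>x. a x * G x \<zeta> \<partial>M)"

definition mass :: real where
  "mass = (\<integral>x. norm (a x) \<partial>M)"

lemma mass_nonneg: "0 \<le> mass"
  by (simp add: mass_def)

lemma nn_integral_mass: "(\<integral>\<^sup>+ x. ennreal (norm (a x)) \<partial>M) = ennreal mass"
  unfolding mass_def using a by (intro nn_integral_eq_integral) auto

lemma integral_op_holomorphic: "cn_holomorphic integral_op"
proof -
  \<comment> \<open>The required bound is a function of a radius, whereas
    \<open>fock_eval_bound\<close> takes a point; \<open>r *\<^sub>R e\<close> is a point of norm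
    \<open>r\<close>.\<close>
  obtain e :: "complex ^ 'n" where e: "norm e = 1"
    using vector_choose_size[of 1] by auto
  have "cn_holomorphic (\<lambda>\<zeta>. \<integral>x. a x * G x \<zeta> \<partial>M)"
  proof (rule cn_holomorphic_integral[OF a G_section fock_holomorphic[OF G_fock]])
    show "norm (G x \<zeta>) \<le> fock_eval_bound (r *\<^sub>R e) * B" if "norm \<zeta> \<le> r" for x \<zeta> r
      using that e order_trans[OF norm_ge_zero that] by (intro G_bound) simp
  qed
  then show ?thesis
    by (simp add: integral_op_def[abs_def])
qed

lemma integral_op_measurable [measurable]: "integral_op \<in> borel_measurable borel"
  by (rule cn_holomorphic_measurable[OF integral_op_holomorphic])

text \<open>Cauchy-Schwarz after splitting \<open>norm (a x)\<close> into two square roots: one goes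
  into \<open>mass\<close>, the other stays as a weight.\<close>

lemma integral_op_square_le:
  "ennreal ((norm (integral_op \<zeta>))\<^sup>2) \<le> ennreal mass * (\<integral>\<^sup>+ x. ennreal (norm (a x) * (norm (G x \<zeta>))\<^sup>2) \<partial>M)"
proof -
  have "ennreal (norm (integral_op \<zeta>)) \<le> (\<integral>\<^sup>+ x. ennreal (norm (a x * G x \<zeta>)) \<partial>M)"
    unfolding integral_op_def by (rule integral_norm_bound_ennreal[OF integrable_section])
  also have "\<dots> = (\<integral>\<^sup>+ x. ennreal (sqrt (norm (a x))) * ennreal (sqrt (norm (a x)) * norm (G x \<zeta>)) \<partial>M)"
    by (intro nn_integral_cong) (simp add: norm_mult mult.assoc[symmetric] flip: ennreal_mult)
  finally have "(ennreal (norm (integral_op \<zeta>)))\<^sup>2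
      \<le> (\<integral>\<^sup>+ x. ennreal (sqrt (norm (a x))) * ennreal (sqrt (norm (a x)) * norm (G x \<zeta>)) \<partial>M)\<^sup>2"
    by (rule power_mono) simp
  also have "\<dots> \<le> (\<integral>\<^sup>+ x. (ennreal (sqrt (norm (a x))))\<^sup>2 \<partial>M) * (\<integral>\<^sup>+ x. (ennreal (sqrt (norm (a x)) * norm (G x \<zeta>)))\<^sup>2 \<partial>M)"
    by (rule Cauchy_Schwarz_nn_integral) measurable
  also have "\<dots> = ennreal mass * (\<integral>\<^sup>+ x. ennreal (norm (a x) * (norm (G x \<zeta>))\<^sup>2) \<partial>M)"
    by (simp add: ennreal_power power_mult_distrib nn_integral_mass)
  finally show ?thesis
    by (simp add: ennreal_power)
qed

text \<open>The pointwise inequality is integrated against the Gaussian and the order of integration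
  exchanged; the second factor \<open>mass\<close> comes from the weight \<open>norm (a x)\<close>
  left over by Cauchy-Schwarz.\<close>

lemma nn_integral_integral_op:
  "(\<integral>\<^sup>+ \<zeta>. ennreal ((norm (integral_op \<zeta>))\<^sup>2 * fock_weight \<zeta>) \<partial>lborel) \<le> ennreal (pi ^ CARD('n) * (mass * B)\<^sup>2)"
proof -
  have "(\<integral>\<^sup>+ \<zeta>. ennreal ((norm (integral_op \<zeta>))\<^sup>2 * fock_weight \<zeta>) \<partial>lborel)
      \<le> (\<integral>\<^sup>+ \<zeta>. ennreal mass * (\<integral>\<^sup>+ x. ennreal (norm (a x) * ((norm (G x \<zeta>))\<^sup>2 * fock_weight \<zeta>)) \<partial>M) \<partial>lborel)"
  proof (rule nn_integral_mono)
    fix \<zeta> :: "complex ^ 'n"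
    have "ennreal ((norm (integral_op \<zeta>))\<^sup>2 * fock_weight \<zeta>) = ennreal ((norm (integral_op \<zeta>))\<^sup>2) * ennreal (fock_weight \<zeta>)"
      by (rule ennreal_mult) auto
    also have "\<dots> \<le> ennreal mass * (\<integral>\<^sup>+ x. ennreal (norm (a x) * (norm (G x \<zeta>))\<^sup>2) \<partial>M) * ennreal (fock_weight \<zeta>)"
      by (intro mult_right_mono integral_op_square_le) simp
    also have "\<dots> = ennreal mass * (\<integral>\<^sup>+ x. ennreal (norm (a x) * (norm (G x \<zeta>))\<^sup>2) * ennreal (fock_weight \<zeta>) \<partial>M)"
      by (simp only: mult.assoc) (subst nn_integral_multc, measurable)
    also have "(\<integral>\<^sup>+ x. ennreal (norm (a x) * (norm (G x \<zeta>))\<^sup>2) * ennreal (fock_weight \<zeta>) \<partial>M)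
        = (\<integral>\<^sup>+ x. ennreal (norm (a x) * ((norm (G x \<zeta>))\<^sup>2 * fock_weight \<zeta>)) \<partial>M)"
      by (intro nn_integral_cong) (simp add: mult.assoc flip: ennreal_mult)
    finally show "ennreal ((norm (integral_op \<zeta>))\<^sup>2 * fock_weight \<zeta>)
        \<le> ennreal mass * (\<integral>\<^sup>+ x. ennreal (norm (a x) * ((norm (G x \<zeta>))\<^sup>2 * fock_weight \<zeta>)) \<partial>M)" .
  qed
  also have "\<dots> = ennreal mass * (\<integral>\<^sup>+ \<zeta>. \<integral>\<^sup>+ x. ennreal (norm (a x) * ((norm (G x \<zeta>))\<^sup>2 * fock_weight \<zeta>)) \<partial>M \<partial>lborel)"
    by (rule nn_integral_cmult) measurable
  also have "\<dots> \<le> ennreal mass * (ennreal mass * ennreal (pi ^ CARD('n) * B\<^sup>2))"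
  proof (rule mult_left_mono)
  have "(\<integral>\<^sup>+ \<zeta>. \<integral>\<^sup>+ x. ennreal (norm (a x) * ((norm (G x \<zeta>))\<^sup>2 * fock_weight \<zeta>)) \<partial>M \<partial>lborel)
      = (\<integral>\<^sup>+ x. \<integral>\<^sup>+ \<zeta>. ennreal (norm (a x) * ((norm (G x \<zeta>))\<^sup>2 * fock_weight \<zeta>)) \<partial>lborel \<partial>M)"
    by (rule Fubini') (simp add: case_prod_unfold)
  also have "\<dots> \<le> (\<integral>\<^sup>+ x. ennreal (norm (a x)) * ennreal (pi ^ CARD('n) * B\<^sup>2) \<partial>M)"
  proof (rule nn_integral_mono)
    fix x
    note [measurable] = fock_measurable[OF G_fock[of x]]
    have "(\<integral>\<^sup>+ \<zeta>. ennreal (norm (a x) * ((norm (G x \<zeta>))\<^sup>2 * fock_weight \<zeta>)) \<partial>lborel)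
        = (\<integral>\<^sup>+ \<zeta>. ennreal (norm (a x)) * ennreal ((norm (G x \<zeta>))\<^sup>2 * fock_weight \<zeta>) \<partial>lborel)"
      by (intro nn_integral_cong ennreal_mult) auto
    also have "\<dots> = ennreal (norm (a x)) * ennreal (pi ^ CARD('n) * (fock_norm (G x))\<^sup>2)"
      unfolding nn_integral_fock_norm[OF G_fock, symmetric] by (rule nn_integral_cmult) measurable
    also have "\<dots> \<le> ennreal (norm (a x)) * ennreal (pi ^ CARD('n) * B\<^sup>2)"
      by (intro mult_left_mono ennreal_leI power_mono G_norm) auto
    finally show "(\<integral>\<^sup>+ \<zeta>. ennreal (norm (a x) * ((norm (G x \<zeta>))\<^sup>2 * fock_weight \<zeta>)) \<partial>lborel)
        \<le> ennreal (norm (a x)) * ennreal (pi ^ CARD('n) * B\<^sup>2)" .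
  qed
  also have "\<dots> = ennreal mass * ennreal (pi ^ CARD('n) * B\<^sup>2)"
    by (subst nn_integral_multc) (simp_all add: nn_integral_mass)
  finally show "(\<integral>\<^sup>+ \<zeta>. \<integral>\<^sup>+ x. ennreal (norm (a x) * ((norm (G x \<zeta>))\<^sup>2 * fock_weight \<zeta>)) \<partial>M \<partial>lborel)
      \<le> ennreal mass * ennreal (pi ^ CARD('n) * B\<^sup>2)" .
  qed simp
  also have "\<dots> = ennreal (mass * (mass * (pi ^ CARD('n) * B\<^sup>2)))"
    using mass_nonneg by (simp add: ennreal_mult del: ennreal_mult')
  finally show ?thesis
    by (simp add: power_mult_distrib power2_eq_square mult_ac)
qed

lemma integral_op_fock: "integral_op \<in> fock"
proof (rule fockI[OF integral_op_holomorphic])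
  show "integrable lborel (\<lambda>\<zeta>. (norm (integral_op \<zeta>))\<^sup>2 * fock_weight \<zeta>)"
    by (rule integrableI_bounded)
      (use le_less_trans[OF nn_integral_integral_op ennreal_less_top] in \<open>auto simp: abs_mult\<close>)
qed

lemma integral_op_norm: "fock_norm integral_op \<le> mass * B"
proof -
  have "pi ^ CARD('n) * (fock_norm integral_op)\<^sup>2 \<le> pi ^ CARD('n) * (mass * B)\<^sup>2"
    using nn_integral_integral_op unfolding nn_integral_fock_norm[OF integral_op_fock]
    by (subst (asm) ennreal_le_iff) auto
  then have "(fock_norm integral_op)\<^sup>2 \<le> (mass * B)\<^sup>2"
    by (rule mult_left_le_imp_le) simp
  then show ?thesis
    by (rule power2_le_imp_le) (simp add: mass_nonneg B_nonneg)
qed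

text \<open>Only finiteness is at stake, so the product of the norms of \<open>G x\<close> and
  \<open>K\<close> at a point is bounded crudely by the sum of their squares; \<open>?c\<close>
  bounds the resulting integral for every \<open>x\<close>.\<close>

lemma integrable_pairing:
  assumes K: "K \<in> fock"
  shows "integrable (M \<Otimes>\<^sub>M lborel) (\<lambda>p. a (fst p) * (G (fst p) (snd p) * cnj (K (snd p)) * of_real (fock_weight (snd p))))"
proof (rule integrableI_bounded)
  note [measurable] = fock_measurable[OF K]
  have [measurable]: "(\<lambda>\<zeta>. cnj (K \<zeta>)) \<in> borel_measurable borel"
    using fock_holomorphic[OF K] by (intro borel_measurable_continuous_onI continuous_intros cn_holomorphic_continuous)
  show "(\<lambda>p. a (fst p) * (G (fst p) (snd p) * cnj (K (snd p)) * of_real (fock_weight (snd p)))) \<in> borel_measurable (M \<Otimes>\<^sub>M lborel)"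
    by measurable
  let ?c = "pi ^ CARD('n) * B\<^sup>2 + pi ^ CARD('n) * (fock_norm K)\<^sup>2"
  have "(\<integral>\<^sup>+ p. ennreal (norm (a (fst p) * (G (fst p) (snd p) * cnj (K (snd p)) * of_real (fock_weight (snd p))))) \<partial>(M \<Otimes>\<^sub>M lborel))
      = (\<integral>\<^sup>+ x. \<integral>\<^sup>+ \<zeta>. ennreal (norm (a x * (G x \<zeta> * cnj (K \<zeta>) * of_real (fock_weight \<zeta>)))) \<partial>lborel \<partial>M)"
    by (subst lborel.nn_integral_fst[symmetric]) (auto simp: lborel.nn_integral_fst)
  also have "\<dots> \<le> (\<integral>\<^sup>+ x. ennreal (norm (a x)) * ennreal ?c \<partial>M)"
  proof (rule nn_integral_mono)
    fix x
    note [measurable] = fock_measurable[OF G_fock[of x]]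
    have "(\<integral>\<^sup>+ \<zeta>. ennreal (norm (a x * (G x \<zeta> * cnj (K \<zeta>) * of_real (fock_weight \<zeta>)))) \<partial>lborel)
        \<le> (\<integral>\<^sup>+ \<zeta>. ennreal (norm (a x)) * (ennreal ((norm (G x \<zeta>))\<^sup>2 * fock_weight \<zeta>) + ennreal ((norm (K \<zeta>))\<^sup>2 * fock_weight \<zeta>)) \<partial>lborel)"
    proof (rule nn_integral_mono)
      fix \<zeta>
      have "norm (G x \<zeta>) * norm (K \<zeta>) \<le> (norm (G x \<zeta>))\<^sup>2 + (norm (K \<zeta>))\<^sup>2"
        using sum_squares_bound[of "norm (G x \<zeta>)" "norm (K \<zeta>)"]
          mult_nonneg_nonneg[OF norm_ge_zero[of "G x \<zeta>"] norm_ge_zero[of "K \<zeta>"]] by linarith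
      then have "norm (G x \<zeta>) * norm (K \<zeta>) * fock_weight \<zeta> \<le> ((norm (G x \<zeta>))\<^sup>2 + (norm (K \<zeta>))\<^sup>2) * fock_weight \<zeta>"
        by (rule mult_right_mono) simp
      then have "norm (a x) * (norm (G x \<zeta>) * norm (K \<zeta>) * fock_weight \<zeta>)
          \<le> norm (a x) * ((norm (G x \<zeta>))\<^sup>2 * fock_weight \<zeta> + (norm (K \<zeta>))\<^sup>2 * fock_weight \<zeta>)"
        by (intro mult_left_mono) (simp_all add: distrib_right)
      then have "ennreal (norm (a x * (G x \<zeta> * cnj (K \<zeta>) * of_real (fock_weight \<zeta>))))
          \<le> ennreal (norm (a x) * ((norm (G x \<zeta>))\<^sup>2 * fock_weight \<zeta> + (norm (K \<zeta>))\<^sup>2 * fock_weight \<zeta>))"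
        by (intro ennreal_leI) (simp add: norm_mult)
      then show "ennreal (norm (a x * (G x \<zeta> * cnj (K \<zeta>) * of_real (fock_weight \<zeta>))))
          \<le> ennreal (norm (a x)) * (ennreal ((norm (G x \<zeta>))\<^sup>2 * fock_weight \<zeta>) + ennreal ((norm (K \<zeta>))\<^sup>2 * fock_weight \<zeta>))"
        by (subst (asm) ennreal_mult) auto
    qed
    also have "\<dots> = ennreal (norm (a x)) * (ennreal (pi ^ CARD('n) * (fock_norm (G x))\<^sup>2) + ennreal (pi ^ CARD('n) * (fock_norm K)\<^sup>2))"
      unfolding nn_integral_fock_norm[OF G_fock, symmetric] nn_integral_fock_norm[OF K, symmetric]
      by (subst nn_integral_cmult, measurable, subst nn_integral_add, measurable)
    also have "\<dots> = ennreal (norm (a x)) * ennreal (pi ^ CARD('n) * (fock_norm (G x))\<^sup>2 + pi ^ CARD('n) * (fock_norm K)\<^sup>2)"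
      by (subst ennreal_plus) auto
    also have "\<dots> \<le> ennreal (norm (a x)) * ennreal ?c"
      by (intro mult_left_mono ennreal_leI add_right_mono power_mono G_norm) auto
    finally show "(\<integral>\<^sup>+ \<zeta>. ennreal (norm (a x * (G x \<zeta> * cnj (K \<zeta>) * of_real (fock_weight \<zeta>)))) \<partial>lborel)
        \<le> ennreal (norm (a x)) * ennreal ?c" .
  qed
  also have "\<dots> = ennreal mass * ennreal ?c"
    by (subst nn_integral_multc) (simp_all add: nn_integral_mass)
  also have "\<dots> < \<infinity>"
    by (simp add: ennreal_mult_less_top)
  finally show "(\<integral>\<^sup>+ p. ennreal (norm (a (fst p) * (G (fst p) (snd p) * cnj (K (snd p)) * of_real (fock_weight (snd p))))) \<partial>(M \<Otimes>\<^sub>M lborel)) < \<infinity>" .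
qed

text \<open>The pointwise integral has the defining property of the weak one: pairing with
  \<open>K\<close> is an integral over Fock variables, and Fubini exchanges it with the integral
  over \<open>x\<close>.\<close>

lemma has_bochner_integral_pairing:
  assumes K: "K \<in> fock"
  shows "has_bochner_integral M (\<lambda>x. fock_inner (\<lambda>\<zeta>. a x * G x \<zeta>) K) (fock_inner integral_op K)"
proof -
  let ?h = "\<lambda>p. a (fst p) * (G (fst p) (snd p) * cnj (K (snd p)) * of_real (fock_weight (snd p)))"
  let ?c = "complex_of_real (1 / pi ^ CARD('n))"
  note int = integrable_pairing[OF K]
  have inner: "fock_inner (\<lambda>\<zeta>. a x * G x \<zeta>) K = ?c * (\<integral>\<zeta>. ?h (x, \<zeta>) \<partial>lborel)" for x
    unfolding fock_inner_eq by (simp add: mult.assoc)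
  have "(\<integral>x. ?h (x, \<zeta>) \<partial>M) = integral_op \<zeta> * cnj (K \<zeta>) * of_real (fock_weight \<zeta>)" for \<zeta>
  proof -
    have "(\<integral>x. ?h (x, \<zeta>) \<partial>M) = (\<integral>x. (a x * G x \<zeta>) * (cnj (K \<zeta>) * of_real (fock_weight \<zeta>)) \<partial>M)"
      by (simp add: mult.assoc)
    also have "\<dots> = integral_op \<zeta> * (cnj (K \<zeta>) * of_real (fock_weight \<zeta>))"
      unfolding integral_op_def by (rule integral_mult_left_zero)
    finally show ?thesis
      by (simp add: mult.assoc)
  qed
  then have "fock_inner integral_op K = ?c * (\<integral>\<zeta>. \<integral>x. ?h (x, \<zeta>) \<partial>M \<partial>lborel)"
    by (simp only: fock_inner_eq)
  also have "(\<integral>\<zeta>. \<integral>x. ?h (x, \<zeta>) \<partial>M \<partial>lborel) = (\<integral>x. \<integral>\<zeta>. ?h (x, \<zeta>) \<partial>lborel \<partial>M)"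
    using Fubini_integral[of "\<lambda>x \<zeta>. ?h (x, \<zeta>)"] int by (simp add: case_prod_unfold)
  finally show ?thesis
    unfolding has_bochner_integral_iff inner using integrable_fst'[OF int] by simp
qed

end

lemma op_integral_eqI:
  assumes H: "H \<in> fock" and pairing: "\<And>K. K \<in> fock \<Longrightarrow> has_bochner_integral M (\<lambda>x. fock_inner (\<Phi> x F) K) (fock_inner H K)"
  shows "op_integral M \<Phi> F = H"
  unfolding op_integral_def
proof (rule the_equality)
  show "H \<in> fock \<and> (\<forall>K\<in>fock. has_bochner_integral M (\<lambda>x. fock_inner (\<Phi> x F) K) (fock_inner H K))"
    using H pairing by blast
  show "H' = H" if "H' \<in> fock \<and> (\<forall>K\<in>fock. has_bochner_integral M (\<lambda>x. fock_inner (\<Phi> x F) K) (fock_inner H' K))" for H'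
    using that H pairing by (intro fock_eqI) (auto intro: has_bochner_integral_eq)
qed

text \<open>Collects what makes \<open>U x F\<close> an admissible integrand for every
  \<open>F\<close> at once, together with linearity in \<open>F\<close>. The representation
  operators satisfy the norm condition with equality.\<close>

definition fock_contractions :: "'x measure \<Rightarrow> ('x \<Rightarrow> ('n::finite) fock_op) \<Rightarrow> bool" where
  "fock_contractions M U \<longleftrightarrow> (\<forall>F\<in>fock.
     (\<lambda>p. U (fst p) F (snd p)) \<in> borel_measurable (M \<Otimes>\<^sub>M lborel) \<and>
     (\<forall>x. U x F \<in> fock \<and> fock_norm (U x F) \<le> fock_norm F \<and>
        (\<forall>H\<in>fock. U x (\<lambda>\<zeta>. F \<zeta> + H \<zeta>) = (\<lambda>\<zeta>. U x F \<zeta> + U x H \<zeta>)) \<and>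
        (\<forall>c. U x (\<lambda>\<zeta>. c * F \<zeta>) = (\<lambda>\<zeta>. c * U x F \<zeta>))))"

lemma fock_contractions_family:
  assumes "fock_contractions M U" "sigma_finite_measure M" "integrable M a" "F \<in> fock"
  shows "fock_family M a (\<lambda>x. U x F) (fock_norm F)"
  using assms by (simp add: fock_contractions_def fock_family_def fock_family_axioms_def)

text \<open>One criterion for all three boundedness claims: both Fourier transforms and the
  multiplier are pointwise integrals of this shape on Fock space. The bound obtained is the L1 norm
  of \<open>a\<close>.\<close>

lemma fock_bounded_integral:
  fixes T :: "('n::finite) fock_op"
  assumes U: "fock_contractions M U" and M: "sigma_finite_measure M" and a: "integrable M a"
    and T: "\<And>F. F \<in> fock \<Longrightarrow> T F = (\<lambda>\<zeta>. \<integral>x. a x * U x F \<zeta> \<partial>M)"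
  shows "fock_bounded T"
proof -
  note fam = fock_contractions_family[OF U M a]
  have TF: "T F = fock_family.integral_op M a (\<lambda>x. U x F)" if "F \<in> fock" for F
    using T[OF that] fock_family.integral_op_def[OF fam[OF that]] by auto
  have int: "integrable M (\<lambda>x. a x * U x F \<zeta>)" if "F \<in> fock" for F \<zeta>
    by (rule fock_family.integrable_section[OF fam[OF that]])
  show ?thesis
    unfolding fock_bounded_def
  proof (intro conjI ballI allI exI)
    fix F :: "complex ^ 'n \<Rightarrow> complex" assume F: "F \<in> fock"
    show "T F \<in> fock"
      unfolding TF[OF F] by (rule fock_family.integral_op_fock[OF fam[OF F]])
    show "fock_norm (T F) \<le> (\<integral>x. norm (a x) \<partial>M) * fock_norm F"
      using fock_family.integral_op_norm[OF fam[OF F]]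
      unfolding TF[OF F] fock_family.mass_def[OF fam[OF F]] .
    show "T (\<lambda>\<zeta>. c * F \<zeta>) = (\<lambda>\<zeta>. c * T F \<zeta>)" for c
    proof -
      have "a x * U x (\<lambda>\<zeta>. c * F \<zeta>) \<zeta> = c * (a x * U x F \<zeta>)" for x \<zeta>
        using U F by (simp add: fock_contractions_def mult.left_commute)
      then show ?thesis
        by (simp only: T[OF F] T[OF fock_scale[OF F]] integral_mult_right_zero)
    qed
    fix H :: "complex ^ 'n \<Rightarrow> complex" assume H: "H \<in> fock"
    have "a x * U x (\<lambda>\<zeta>. F \<zeta> + H \<zeta>) \<zeta> = a x * U x F \<zeta> + a x * U x H \<zeta>" for x \<zeta>
      using U F H by (simp add: fock_contractions_def distrib_left)
    then show "T (\<lambda>\<zeta>. F \<zeta> + H \<zeta>) = (\<lambda>\<zeta>. T F \<zeta> + T H \<zeta>)"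
      using int[OF F] int[OF H] by (simp add: T F H fock_add)
  qed
qed

section \<open>The representations on Fock space\<close>

text \<open>The Hermitian form on complex space. Its real part is the Euclidean inner product; its
  imaginary part is, up to sign and scale, the symplectic form given by the bracket.\<close>

definition cdot :: "complex ^ 'n \<Rightarrow> complex ^ 'n \<Rightarrow> complex" where
  "cdot w z = (\<Sum>i\<in>UNIV. w $ i * cnj (z $ i))"

lemma Re_cdot: "Re (cdot w z) = w \<bullet> z"
  by (simp add: cdot_def inner_vec_def inner_complex_def)

lemma cdot_add_left: "cdot (w + w') z = cdot w z + cdot w' z"
  by (simp add: cdot_def distrib_right sum.distrib)

lemma cdot_add_right: "cdot w (z + z') = cdot w z + cdot w z'"
  by (simp add: cdot_def distrib_left sum.distrib)

lemma cdot_scaleR_left: "cdot (c *\<^sub>R w) z = of_real c * cdot w z"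
  by (simp add: cdot_def sum_distrib_left mult.assoc scaleR_conv_of_real[where 'a = complex])

lemma cdot_zero [simp]: "cdot w 0 = 0"
  by (simp add: cdot_def)

lemma inner_i_smult: "(\<i> *s w) \<bullet> z = - Im (cdot w z)"
proof -
  have "cdot (\<i> *s w) z = \<i> * cdot w z"
    by (simp add: cdot_def sum_distrib_left mult.assoc)
  then show ?thesis
    using Re_cdot[of "\<i> *s w" z] by simp
qed

definition pi_factor :: "real \<Rightarrow> complex ^ 'n \<Rightarrow> real \<Rightarrow> complex ^ 'n \<Rightarrow> complex" where
  "pi_factor h z t \<zeta> = exp (\<i> * of_real (h * t) - of_real (sqrt (h / 2)) * cdot \<zeta> z - of_real (h / 4 * (norm z)\<^sup>2))"

lemma pi_heis_eq: "pi_heis h z t F \<zeta> = pi_factor h z t \<zeta> * F (\<zeta> + sqrt (h / 2) *\<^sub>R z)"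
  by (simp add: pi_heis_def pi_factor_def cdot_def)

lemma pi_factor_holomorphic: "cn_holomorphic (pi_factor h z t)"
proof -
  have "pi_factor h z t = (\<lambda>\<zeta>. exp ((\<i> * of_real (h * t) - of_real (h / 4 * (norm z)\<^sup>2))
      - (\<Sum>i\<in>UNIV. \<zeta> $ i * (\<chi> i. of_real (sqrt (h / 2)) * cnj (z $ i)) $ i)))"
    by (simp add: pi_factor_def cdot_def fun_eq_iff sum_distrib_left mult.left_commute algebra_simps)
  then show ?thesis
    by (simp only: cn_holomorphic_exp_linear)
qed

text \<open>Completing the square: twice the real part of the exponent plus the Gaussian exponent at
  \<open>\<zeta>\<close> is the Gaussian exponent at the shifted point. Preservation of the inner
  product is then translation invariance of Lebesgue measure.\<close>

lemma pi_factor_weight: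
  assumes "h > 0"
  shows "pi_factor h z t \<zeta> * cnj (pi_factor h z t \<zeta>) * of_real (fock_weight \<zeta>)
    = of_real (fock_weight (\<zeta> + sqrt (h / 2) *\<^sub>R z))"
proof -
  define e where "e = \<i> * of_real (h * t) - of_real (sqrt (h / 2)) * cdot \<zeta> z - of_real (h / 4 * (norm z)\<^sup>2)"
  have "(norm (\<zeta> + r *\<^sub>R z))\<^sup>2 = (norm \<zeta>)\<^sup>2 + 2 * r * (\<zeta> \<bullet> z) + r\<^sup>2 * (norm z)\<^sup>2" for r
    unfolding power2_norm_eq_inner by (simp add: inner_add_left inner_add_right inner_commute power2_eq_square)
  moreover have "(sqrt (h / 2))\<^sup>2 = h / 2"
    using assms by simp
  ultimately have norm_sq: "(norm (\<zeta> + sqrt (h / 2) *\<^sub>R z))\<^sup>2 = (norm \<zeta>)\<^sup>2 + 2 * sqrt (h / 2) * (\<zeta> \<bullet> z) + h / 2 * (norm z)\<^sup>2"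
    by metis
  have "e + cnj e = of_real (2 * Re e)"
    by (rule complex_add_cnj)
  also have "2 * Re e = - 2 * sqrt (h / 2) * (\<zeta> \<bullet> z) - h / 2 * (norm z)\<^sup>2"
    by (simp add: e_def Re_cdot)
  finally have "e + cnj e = of_real (- 2 * sqrt (h / 2) * (\<zeta> \<bullet> z) - h / 2 * (norm z)\<^sup>2)" .
  then have "e + cnj e + of_real (- (norm \<zeta>)\<^sup>2) = of_real (- (norm (\<zeta> + sqrt (h / 2) *\<^sub>R z))\<^sup>2)"
    by (simp only: norm_sq of_real_add[symmetric]) (simp add: algebra_simps)
  then have "exp e * cnj (exp e) * exp (of_real (- (norm \<zeta>)\<^sup>2)) = exp (of_real (- (norm (\<zeta> + sqrt (h / 2) *\<^sub>R z))\<^sup>2))"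
    by (simp only: exp_cnj exp_add[symmetric])
  then show ?thesis
    by (simp only: pi_factor_def fock_weight_def e_def exp_of_real)
qed

lemma pi_heis_pairing:
  assumes "h > 0"
  shows "pi_heis h z t F \<zeta> * cnj (pi_heis h z t K \<zeta>) * of_real (fock_weight \<zeta>)
    = F (\<zeta> + sqrt (h / 2) *\<^sub>R z) * cnj (K (\<zeta> + sqrt (h / 2) *\<^sub>R z)) * of_real (fock_weight (\<zeta> + sqrt (h / 2) *\<^sub>R z))"
  unfolding pi_heis_eq pi_factor_weight[OF assms, of z t, symmetric] by (simp add: mult_ac)

lemma pi_heis_norm_pairing:
  assumes "h > 0"
  shows "(norm (pi_heis h z t F \<zeta>))\<^sup>2 * fock_weight \<zeta>
    = (norm (F (\<zeta> + sqrt (h / 2) *\<^sub>R z)))\<^sup>2 * fock_weight (\<zeta> + sqrt (h / 2) *\<^sub>R z)"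
  using pi_heis_pairing[OF assms, of z t F \<zeta> F]
  unfolding complex_norm_square[symmetric] of_real_mult[symmetric] of_real_eq_iff .

lemma pi_heis_fock:
  assumes h: "h > 0" and F: "F \<in> fock"
  shows "pi_heis h z t F \<in> fock"
proof (rule fockI)
  show "cn_holomorphic (pi_heis h z t F)"
    using cn_holomorphic_mult[OF pi_factor_holomorphic cn_holomorphic_shift[OF fock_holomorphic[OF F]]]
    by (simp only: pi_heis_eq[abs_def])
  have meas: "(\<lambda>\<zeta>. (norm (F \<zeta>))\<^sup>2 * fock_weight \<zeta>) \<in> borel_measurable borel"
    using fock_measurable[OF F] by simp
  have "integrable (distr lborel borel ((+) (sqrt (h / 2) *\<^sub>R z))) (\<lambda>\<zeta>. (norm (F \<zeta>))\<^sup>2 * fock_weight \<zeta>)"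
    using fock_integrable[OF F] by (simp add: lborel_distr_plus)
  then show "integrable lborel (\<lambda>\<zeta>. (norm (pi_heis h z t F \<zeta>))\<^sup>2 * fock_weight \<zeta>)"
    unfolding pi_heis_norm_pairing[OF h] using meas by (simp add: integrable_distr_eq add.commute)
qed

lemma fock_inner_pi_heis:
  assumes h: "h > 0" and F: "F \<in> fock" and K: "K \<in> fock"
  shows "fock_inner (pi_heis h z t F) (pi_heis h z t K) = fock_inner F K"
proof -
  have "(\<lambda>\<zeta>. F \<zeta> * cnj (K \<zeta>) * of_real (fock_weight \<zeta>)) \<in> borel_measurable borel"
    using borel_measurable_integrable[OF fock_inner_integrable[OF F K]] by simp
  then have "(\<integral>\<zeta>. F \<zeta> * cnj (K \<zeta>) * of_real (fock_weight \<zeta>) \<partial>distr lborel borel ((+) (sqrt (h / 2) *\<^sub>R z)))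
      = (\<integral>\<zeta>. pi_heis h z t F \<zeta> * cnj (pi_heis h z t K \<zeta>) * of_real (fock_weight \<zeta>) \<partial>lborel)"
    unfolding pi_heis_pairing[OF h] by (subst integral_distr) (simp_all add: add.commute)
  then show ?thesis
    by (simp add: fock_inner_eq lborel_distr_plus)
qed

lemma fock_norm_pi_heis:
  assumes "h > 0" "F \<in> fock"
  shows "fock_norm (pi_heis h z t F) = fock_norm F"
  using fock_inner_pi_heis[OF assms(1,2,2)] by (simp add: fock_norm_def)

text \<open>Shifting the argument of the second factor contributes \<open>- h / 2\<close> times
  \<open>cdot z z'\<close> to the exponent. Its real part completes the square of
  \<open>norm (z + z')\<close>; its imaginary part is the Heisenberg cocycle.\<close>

lemma pi_heis_pi_heis:
  assumes "h > 0"
  shows "pi_heis h z t (pi_heis h z' t' F) = pi_heis h (z + z') (t + t' - Im (cdot z z') / 2) F"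
proof
  fix \<zeta>
  define r where "r = sqrt (h / 2)"
  have r: "of_real r * of_real r = (of_real (h / 2) :: complex)"
    using assms by (simp add: r_def flip: of_real_mult)
  have norm_sq: "(norm (z + z'))\<^sup>2 = (norm z)\<^sup>2 + 2 * Re (cdot z z') + (norm z')\<^sup>2"
    unfolding Re_cdot power2_norm_eq_inner by (simp add: inner_add_left inner_add_right inner_commute)
  have split: "cdot z z' = of_real (Re (cdot z z')) + \<i> * of_real (Im (cdot z z'))"
    by (rule complex_eq)
  have "(\<i> * of_real (h * t) - of_real r * cdot \<zeta> z - of_real (h / 4 * (norm z)\<^sup>2))
      + (\<i> * of_real (h * t') - of_real r * cdot (\<zeta> + r *\<^sub>R z) z' - of_real (h / 4 * (norm z')\<^sup>2))
    = \<i> * of_real (h * t) + \<i> * of_real (h * t') - of_real r * cdot \<zeta> z - of_real r * cdot \<zeta> z'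
      - (of_real r * of_real r) * cdot z z' - of_real (h / 4 * (norm z)\<^sup>2) - of_real (h / 4 * (norm z')\<^sup>2)"
    by (simp add: cdot_add_left cdot_scaleR_left algebra_simps)
  also have "\<dots> = \<i> * of_real (h * (t + t' - Im (cdot z z') / 2)) - of_real r * cdot \<zeta> (z + z') - of_real (h / 4 * (norm (z + z'))\<^sup>2)"
    unfolding r norm_sq by (subst split) (simp add: cdot_add_right algebra_simps)
  finally have "pi_factor h z t \<zeta> * pi_factor h z' t' (\<zeta> + r *\<^sub>R z) = pi_factor h (z + z') (t + t' - Im (cdot z z') / 2) \<zeta>"
    unfolding pi_factor_def r_def[symmetric] exp_add[symmetric] by simp
  then show "pi_heis h z t (pi_heis h z' t' F) \<zeta> = pi_heis h (z + z') (t + t' - Im (cdot z z') / 2) F \<zeta>"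
    by (simp add: pi_heis_eq r_def[symmetric] scaleR_add_right add.assoc mult.assoc[symmetric])
qed

lemma pi_heis_zero: "pi_heis h 0 0 F = F"
  by (simp add: pi_heis_eq pi_factor_def fun_eq_iff)

section \<open>From the Heisenberg model to representations of the H-type group\<close>

locale h_type_frame = h_type_algebra br for br :: "'g::euclidean_space \<Rightarrow> 'g \<Rightarrow> 'g" +
  fixes R :: "'g \<Rightarrow> complex ^ 'n \<Rightarrow> 'g" and \<mu> :: 'g
  assumes frame: "frame_family br R" and \<mu>_center: "\<mu> \<in> lie_center br" and \<mu>_nonzero: "\<mu> \<noteq> 0"
begin

abbreviation "coord \<equiv> adjoint (R \<mu>)"

lemma linear_R: "linear (R \<mu>)" and range_R: "range (R \<mu>) = horizontal br"
  and J_map_R: "V \<in> horizontal br \<Longrightarrow> J_map br \<mu> V = norm \<mu> *\<^sub>R R \<mu> (\<i> *s coord V)"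
  using frame \<mu>_center \<mu>_nonzero unfolding frame_family_def by blast+

lemma linear_coord: "linear coord"
  by (rule adjoint_linear[OF linear_R])

lemma coord_center: "z \<in> lie_center br \<Longrightarrow> coord z = 0"
proof -
  assume z: "z \<in> lie_center br"
  have "coord z \<bullet> coord z = R \<mu> (coord z) \<bullet> z"
    by (simp add: adjoint_works[OF linear_R] inner_commute)
  also have "\<dots> = 0"
    using range_R z by (intro horiz_inner_center) auto
  finally show ?thesis by simp
qed

text \<open>Matches the bracket with the cocycle above: half of this, divided by
  \<open>norm \<mu>\<close>, is the phase correction in \<open>pi_heis_pi_heis\<close>. On the
  horizontal part of \<open>g\<close> the frame turns \<open>J_map\<close> into multiplication by i,
  and central parts do not affect either side.\<close>

lemma inner_br: "\<mu> \<bullet> br g g' = - norm \<mu> * Im (cdot (coord g) (coord g'))"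
proof -
  obtain P where P: "P g \<in> lie_center br" "g - P g \<in> horizontal br"
    using center_projection by metis
  define V where "V = g - P g"
  have "\<mu> \<bullet> br g g' = \<mu> \<bullet> br V g'"
    using P by (simp add: V_def br_simps)
  also have "\<dots> = J_map br \<mu> V \<bullet> g'"
    by (simp add: J_map_inner)
  also have "\<dots> = norm \<mu> * (R \<mu> (\<i> *s coord V) \<bullet> g')"
    using P by (simp add: V_def[symmetric] J_map_R)
  also have "R \<mu> (\<i> *s coord V) \<bullet> g' = (\<i> *s coord V) \<bullet> coord g'"
    by (rule adjoint_works[OF linear_R, symmetric])
  also have "coord V = coord g"
    using P by (simp add: V_def linear_diff[OF linear_coord] coord_center)
  finally show ?thesis
    by (simp add: inner_i_smult)
qed

lemma pi_rep_hmult: "pi_rep R \<mu> (hmult br g g') F = pi_rep R \<mu> g (pi_rep R \<mu> g' F)"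
proof -
  have "coord (hmult br g g') = coord g + coord g'"
    by (simp add: hmult_def linear_add[OF linear_coord] linear_scale[OF linear_coord] coord_center)
  moreover have "(\<mu> \<bullet> hmult br g g') / norm \<mu>
      = (\<mu> \<bullet> g) / norm \<mu> + (\<mu> \<bullet> g') / norm \<mu> - Im (cdot (coord g) (coord g')) / 2"
    using \<mu>_nonzero by (simp add: hmult_def inner_add_right inner_br add_divide_distrib diff_divide_distrib)
  ultimately show ?thesis
    using \<mu>_nonzero by (simp add: pi_rep_def pi_heis_pi_heis)
qed

lemma pi_rep_zero: "pi_rep R \<mu> 0 F = F"
  by (simp add: pi_rep_def linear_0[OF linear_coord] pi_heis_zero)

lemma pi_rep_fock: "F \<in> fock \<Longrightarrow> pi_rep R \<mu> g F \<in> fock"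
  using \<mu>_nonzero by (simp add: pi_rep_def pi_heis_fock)

lemma fock_norm_pi_rep: "F \<in> fock \<Longrightarrow> fock_norm (pi_rep R \<mu> g F) = fock_norm F"
  using \<mu>_nonzero by (simp add: pi_rep_def fock_norm_pi_heis)

lemma fock_inner_pi_rep: "F \<in> fock \<Longrightarrow> K \<in> fock \<Longrightarrow> fock_inner (pi_rep R \<mu> g F) (pi_rep R \<mu> g K) = fock_inner F K"
  using \<mu>_nonzero by (simp add: pi_rep_def fock_inner_pi_heis)

text \<open>The operators preserve the inner product and have an explicit inverse, since the group
  inverse of \<open>g\<close> is \<open>- g\<close>.\<close>

lemma fock_adjoint_pi_rep:
  assumes F: "F \<in> fock"
  shows "fock_adjoint (pi_rep R \<mu> g) F = pi_rep R \<mu> (- g) F"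
  unfolding fock_adjoint_def
proof (rule the_equality)
  have cancel: "pi_rep R \<mu> g (pi_rep R \<mu> (- g) F) = F"
    by (simp add: pi_rep_hmult[symmetric] pi_rep_zero)
  show adj: "pi_rep R \<mu> (- g) F \<in> fock \<and> (\<forall>K\<in>fock. fock_inner (pi_rep R \<mu> (- g) F) K = fock_inner F (pi_rep R \<mu> g K))"
    using fock_inner_pi_rep[OF pi_rep_fock[OF F, of "- g"], of _ g] F by (simp add: pi_rep_fock cancel)
  show "H = pi_rep R \<mu> (- g) F" if "H \<in> fock \<and> (\<forall>K\<in>fock. fock_inner H K = fock_inner F (pi_rep R \<mu> g K))" for H
    using that adj by (intro fock_eqI) auto
qed

text \<open>Continuity jointly in the group element and the point gives the joint measurability that
  Fubini requires.\<close>

lemma pi_rep_continuous: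
  assumes F: "F \<in> fock"
  shows "continuous_on UNIV (\<lambda>p. pi_rep R \<mu> (fst p) F (snd p))"
proof -
  have F': "continuous_on UNIV F"
    by (rule cn_holomorphic_continuous[OF fock_holomorphic[OF F]])
  have coord: "continuous_on UNIV (\<lambda>p :: 'g \<times> (complex ^ 'n). coord (fst p))"
    by (rule linear_continuous_on_compose[OF _ linear_coord]) (rule continuous_on_fst[OF continuous_on_id])
  have shift: "continuous_on UNIV (\<lambda>p :: 'g \<times> (complex ^ 'n). F (snd p + r *\<^sub>R coord (fst p)))" for r
    by (rule continuous_on_compose2[OF F'])
      (simp_all add: continuous_on_add continuous_on_scaleR continuous_on_snd continuous_on_id coord)
  have phase: "continuous_on UNIV (\<lambda>p :: 'g \<times> (complex ^ 'n). r * (\<mu> \<bullet> fst p / norm \<mu>))" for r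
    using \<mu>_nonzero by (intro continuous_on_mult continuous_on_divide continuous_on_inner continuous_on_fst
        continuous_on_id continuous_on_const) simp
  have pairing: "continuous_on UNIV (\<lambda>p :: 'g \<times> (complex ^ 'n). \<Sum>i\<in>UNIV. snd p $ i * cnj (coord (fst p) $ i))"
    by (intro continuous_on_sum continuous_on_mult continuous_on_cnj continuous_on_component
        continuous_on_snd continuous_on_id coord)
  show ?thesis
    unfolding pi_rep_def pi_heis_eq pi_factor_def cdot_def
    by (intro continuous_on_mult continuous_on_exp continuous_on_diff continuous_on_of_real
        continuous_on_power continuous_on_norm continuous_on_const shift phase pairing coord)
qed

lemma pi_rep_section_continuous:
  assumes "F \<in> fock"
  shows "continuous_on UNIV (\<lambda>g. pi_rep R \<mu> g F \<zeta>)"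
proof -
  have "continuous_on UNIV (\<lambda>g :: 'g. (g, \<zeta>))"
    by (intro continuous_on_Pair continuous_on_id continuous_on_const)
  from continuous_on_compose2[OF pi_rep_continuous[OF assms] this] show ?thesis
    by simp
qed

lemma pi_rep_contractions:
  assumes \<phi>: "\<phi> \<in> borel_measurable M"
  shows "fock_contractions M (\<lambda>x. pi_rep R \<mu> (\<phi> x))"
  unfolding fock_contractions_def
proof (intro ballI conjI allI)
  fix F :: "complex ^ 'n \<Rightarrow> complex" assume F: "F \<in> fock"
  have "(\<lambda>p. (\<phi> (fst p), snd p)) \<in> borel_measurable (M \<Otimes>\<^sub>M lborel)"
    using \<phi> by (intro borel_measurable_Pair measurable_compose[OF measurable_fst]) simp_all
  from measurable_compose[OF this borel_measurable_continuous_onI[OF pi_rep_continuous[OF F]]]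
  show "(\<lambda>p. pi_rep R \<mu> (\<phi> (fst p)) F (snd p)) \<in> borel_measurable (M \<Otimes>\<^sub>M lborel)"
    by simp
  fix x
  show "pi_rep R \<mu> (\<phi> x) F \<in> fock" "fock_norm (pi_rep R \<mu> (\<phi> x) F) \<le> fock_norm F"
    using F by (simp_all add: pi_rep_fock fock_norm_pi_rep)
  show "pi_rep R \<mu> (\<phi> x) (\<lambda>\<zeta>. F \<zeta> + H \<zeta>) = (\<lambda>\<zeta>. pi_rep R \<mu> (\<phi> x) F \<zeta> + pi_rep R \<mu> (\<phi> x) H \<zeta>)" for H
    by (simp add: pi_rep_def pi_heis_eq fun_eq_iff distrib_left)
  show "pi_rep R \<mu> (\<phi> x) (\<lambda>\<zeta>. c * F \<zeta>) = (\<lambda>\<zeta>. c * pi_rep R \<mu> (\<phi> x) F \<zeta>)" for c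
    by (simp add: pi_rep_def pi_heis_eq fun_eq_iff mult.left_commute)
qed

lemma fourier_op_lborel:
  assumes f: "integrable lborel f" and F: "F \<in> fock"
  shows "fourier_op lborel f (pi_rep R \<mu>) F = (\<lambda>\<zeta>. \<integral>g. f g * pi_rep R \<mu> (- g) F \<zeta> \<partial>lborel)"
proof -
  interpret fock_family lborel f "\<lambda>g. pi_rep R \<mu> (- g) F" "fock_norm F"
    using pi_rep_contractions[of uminus lborel] f F
    by (intro fock_contractions_family lborel.sigma_finite_measure_axioms) simp_all
  have "op_integral lborel (\<lambda>x F \<zeta>. f x * fock_adjoint (pi_rep R \<mu> x) F \<zeta>) F = integral_op"
    by (rule op_integral_eqI[OF integral_op_fock])
      (use has_bochner_integral_pairing in \<open>simp add: fock_adjoint_pi_rep[OF F]\<close>)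
  then show ?thesis
    by (simp add: fourier_op_def integral_op_def[abs_def])
qed

lemma fock_bounded_fourier_op_lborel:
  assumes "integrable lborel f"
  shows "fock_bounded (fourier_op lborel f (pi_rep R \<mu>))"
  by (rule fock_bounded_integral[OF pi_rep_contractions[of uminus lborel] lborel.sigma_finite_measure_axioms assms])
    (simp_all add: fourier_op_lborel[OF assms])

text \<open>Matrix coefficients must be measurable on the group before their integrals can be
  transferred to the quotient.\<close>

lemma fock_inner_pi_rep_measurable:
  assumes F: "F \<in> fock" and K: "K \<in> fock"
  shows "(\<lambda>g. fock_inner (pi_rep R \<mu> (- g) F) K) \<in> borel_measurable borel"
proof -
  have "(\<lambda>p. pi_rep R \<mu> (- fst p) F (snd p)) \<in> borel_measurable (borel \<Otimes>\<^sub>M lborel)"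
    using pi_rep_contractions[of uminus "borel :: 'g measure"] F by (simp add: fock_contractions_def)
  moreover have "(\<lambda>\<zeta>. cnj (K \<zeta>)) \<in> borel_measurable borel"
    using fock_holomorphic[OF K] by (intro borel_measurable_continuous_onI continuous_intros cn_holomorphic_continuous)
  ultimately show ?thesis
    unfolding fock_inner_eq by measurable
qed

end

section \<open>The operator-valued Fourier transform on the quotient\<close>

locale h_type_transform = h_type_xray br l \<nu> + h_type_frame br R \<mu>
  for br :: "'g::euclidean_space \<Rightarrow> 'g \<Rightarrow> 'g" and l \<nu> and R :: "'g \<Rightarrow> complex ^ 'n \<Rightarrow> 'g" and \<mu> +
  fixes k :: int
  assumes resonance: "l \<bullet> \<mu> = 2 * of_int k * norm l ^ 3"
begin

text \<open>By \<open>resonance\<close> the pairing of \<open>\<mu>\<close> with the period is 2 pi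
  k, so the central phase is unchanged, while the frame coordinates of the central period
  vanish.\<close>

lemma pi_rep_period: "pi_rep R \<mu> (g + period) = pi_rep R \<mu> g"
proof -
  have "\<mu> \<bullet> period = 2 * pi * of_int k"
    using resonance l_nonzero
    by (simp add: period_def sgn_div_norm inner_commute[of \<mu>] field_simps power2_eq_square power3_eq_cube)
  then have one: "exp (\<i> * of_real (\<mu> \<bullet> period)) = 1"
    using exp_integer_2pi[of "of_int k"] by (simp add: mult_ac)
  have cancel: "norm \<mu> * (x / norm \<mu>) = x" for x
    using \<mu>_nonzero by simp
  have "exp (\<i> * of_real (\<mu> \<bullet> (g + period)) - a - b) = exp (\<i> * of_real (\<mu> \<bullet> g) - a - b)" for a b :: complex
  proof -
    have "\<i> * of_real (\<mu> \<bullet> (g + period)) - a - b = (\<i> * of_real (\<mu> \<bullet> g) - a - b) + \<i> * of_real (\<mu> \<bullet> period)"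
      by (simp add: inner_add_right algebra_simps)
    then show ?thesis
      by (simp only: exp_add one mult_1_right)
  qed
  then show ?thesis
    by (intro ext)
      (simp only: pi_rep_def pi_heis_eq pi_factor_def linear_add[OF linear_coord] coord_center period_center cancel add_0_right)
qed

lemma descend_pi_rep: "descend (pi_rep R \<mu>) (coset g) = pi_rep R \<mu> g"
  by (rule descend_coset) (rule pi_rep_period)

lemma pi_rep_uminus_period: "pi_rep R \<mu> (- (g + period)) = pi_rep R \<mu> (- g)"
  using pi_rep_period[of "- (g + period)"] by simp

lemma integrable_slab_line_integral:
  assumes f: "integrable lborel f"
  shows "integrable lborel (\<lambda>g. indicator slab g *\<^sub>R line_integral f g)"
proof -
  have [measurable]: "f \<in> borel_measurable borel"
    using f by (simp add: borel_measurable_integrable)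
  have "has_bochner_integral (quot_haar br l) (xray br \<nu> l f) (\<integral>C. xray br \<nu> l f C \<partial>quot_haar br l)"
    using integrable_xray[OF f] by (simp add: has_bochner_integral_iff)
  then show ?thesis
    by (subst (asm) has_bochner_integral_quot_haar) (simp_all add: xray_coset has_bochner_integral_iff)
qed

text \<open>The pointwise integral is formed on the group, with the line integral cut off to the
  slab as coefficient; its pairings with each \<open>K\<close> are then carried over to the
  quotient.\<close>

lemma fourier_op_quot:
  assumes f: "integrable lborel f" and F: "F \<in> fock"
  shows "fourier_op (quot_haar br l) (xray br \<nu> l f) (descend (pi_rep R \<mu>)) F
    = (\<lambda>\<zeta>. \<integral>g. (indicator slab g *\<^sub>R line_integral f g) * pi_rep R \<mu> (- g) F \<zeta> \<partial>lborel)"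
proof -
  have [measurable]: "f \<in> borel_measurable borel"
    using f by (simp add: borel_measurable_integrable)
  interpret fock_family lborel "\<lambda>g. indicator slab g *\<^sub>R line_integral f g" "\<lambda>g. pi_rep R \<mu> (- g) F" "fock_norm F"
    using pi_rep_contractions[of uminus lborel] integrable_slab_line_integral[OF f] F
    by (intro fock_contractions_family lborel.sigma_finite_measure_axioms) simp_all
  have "op_integral (quot_haar br l) (\<lambda>C F \<zeta>. xray br \<nu> l f C * fock_adjoint (descend (pi_rep R \<mu>) C) F \<zeta>) F = integral_op"
  proof (rule op_integral_eqI[OF integral_op_fock])
    fix K :: "complex ^ 'n \<Rightarrow> complex" assume K: "K \<in> fock"
    have eq: "fock_inner (\<lambda>\<zeta>. xray br \<nu> l f (coset g) * fock_adjoint (descend (pi_rep R \<mu>) (coset g)) F \<zeta>) K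
        = line_integral f g * fock_inner (pi_rep R \<mu> (- g) F) K" for g
      by (simp add: xray_coset descend_pi_rep fock_adjoint_pi_rep[OF F] fock_inner_scale_left)
    have "has_bochner_integral lborel (\<lambda>g. indicator slab g *\<^sub>R (line_integral f g * fock_inner (pi_rep R \<mu> (- g) F) K)) (fock_inner integral_op K)"
    proof -
      have "fock_inner (\<lambda>\<zeta>. (indicator slab g *\<^sub>R line_integral f g) * pi_rep R \<mu> (- g) F \<zeta>) K
          = indicator slab g *\<^sub>R (line_integral f g * fock_inner (pi_rep R \<mu> (- g) F) K)" for g
        unfolding fock_inner_scale_left by simp
      then show ?thesis
        using has_bochner_integral_pairing[OF K] by (simp only:)
    qed
    moreover have "(\<lambda>g. line_integral f g * fock_inner (pi_rep R \<mu> (- g) F) K) \<in> borel_measurable borel"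
      using fock_inner_pi_rep_measurable[OF F K] by simp
    ultimately show "has_bochner_integral (quot_haar br l)
        (\<lambda>C. fock_inner (\<lambda>\<zeta>. xray br \<nu> l f C * fock_adjoint (descend (pi_rep R \<mu>) C) F \<zeta>) K) (fock_inner integral_op K)"
      by (subst has_bochner_integral_quot_haar) (simp_all add: eq)
  qed
  then show ?thesis
    by (simp add: fourier_op_def integral_op_def[abs_def])
qed

lemma fock_bounded_fourier_op_quot:
  assumes f: "integrable lborel f"
  shows "fock_bounded (fourier_op (quot_haar br l) (xray br \<nu> l f) (descend (pi_rep R \<mu>)))"
  by (rule fock_bounded_integral[OF pi_rep_contractions[of uminus lborel] lborel.sigma_finite_measure_axioms
        integrable_slab_line_integral[OF f]])
    (simp_all add: fourier_op_quot[OF f])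

abbreviation "interval \<equiv> restrict_space lborel {0..time}"

lemma sigma_finite_interval: "sigma_finite_measure interval"
  by (intro sigma_finite_measure_restrict_space lborel.sigma_finite_measure_axioms) simp

lemma geo_measurable_interval: "geo \<in> borel_measurable interval"
  using geo_measurable by (intro measurable_restrict_space1) simp

lemma integrable_interval_const: "integrable interval (\<lambda>_. c :: complex)"
  using time_pos by (simp add: integrable_restrict_space)

lemma multiplier_eq:
  assumes F: "F \<in> fock"
  shows "multiplier br R \<nu> l \<mu> F = (\<lambda>\<zeta>. \<integral>s. of_real (norm l / (2 * pi)) * pi_rep R \<mu> (geo s) F \<zeta> \<partial>interval)"
proof -
  interpret fock_family interval "\<lambda>_. 1" "\<lambda>s. pi_rep R \<mu> (geo s) F" "fock_norm F"
    using pi_rep_contractions[OF geo_measurable_interval] F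
    by (intro fock_contractions_family sigma_finite_interval integrable_interval_const) simp_all
  have "op_integral interval (\<lambda>s. pi_rep R \<mu> (geo s)) F = integral_op"
    by (rule op_integral_eqI[OF integral_op_fock]) (use has_bochner_integral_pairing in simp)
  then show ?thesis
    by (simp add: fun_eq_iff multiplier_def integral_op_def time_def[symmetric])
qed

lemma fock_bounded_multiplier: "fock_bounded (multiplier br R \<nu> l \<mu>)"
  by (rule fock_bounded_integral[OF pi_rep_contractions[OF geo_measurable_interval] sigma_finite_interval
        integrable_interval_const])
    (rule multiplier_eq)

lemma fourier_op_xray:
  assumes f: "integrable lborel f" and F: "F \<in> fock"
  shows "fourier_op (quot_haar br l) (xray br \<nu> l f) (descend (pi_rep R \<mu>)) F =
    (\<lambda>\<zeta>. of_real (2 * pi / norm l) * (multiplier br R \<nu> l \<mu> \<circ> fourier_op lborel f (pi_rep R \<mu>)) F \<zeta>)"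
proof
  fix \<zeta>
  have [measurable]: "f \<in> borel_measurable borel"
    using f by (simp add: borel_measurable_integrable)
  define H where "H = fourier_op lborel f (pi_rep R \<mu>) F"
  have H: "H \<in> fock"
    using fock_bounded_fourier_op_lborel[OF f] F by (simp add: H_def fock_bounded_def)
  define \<psi> where "\<psi> g = pi_rep R \<mu> (- g) F \<zeta>" for g
  have \<psi>_meas[measurable]: "\<psi> \<in> borel_measurable borel"
    unfolding \<psi>_def
    by (rule measurable_compose[OF _ borel_measurable_continuous_onI[OF pi_rep_section_continuous[OF F]]]) simp
  have "has_bochner_integral (quot_haar br l) (\<lambda>C. xray br \<nu> l f C * (descend \<psi>) C)
      (\<integral>s. (\<integral>g. f g * \<psi> (hmult br g (- geo s)) \<partial>lborel) \<partial>interval)"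
  proof (rule has_bochner_integral_xray[OF f \<psi>_meas])
    show "norm (\<psi> g) \<le> fock_eval_bound \<zeta> * fock_norm F" for g
      using fock_eval_le[OF pi_rep_fock[OF F]] by (simp add: \<psi>_def fock_norm_pi_rep[OF F])
    show "\<psi> (g + period) = \<psi> g" for g
      unfolding \<psi>_def pi_rep_uminus_period ..
    then show "descend \<psi> (coset g) = \<psi> g" for g
      by (rule descend_coset)
  qed
  moreover have "descend \<psi> (coset g) = \<psi> g" for g
    by (rule descend_coset) (simp only: \<psi>_def pi_rep_uminus_period)
  ultimately have "has_bochner_integral lborel (\<lambda>g. indicator slab g *\<^sub>R (line_integral f g * \<psi> g))
      (\<integral>s. (\<integral>g. f g * \<psi> (hmult br g (- geo s)) \<partial>lborel) \<partial>interval)"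
    by (subst (asm) has_bochner_integral_quot_haar) (simp_all add: xray_coset)
  then have "fourier_op (quot_haar br l) (xray br \<nu> l f) (descend (pi_rep R \<mu>)) F \<zeta>
      = (\<integral>s. (\<integral>g. f g * \<psi> (hmult br g (- geo s)) \<partial>lborel) \<partial>interval)"
    by (simp add: fourier_op_quot[OF f F] \<psi>_def has_bochner_integral_integral_eq)
  also have "\<dots> = (\<integral>s. pi_rep R \<mu> (geo s) H \<zeta> \<partial>interval)"
  proof (rule Bochner_Integration.integral_cong)
    fix s
    let ?h = "norm \<mu>" and ?z = "coord (geo s)" and ?t = "\<mu> \<bullet> geo s / norm \<mu>"
    \<comment> \<open>The operator of \<open>geo s\<close> multiplies by a factor and shifts the
      argument. At a fixed point it therefore passes through the integral over \<open>g\<close>,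
      which becomes the value of \<open>H\<close> at the shifted point.\<close>
    have "\<psi> (hmult br g (- geo s)) = pi_factor ?h ?z ?t \<zeta> * pi_rep R \<mu> (- g) F (\<zeta> + sqrt (?h / 2) *\<^sub>R ?z)" for g
      by (simp add: \<psi>_def hmult_inverse pi_rep_hmult) (simp add: pi_rep_def[of R \<mu> "geo s"] pi_heis_eq)
    then have "(\<integral>g. f g * \<psi> (hmult br g (- geo s)) \<partial>lborel)
        = (\<integral>g. pi_factor ?h ?z ?t \<zeta> * (f g * pi_rep R \<mu> (- g) F (\<zeta> + sqrt (?h / 2) *\<^sub>R ?z)) \<partial>lborel)"
      by (simp add: mult.left_commute)
    also have "\<dots> = pi_factor ?h ?z ?t \<zeta> * H (\<zeta> + sqrt (?h / 2) *\<^sub>R ?z)"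
      unfolding H_def fourier_op_lborel[OF f F] by (rule integral_mult_right_zero)
    finally show "(\<integral>g. f g * \<psi> (hmult br g (- geo s)) \<partial>lborel) = pi_rep R \<mu> (geo s) H \<zeta>"
      by (simp add: pi_rep_def pi_heis_eq)
  qed simp
  \<comment> \<open>The prefactor cancels the averaging constant \<open>norm l / (2 * pi)\<close>
    contained in \<open>multiplier\<close>.\<close>
  also have "\<dots> = of_real (2 * pi / norm l) * multiplier br R \<nu> l \<mu> H \<zeta>"
    using l_nonzero by (simp add: multiplier_eq[OF H])
  finally show "fourier_op (quot_haar br l) (xray br \<nu> l f) (descend (pi_rep R \<mu>)) F \<zeta>
      = of_real (2 * pi / norm l) * (multiplier br R \<nu> l \<mu> \<circ> fourier_op lborel f (pi_rep R \<mu>)) F \<zeta>"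
    by (simp add: H_def)
qed

end

theorem theorem2p5:
  fixes br :: "'g::euclidean_space \<Rightarrow> 'g \<Rightarrow> 'g"
    and R :: "'g \<Rightarrow> complex ^ 'n \<Rightarrow> 'g"
    and f :: "'g \<Rightarrow> complex"
    and l \<nu> :: 'g
  assumes "h_type br"
    and "dim (horizontal br) = 2 * CARD('n)"
    and "frame_family br R"
    and "integrable lborel f"
    and "l \<in> lie_center br" and "l \<noteq> 0"
    and "\<nu> \<in> horizontal br" and "norm \<nu> = 1"
  shows "integrable (quot_haar br l) (xray br \<nu> l f) \<and>
    (\<forall>\<eta>\<in>horizontal br.
       fourier_char (quot_haar br l) (xray br \<nu> l f) (descend (pi_char \<eta>)) =
       of_real (2 * pi / norm l *
         bessel_J0 (norm (orth_proj (span {\<nu>, J_map br (sgn l) \<nu>}) \<eta>) / norm l)) *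
       fourier_char lborel f (pi_char \<eta>)) \<and>
    (\<forall>\<mu>\<in>lie_center br - {0}. (\<exists>k::int. l \<bullet> \<mu> = 2 * of_int k * norm l ^ 3) \<longrightarrow>
       fock_bounded (fourier_op (quot_haar br l) (xray br \<nu> l f) (descend (pi_rep R \<mu>))) \<and>
       fock_bounded (multiplier br R \<nu> l \<mu>) \<and>
       fock_bounded (fourier_op lborel f (pi_rep R \<mu>)) \<and>
       (\<forall>F\<in>fock.
          fourier_op (quot_haar br l) (xray br \<nu> l f) (descend (pi_rep R \<mu>)) F =
          (\<lambda>\<zeta>. of_real (2 * pi / norm l) *
             (multiplier br R \<nu> l \<mu> \<circ> fourier_op lborel f (pi_rep R \<mu>)) F \<zeta>)))"
proof (intro conjI ballI impI)
  interpret h_type_xray br l \<nu>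
    by unfold_locales (use assms in auto)
  show "integrable (quot_haar br l) (xray br \<nu> l f)"
    by (rule integrable_xray) fact
  show "fourier_char (quot_haar br l) (xray br \<nu> l f) (descend (pi_char \<eta>)) =
      of_real (2 * pi / norm l *
        bessel_J0 (norm (orth_proj (span {\<nu>, J_map br (sgn l) \<nu>}) \<eta>) / norm l)) *
      fourier_char lborel f (pi_char \<eta>)" if "\<eta> \<in> horizontal br" for \<eta>
    by (rule fourier_char_xray) fact+
  fix \<mu> assume \<mu>: "\<mu> \<in> lie_center br - {0}" and "\<exists>k::int. l \<bullet> \<mu> = 2 * of_int k * norm l ^ 3"
  then obtain k :: int where "l \<bullet> \<mu> = 2 * of_int k * norm l ^ 3"
    by blast
  then interpret h_type_transform br l \<nu> R \<mu> k
    by unfold_locales (use assms \<mu> in auto)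
  show "fock_bounded (fourier_op (quot_haar br l) (xray br \<nu> l f) (descend (pi_rep R \<mu>)))"
    by (rule fock_bounded_fourier_op_quot) fact
  show "fock_bounded (multiplier br R \<nu> l \<mu>)"
    by (rule fock_bounded_multiplier)
  show "fock_bounded (fourier_op lborel f (pi_rep R \<mu>))"
    by (rule fock_bounded_fourier_op_lborel) fact
  show "fourier_op (quot_haar br l) (xray br \<nu> l f) (descend (pi_rep R \<mu>)) F =
      (\<lambda>\<zeta>. of_real (2 * pi / norm l) *
        (multiplier br R \<nu> l \<mu> \<circ> fourier_op lborel f (pi_rep R \<mu>)) F \<zeta>)" if "F \<in> fock" for F
    by (rule fourier_op_xray) fact+
qed

end
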